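(* Consider the nonlinear Schrödinger-type system for complex functions $p,q,r$ and a real function $u$ of $(t,z,\bar z)$, $$(\mathrm{NLS})\quad\begin{cases} iq_t+q_{z\bar z}-2uq+2(\bar p q)_z-2pq_{\bar z}-4|p|^2q=0,\\ ir_t-r_{z\bar z}+2ur+2(\bar p r)_z-2pr_{\bar z}+4|p|^2r=0,\\ ip_t+(qr)_{\bar z}-u_z=0,\\ \bar p_z+p_{\bar z}=-|q|^2+|r|^2,\\ -\bar r_z+q_{\bar z}=-2(p\bar r+\bar p q),\end{cases}$$ and the equation of the Schrödinger maps from $\mathbf{R}^2$ to the hyperbolic 2-space $\mathbf{H}^2$ in matrix form, $$(\mathrm{SM})\quad S_t=-\tfrac12[S,S_{z\bar z}],\qquad S=\begin{pmatrix} is_3 & s_1+is_2\\ s_1-is_2 & -is_3\end{pmatrix}\in su(1,1),\quad s_1^2+s_2^2-s_3^2=-1,\ s_3<0 .$$ (i) For any $C^2$-solution $(p,q,r,u)$ to (NLS), there is a matrix $C^2$-function $G\in SU(1,1)$ such that $(p,q,r,u)$ is gauge transformed by $G$ to a $C^3$-solution $S$ to (SM). (ii) Moreover, if the gauge matrix $G$ is required to satisfy $G|_{t=z=\bar z=0}=I$, then any $C^m$-solution ($m\ge 2$) to (NLS) corresponds uniquely to a $C^{m+1}$-solution to (SM), and vice versa.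
   Context: Coordinates on $\mathbf{R}^2$ are $(x_1,x_2)$, with $z=\frac{x_1+ix_2}{2}$ and $\bar z=\frac{x_1-ix_2}{2}$ (note the nonstandard factor $\frac12$), so that $\partial_z=\partial_{x_1}-i\partial_{x_2}$, $\partial_{\bar z}=\partial_{x_1}+i\partial_{x_2}$ and $\partial_z\partial_{\bar z}=\partial_{x_1}^2+\partial_{x_2}^2$. Functions of $(t,z,\bar z)$ are just functions of $(t,x_1,x_2)$; subscripts denote partial derivatives, and $\bar p_z$, $\bar r_z$ mean $\partial_z(\bar p)$, $\partial_z(\bar r)$. $SU(1,1)$ is the group of matrices $\begin{pmatrix}A&B\\ \bar B&\bar A\end{pmatrix}$ with $A,B\in\mathbf{C}$, $|A|^2-|B|^2=1$, and $su(1,1)$ is its Lie algebra, consisting of the matrices $\begin{pmatrix} ia& w\\ \bar w&-ia\end{pmatrix}$ with $a\in\mathbf{R}$, $w\in\mathbf{C}$. $\sigma_3=\mathrm{diag}(1,-1)$, $I$ is the identity matrix, and $[X,Y]=XY-YX$. Gauge transformation: an $SU(1,1)$-valued function $G$ gauge transforms $(p,q,r,u)$ to $S$, and $S$ to $(p,q,r,u)$ (one then says that $S$ and $(p,q,r,u)$ correspond to each other by the gauge transformation with $G$), if $$S=-iG\sigma_3G^{-1},\qquad G_z=-G\begin{pmatrix} p&q\\ r&-p\end{pmatrix},\qquad G_{\bar z}=G\begin{pmatrix}\bar p&-\bar r\\ -\bar q&-\bar p\end{pmatrix},$$ $$G_t=iG\begin{pmatrix} u&-q_{\bar z}-2\bar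 p q\\ r_{\bar z}-2\bar p r&-u\end{pmatrix}.$$
   Formalization: For ordinary C^m the C^{m+1} claim for S excludes the pure t-derivative of order m+1 (also parabolic C^m, then u of class C^{m-1}); the converse assumes S(0)=-iσ₃, and uniqueness of (p,q,r,u) is only up to G→G diag(e^{iθ},e^{-iθ}), θ(0)=0. *)

theory Defs
  imports "HOL-Analysis.Analysis"
begin

text \<open>Points are triples \<open>(t, x\<^sub>1, x\<^sub>2)\<close> of time and space coordinates.\<close>

type_synonym pt = "real \<times> real \<times> real"

definition dt :: "(pt \<Rightarrow> 'a::real_normed_vector) \<Rightarrow> pt \<Rightarrow> 'a" where
  "dt f = (\<lambda>(t, x1, x2). vector_derivative (\<lambda>s. f (s, x1, x2)) (at t))"

definition d1 :: "(pt \<Rightarrow> 'a::real_normed_vector) \<Rightarrow> pt \<Rightarrow> 'a" where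
  "d1 f = (\<lambda>(t, x1, x2). vector_derivative (\<lambda>s. f (t, s, x2)) (at x1))"

definition d2 :: "(pt \<Rightarrow> 'a::real_normed_vector) \<Rightarrow> pt \<Rightarrow> 'a" where
  "d2 f = (\<lambda>(t, x1, x2). vector_derivative (\<lambda>s. f (t, x1, s)) (at x2))"

definition has_dt :: "(pt \<Rightarrow> 'a::real_normed_vector) \<Rightarrow> bool" where
  "has_dt f \<longleftrightarrow> (\<forall>t x1 x2. (\<lambda>s. f (s, x1, x2)) differentiable (at t))"

definition has_d1 :: "(pt \<Rightarrow> 'a::real_normed_vector) \<Rightarrow> bool" where
  "has_d1 f \<longleftrightarrow> (\<forall>t x1 x2. (\<lambda>s. f (t, s, x2)) differentiable (at x1))"

definition has_d2 :: "(pt \<Rightarrow> 'a::real_normed_vector) \<Rightarrow> bool" where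
  "has_d2 f \<longleftrightarrow> (\<forall>t x1 x2. (\<lambda>s. f (t, x1, s)) differentiable (at x2))"

text \<open>
  \<open>Ck w k f\<close>: all partial derivatives of \<open>f\<close>, in any order, with \<open>a\<close> time derivatives and
  \<open>b\<close> space derivatives and \<open>w * a + b \<le> k\<close>, exist everywhere and are continuous.  So \<open>w\<close> is
  the number of space derivatives that one time derivative counts for: \<open>w = 1\<close> is the ordinary
  class \<open>C\<^sup>k\<close> on \<open>\<real> \<times> \<real>\<^sup>2\<close>, and \<open>w = 2\<close> is the parabolic class adapted to
  equations of the form \<open>\<partial>\<^sub>t = second order in space\<close>.
  The guard \<open>0 < w\<close> only serves termination.
\<close>

function Ck :: "nat \<Rightarrow> nat \<Rightarrow> (pt \<Rightarrow> 'a::real_normed_vector) \<Rightarrow> bool" where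
  "Ck w k f \<longleftrightarrow>
     continuous_on UNIV f \<and>
     (0 < k \<longrightarrow> has_d1 f \<and> has_d2 f) \<and>
     (0 < k \<longrightarrow> Ck w (k - 1) (d1 f)) \<and>
     (0 < k \<longrightarrow> Ck w (k - 1) (d2 f)) \<and>
     (0 < w \<and> w \<le> k \<longrightarrow> has_dt f) \<and>
     (0 < w \<and> w \<le> k \<longrightarrow> Ck w (k - w) (dt f))"
  by pat_completeness auto
termination
  by (relation "Wellfounded.measure (\<lambda>(w, k, f). k)") auto

declare Ck.simps [simp del]

text \<open>
  The complex coordinate is \<open>z = (x\<^sub>1 + \<i> x\<^sub>2) / 2\<close>, hence no factor 1/2 in these operators.
\<close>

definition dz :: "(pt \<Rightarrow> complex) \<Rightarrow> pt \<Rightarrow> complex" where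
  "dz f x = d1 f x - \<i> * d2 f x"

definition dzb :: "(pt \<Rightarrow> complex) \<Rightarrow> pt \<Rightarrow> complex" where
  "dzb f x = d1 f x + \<i> * d2 f x"

type_synonym cmat = "complex^2^2"

definition mat2 :: "complex \<Rightarrow> complex \<Rightarrow> complex \<Rightarrow> complex \<Rightarrow> cmat" where
  "mat2 a b c d = vector [vector [a, b], vector [c, d]]"

definition cscale :: "complex \<Rightarrow> cmat \<Rightarrow> cmat" where
  "cscale c M = (\<chi> i j. c * M $ i $ j)"

definition mdz :: "(pt \<Rightarrow> cmat) \<Rightarrow> pt \<Rightarrow> cmat" where
  "mdz F x = d1 F x - cscale \<i> (d2 F x)"

definition mdzb :: "(pt \<Rightarrow> cmat) \<Rightarrow> pt \<Rightarrow> cmat" where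
  "mdzb F x = d1 F x + cscale \<i> (d2 F x)"

definition commutator :: "cmat \<Rightarrow> cmat \<Rightarrow> cmat" where
  "commutator X Y = X ** Y - Y ** X"

definition sigma3 :: cmat where
  "sigma3 = mat2 1 0 0 (-1)"

definition SU11 :: "cmat set" where
  "SU11 = {mat2 A B (cnj B) (cnj A) | A B. (cmod A)\<^sup>2 - (cmod B)\<^sup>2 = 1}"

definition su11 :: "cmat set" where
  "su11 = {mat2 (\<i> * of_real a) w (cnj w) (- \<i> * of_real a) | a w. True}"

definition hyperbolic_plane :: "cmat set" where
  "hyperbolic_plane =
     {S \<in> su11. \<exists>s1 s2 s3 :: real.
        S = mat2 (\<i> * of_real s3) (of_real s1 + \<i> * of_real s2)
                 (of_real s1 - \<i> * of_real s2) (- \<i> * of_real s3) \<and>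
        s1\<^sup>2 + s2\<^sup>2 - s3\<^sup>2 = -1 \<and> s3 < 0}"

definition NLS ::
  "(pt \<Rightarrow> complex) \<Rightarrow> (pt \<Rightarrow> complex) \<Rightarrow> (pt \<Rightarrow> complex) \<Rightarrow> (pt \<Rightarrow> real) \<Rightarrow> bool" where
  "NLS p q r u \<longleftrightarrow> (\<forall>x.
     \<i> * dt q x + dzb (dz q) x - 2 * of_real (u x) * q x
       + 2 * dz (\<lambda>y. cnj (p y) * q y) x - 2 * p x * dzb q x
       - 4 * of_real ((cmod (p x))\<^sup>2) * q x = 0 \<and>
     \<i> * dt r x - dzb (dz r) x + 2 * of_real (u x) * r x
       + 2 * dz (\<lambda>y. cnj (p y) * r y) x - 2 * p x * dzb r x
       + 4 * of_real ((cmod (p x))\<^sup>2) * r x = 0 \<and>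
     \<i> * dt p x + dzb (\<lambda>y. q y * r y) x - dz (\<lambda>y. of_real (u y)) x = 0 \<and>
     dz (\<lambda>y. cnj (p y)) x + dzb p x
       = - of_real ((cmod (q x))\<^sup>2) + of_real ((cmod (r x))\<^sup>2) \<and>
     - dz (\<lambda>y. cnj (r y)) x + dzb q x
       = - 2 * (p x * cnj (r x) + cnj (p x) * q x))"

text \<open>
  The field \<open>u\<close> is the diagonal part of \<open>-\<i> G\<^sup>-\<^sup>1 G\<^sub>t\<close>, whereas \<open>p\<close>, \<open>q\<close>, \<open>r\<close> are the
  entries of \<open>- G\<^sup>-\<^sup>1 G\<^sub>z\<close>.  With a time derivative of weight \<open>w\<close>, the regularity of \<open>u\<close> that
  goes with \<open>p, q, r\<close> of class \<open>m\<close> is therefore \<open>m + 1 - w\<close>; for \<open>w = 1\<close> all four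
  functions are of class \<open>C\<^sup>m\<close>.
\<close>

definition NLS_solution ::
  "nat \<Rightarrow> nat \<Rightarrow> (pt \<Rightarrow> complex) \<Rightarrow> (pt \<Rightarrow> complex) \<Rightarrow> (pt \<Rightarrow> complex) \<Rightarrow> (pt \<Rightarrow> real) \<Rightarrow> bool"
where
  "NLS_solution w m p q r u \<longleftrightarrow>
     Ck w m p \<and> Ck w m q \<and> Ck w m r \<and> Ck w (m + 1 - w) u \<and> NLS p q r u"

definition SM :: "(pt \<Rightarrow> cmat) \<Rightarrow> bool" where
  "SM S \<longleftrightarrow> (\<forall>x. S x \<in> hyperbolic_plane \<and>
     dt S x = cscale (- 1 / 2) (commutator (S x) (mdzb (mdz S) x)))"

definition SM_solution :: "nat \<Rightarrow> nat \<Rightarrow> (pt \<Rightarrow> cmat) \<Rightarrow> bool" where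
  "SM_solution w k S \<longleftrightarrow> Ck w k S \<and> SM S"

text \<open>
  The regularity of an \<open>S\<close> obtained from a \<open>C\<^sup>k\<^sup>-\<^sup>1\<close> solution of \<open>NLS\<close>.  For \<open>w = 2\<close> this is just
  \<open>SM_solution 2 k S\<close>.  For \<open>w = 1\<close> it says that all derivatives of order at most \<open>k\<close> are
  continuous, except possibly the pure time derivative of order \<open>k\<close>, which need not exist.
\<close>

definition SM_solution_space :: "nat \<Rightarrow> nat \<Rightarrow> (pt \<Rightarrow> cmat) \<Rightarrow> bool" where
  "SM_solution_space w k S \<longleftrightarrow>
     SM_solution 2 k S \<and> Ck w (k - 1) S \<and> Ck w (k - 1) (d1 S) \<and> Ck w (k - 1) (d2 S)"

definition gauge_transforms ::
  "(pt \<Rightarrow> cmat) \<Rightarrow> (pt \<Rightarrow> complex) \<Rightarrow> (pt \<Rightarrow> complex) \<Rightarrow> (pt \<Rightarrow> complex) \<Rightarrow> (pt \<Rightarrow> real)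
     \<Rightarrow> (pt \<Rightarrow> cmat) \<Rightarrow> bool"
where
  "gauge_transforms G p q r u S \<longleftrightarrow> (\<forall>x.
     G x \<in> SU11 \<and>
     S x = cscale (- \<i>) (G x ** sigma3 ** matrix_inv (G x)) \<and>
     mdz G x = - (G x ** mat2 (p x) (q x) (r x) (- p x)) \<and>
     mdzb G x = G x ** mat2 (cnj (p x)) (- cnj (r x)) (- cnj (q x)) (- cnj (p x)) \<and>
     dt G x = cscale \<i> (G x ** mat2 (of_real (u x)) (- dzb q x - 2 * cnj (p x) * q x)
                                     (dzb r x - 2 * cnj (p x) * r x) (- of_real (u x))))"

text \<open>Correspondence by a \<open>C\<^sup>2\<close> gauge matrix normalised at the origin.\<close>

definition corresponds ::
  "nat \<Rightarrow> (pt \<Rightarrow> complex) \<Rightarrow> (pt \<Rightarrow> complex) \<Rightarrow> (pt \<Rightarrow> complex) \<Rightarrow> (pt \<Rightarrow> real)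
     \<Rightarrow> (pt \<Rightarrow> cmat) \<Rightarrow> bool"
where
  "corresponds w p q r u S \<longleftrightarrow>
     (\<exists>G. Ck w 2 G \<and> G (0, 0, 0) = mat 1 \<and> gauge_transforms G p q r u S)"

text \<open>
  Replacing \<open>G\<close> by \<open>G diag(e\<^bsup>\<i>\<theta>\<^esup>, e\<^bsup>-\<i>\<theta>\<^esup>)\<close> with \<open>\<theta>\<close> real and \<open>\<theta>(0) = 0\<close> changes neither \<open>S\<close>
  nor the normalisation \<open>G(0) = I\<close>, and acts on \<open>(p, q, r, u)\<close> as follows.  This is the
  exact ambiguity of \<open>(p, q, r, u)\<close> for a given \<open>S\<close>.
\<close>

definition U1_equivalent ::
  "nat \<Rightarrow> nat
     \<Rightarrow> (pt \<Rightarrow> complex) \<Rightarrow> (pt \<Rightarrow> complex) \<Rightarrow> (pt \<Rightarrow> complex) \<Rightarrow> (pt \<Rightarrow> real)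
     \<Rightarrow> (pt \<Rightarrow> complex) \<Rightarrow> (pt \<Rightarrow> complex) \<Rightarrow> (pt \<Rightarrow> complex) \<Rightarrow> (pt \<Rightarrow> real) \<Rightarrow> bool"
where
  "U1_equivalent w m p q r u p' q' r' u' \<longleftrightarrow>
     (\<exists>\<theta> :: pt \<Rightarrow> real. Ck w (m + 1) \<theta> \<and> \<theta> (0, 0, 0) = 0 \<and>
        (\<forall>x. p' x = p x - \<i> * dz (\<lambda>y. of_real (\<theta> y)) x \<and>
             q' x = cis (- 2 * \<theta> x) * q x \<and>
             r' x = cis (2 * \<theta> x) * r x \<and>
             u' x = u x + dt \<theta> x))"

end

(*
  Writing G = ((a, b), (cnj b, cnj a)), the gauge equations say that the row (a, b) is parallel for
  a connection with values in su(1,1), and (NLS) is exactly the flatness of this connection.  Given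
  a solution of (NLS) a flat frame is obtained by solving linear ordinary differential equations
  first along the t-axis, then in x1, then in x2; in this order only derivatives of the
  coefficients occur that exist in the parabolic class as well (the t-component of the connection
  has no t-derivative there).  S = -i G sigma3 G^-1 solves (SM) because its time
  derivative and its commutator with its Laplacian are given by the same off-diagonal matrix.
  Conversely S has the explicit lift a = sqrt ((1 - s3) / 2), b = (s1 + i s2) / (2 i a), from which
  p, q, r, u are read off, and (NLS) is the equality of mixed derivatives.  Two lifts of the same S
  differ by a phase, which lifts to a real angle because the domain is simply connected.
*)

theory Submission
  imports Defs
begin

section \<open>Linear differential equations with parameters\<close>

text \<open>The obstacle in integrating the connection is regularity in the variables that are mere
  parameters of an ODE. Picard iteration gives continuity in the parameters but no
  differentiability; the latter is extracted from flatness, by comparing the solution with the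
  integral of its expected derivative. The second theme is the bookkeeping of derivatives.
  \<open>Ck 1 k\<close> is contained in \<open>Ck 2 k\<close>, so curvature, commutator and
  compatibility identities are proved for \<open>w = 2\<close> alone, and \<open>w\<close> matters
  mainly where a frame or a phase is bootstrapped from its own first order equations. These give one
  space derivative more than \<open>p\<close>, \<open>q\<close>, \<open>r\<close> have, but for
  \<open>w = 1\<close> no additional time derivative, because the time component contains
  \<open>dzb q\<close>. This is the origin of the class \<open>SM_solution_space\<close>. Gauge
  matrices in a correspondence are only of class \<open>Ck w 2\<close>, so uniqueness has to hold
  among frames of that class; it comes from invariant pairings of rows, which involve first
  derivatives only.\<close>

definition primitive :: "(real \<Rightarrow> 'a::banach) \<Rightarrow> real \<Rightarrow> 'a" where
  "primitive f x = x *\<^sub>R integral {0..1} (\<lambda>s. f (s * x))"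

lemma primitive_eq_diff:
  assumes "\<And>y. \<bar>y\<bar> \<le> \<bar>x\<bar> \<Longrightarrow> (g has_vector_derivative f y) (at y)"
  shows "primitive f x = g x - g 0"
proof -
  have "((\<lambda>s. x *\<^sub>R f (s * x)) has_integral g (1 * x) - g (0 * x)) {0..1}"
  proof (rule fundamental_theorem_of_calculus)
    fix s :: real assume s: "s \<in> {0..1}"
    then have "\<bar>s * x\<bar> \<le> \<bar>x\<bar>" by (simp add: abs_mult mult_left_le_one_le)
    then have d: "(g has_vector_derivative f (s * x)) (at (s * x))" by (rule assms)
    have "((\<lambda>s. s * x) has_vector_derivative x) (at s within {0..1})"
      by (auto intro!: derivative_eq_intros)
    from vector_diff_chain_within[OF this has_vector_derivative_at_within[OF d]]
    show "((\<lambda>s. g (s * x)) has_vector_derivative x *\<^sub>R f (s * x)) (at s within {0..1})"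
      by (simp add: o_def)
  qed simp
  from integral_unique[OF this] show ?thesis
    unfolding primitive_def by simp
qed

lemma primitive_0 [simp]: "primitive f 0 = 0"
  by (simp add: primitive_def)

lemma primitive_has_vector_derivative:
  assumes "continuous_on UNIV f"
  shows "(primitive f has_vector_derivative f x) (at x)"
proof -
  define R where "R = \<bar>x\<bar> + 1"
  obtain g where g: "\<And>y. y \<in> {-R..R} \<Longrightarrow> (g has_vector_derivative f y) (at y within {-R..R})"
    using antiderivative_continuous[OF continuous_on_subset[OF assms subset_UNIV]] by blast
  have g': "(g has_vector_derivative f y) (at y)" if "\<bar>y\<bar> < R" for y
    proof -
    have "-R < y" "y < R" using that by auto
    then show ?thesis using g[of y] at_within_Icc_at[of "-R" y R] by simp
  qed
  have eq: "primitive f y = g y - g 0" if "y \<in> {-R<..<R}" for y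
    by (rule primitive_eq_diff) (use that in \<open>auto intro!: g'\<close>)
  have "((\<lambda>y. g y - g 0) has_vector_derivative f x) (at x)"
    using g'[of x] by (auto simp: R_def intro!: derivative_eq_intros)
  moreover have "x \<in> {-R<..<R}" by (auto simp: R_def)
  ultimately show ?thesis
    by (rule has_vector_derivative_transform_within_open[OF _ open_greaterThanLessThan]) (simp add: eq)
qed

text \<open>Integrating over the fixed interval [0,1] pays off here: \<open>x\<close> moves into the
  integrand and becomes one more parameter, so continuity is joint in \<open>p\<close> and
  \<open>x\<close>, for either sign of \<open>x\<close>.\<close>

lemma continuous_on_primitive:
  fixes f :: "'p::topological_space \<Rightarrow> real \<Rightarrow> 'a::banach"
  assumes "continuous_on UNIV (\<lambda>(p, x). f p x)"
  shows "continuous_on UNIV (\<lambda>(p, x). primitive (f p) x)"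
proof -
  have c: "continuous_on UNIV (\<lambda>((p, x), s::real). f p (s * x))"
    unfolding split_beta
    by (rule continuous_on_compose2[OF assms[unfolded split_beta], of _ "\<lambda>z. (fst (fst z), snd z * snd (fst z))", simplified])
      (intro continuous_intros)
  have "continuous_on UNIV (\<lambda>z. integral (cbox 0 1) ((\<lambda>(p, x) s::real. f p (s * x)) z))"
    by (rule integral_continuous_on_param) (use continuous_on_subset[OF c] in \<open>simp add: split_beta\<close>)
  then show ?thesis
    unfolding primitive_def split_beta by (intro continuous_intros) (simp add: split_beta)
qed

lemma primitive_has_vector_derivative_param:
  fixes f :: "real \<Rightarrow> real \<Rightarrow> 'a::banach"
  assumes "\<And>x s. ((\<lambda>x. f x s) has_vector_derivative f' x s) (at x)"
    and "\<And>x. continuous_on UNIV (f x)"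
    and "continuous_on UNIV (\<lambda>(x, s). f' x s)"
  shows "((\<lambda>x. primitive (f x) s) has_vector_derivative primitive (f' x) s) (at x)"
proof -
  have c: "continuous_on UNIV (\<lambda>(x, t::real). f' x (t * s))"
    unfolding split_beta
    by (rule continuous_on_compose2[OF assms(3)[unfolded split_beta], of _ "\<lambda>z. (fst z, snd z * s)", simplified])
      (intro continuous_intros)
  have i: "(\<lambda>t. f x (t * s)) integrable_on cbox 0 1" for x
    by (rule integrable_continuous, rule continuous_on_compose2[OF assms(2)])
      (auto intro: continuous_on_mult_right continuous_on_id)
  have "((\<lambda>x. integral (cbox 0 1) (\<lambda>t. f x (t * s))) has_vector_derivative
      integral (cbox 0 1) (\<lambda>t. f' x (t * s))) (at x within UNIV)"
    by (rule leibniz_rule_vector_derivative)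
      (use assms(1) i continuous_on_subset[OF c] in simp_all)
  then show ?thesis
    unfolding primitive_def
    using has_vector_derivative_scaleR[OF DERIV_const, of "\<lambda>x. integral {0..1} (\<lambda>t. f x (t * s))" _ x UNIV s] by simp
qed

text \<open>The engine of the factorial estimates: each application raises the power of
  \<open>\<bar>x\<bar>\<close> by one and divides by \<open>Suc n\<close>, so iterating it from a
  constant bound produces \<open>C * L ^ n / fact n * \<bar>x\<bar> ^ n\<close>.\<close>

lemma power_growth_bound:
  fixes f :: "real \<Rightarrow> 'a::real_normed_vector"
  assumes f: "\<And>y. \<bar>y\<bar> \<le> R \<Longrightarrow> (f has_vector_derivative f' y) (at y)"
    and b: "\<And>y. \<bar>y\<bar> \<le> R \<Longrightarrow> norm (f' y) \<le> c * \<bar>y\<bar> ^ n"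
    and "f 0 = 0" and x: "\<bar>x\<bar> \<le> R"
  shows "norm (f x) \<le> c * \<bar>x\<bar> ^ Suc n / Suc n"
proof (cases "x = 0")
  case False
  \<comment> \<open>Reflection by \<open>sgn x\<close> reduces negative \<open>x\<close> to the mean
    value inequality on the interval from 0 to \<open>\<bar>x\<bar>\<close>.\<close>
  define g where "g = (\<lambda>y. f (sgn x * y))"
  have g: "(g has_vector_derivative sgn x *\<^sub>R f' (sgn x * y)) (at y)" if "0 \<le> y" "y \<le> \<bar>x\<bar>" for y
  proof -
    have "((*) (sgn x) has_vector_derivative sgn x) (at y)"
      by (auto intro!: derivative_eq_intros)
    moreover have "\<bar>sgn x * y\<bar> \<le> R" using that x False by (simp add: abs_mult abs_sgn_eq)
    ultimately have "((f \<circ> (*) (sgn x)) has_vector_derivative sgn x *\<^sub>R f' (sgn x * y)) (at y)"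
      by (intro vector_diff_chain_at f) auto
    then show ?thesis by (simp add: g_def o_def)
  qed
  have "norm (g \<bar>x\<bar> - g 0) \<le> c * \<bar>x\<bar> ^ Suc n / Suc n - c * 0 ^ Suc n / Suc n"
  proof (rule differentiable_bound_general)
    show "continuous_on {0..\<bar>x\<bar>} g"
      by (intro continuous_at_imp_continuous_on ballI has_vector_derivative_continuous[OF g]) auto
    show "continuous_on {0..\<bar>x\<bar>} (\<lambda>y. c * y ^ Suc n / Suc n)"
      by (intro continuous_intros) auto
    show "(g has_vector_derivative sgn x *\<^sub>R f' (sgn x * y)) (at y)" if "0 < y" "y < \<bar>x\<bar>" for y
      using g that by auto
    show "((\<lambda>y. c * y ^ Suc n / Suc n) has_vector_derivative c * y ^ n) (at y)" for y
      unfolding has_real_derivative_iff_has_vector_derivative[symmetric]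
      by (rule derivative_eq_intros refl | simp del: of_nat_Suc)+
    show "norm (sgn x *\<^sub>R f' (sgn x * y)) \<le> c * y ^ n" if "0 < y" "y < \<bar>x\<bar>" for y
      using b[of "sgn x * y"] that x False by (simp add: abs_mult abs_sgn_eq)
  qed (use False in auto)
  then show ?thesis using assms(3) by (simp add: g_def mult_sgn_abs)
qed (use assms in auto)

text \<open>Picard iteration. Linearity makes the iterates converge on the whole line. The parameter
  ranges over a Euclidean space so that closed balls are compact: convergence is then uniform near
  each point and the limit is jointly continuous. \<open>pr\<close> stands for the action of a
  matrix on a row.\<close>

lemma linear_ode_exists:
  fixes pr :: "'e::banach \<Rightarrow> 'm::real_normed_vector \<Rightarrow> 'e"
    and A :: "'p::euclidean_space \<Rightarrow> real \<Rightarrow> 'm"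
  assumes bb: "bounded_bilinear pr"
    and A: "continuous_on UNIV (\<lambda>(p, x). A p x)"
    and h: "continuous_on UNIV h"
  obtains H where "continuous_on UNIV (\<lambda>(p, x). H p x)"
    "\<And>p x. (H p has_vector_derivative pr (H p x) (A p x)) (at x)"
    "\<And>p. H p 0 = h p"
proof -
  interpret bounded_bilinear pr by (rule bb)
  define Z where "Z = rec_nat (\<lambda>p x. h p) (\<lambda>_ z p x. h p + primitive (\<lambda>s. pr (z p s) (A p s)) x)"
  have Z_0: "Z 0 = (\<lambda>p x. h p)"
    and Z_Suc: "Z (Suc n) = (\<lambda>p x. h p + primitive (\<lambda>s. pr (Z n p s) (A p s)) x)" for n
    by (simp_all add: Z_def)
  have h': "continuous_on UNIV (\<lambda>(p, x::real). h p)"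
    unfolding split_beta by (rule continuous_on_compose2[OF h]) (auto intro: continuous_intros)
  have cont: "continuous_on UNIV (\<lambda>(p, x). Z n p x)" for n
  proof (induction n)
    case 0 show ?case using h' by (simp add: Z_0)
  next
    case (Suc n)
    have "continuous_on UNIV (\<lambda>(p, x). pr (Z n p x) (A p x))"
      using continuous_on[OF Suc A] by (simp add: split_beta)
    from continuous_on_add[OF h' continuous_on_primitive[OF this]]
    show ?case by (simp add: Z_Suc split_beta)
  qed
  have line: "continuous_on UNIV (f p)" if "continuous_on UNIV (\<lambda>(p, x). f p x)"
    for f :: "'p \<Rightarrow> real \<Rightarrow> 'b::topological_space" and p
  proof -
    have "continuous_on UNIV (\<lambda>x::real. (p, x))" by (rule continuous_on_Pair[OF continuous_on_const continuous_on_id])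
    from continuous_on_compose2[OF that this] show ?thesis by simp
  qed
  have contF: "continuous_on UNIV (\<lambda>s. pr (Z n p s) (A p s))" for n p
    by (intro continuous_on line cont A)
  have dZ: "(Z (Suc n) p has_vector_derivative pr (Z n p x) (A p x)) (at x)" for n p x
    unfolding Z_Suc using has_vector_derivative_add[OF has_vector_derivative_const primitive_has_vector_derivative[OF contF]]
    by simp
  have Z0: "Z n p 0 = h p" for n p by (cases n) (simp_all add: Z_0 Z_Suc)
  define D where "D = (\<lambda>i z. Z (Suc i) (fst z) (snd z) - Z i (fst z) (snd z))"
  define H where "H = (\<lambda>p x. h p + suminf (\<lambda>i. D i (p, x)))"
  have unif: "uniform_limit (N \<times> {-R..R}) (\<lambda>n z. Z n (fst z) (snd z)) (\<lambda>z. H (fst z) (snd z)) sequentially"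
    if N: "compact N" for N R
  proof -
    have comp: "compact (N \<times> {-R..R})" by (intro compact_Times N) simp
    have "bounded ((\<lambda>(p, x). A p x) ` (N \<times> {-R..R}))"
      by (intro compact_imp_bounded compact_continuous_image comp continuous_on_subset[OF A]) simp
    then obtain MA where MA: "\<And>p x. p \<in> N \<Longrightarrow> \<bar>x\<bar> \<le> R \<Longrightarrow> norm (A p x) \<le> MA"
      unfolding bounded_iff by fastforce
    have "bounded (D 0 ` (N \<times> {-R..R}))"
      unfolding D_def using cont[of "Suc 0"] cont[of 0]
      by (intro compact_imp_bounded compact_continuous_image comp)
        (auto intro!: continuous_on_subset[OF continuous_on_diff] simp: split_beta)
    then obtain C where C: "\<And>p x. p \<in> N \<Longrightarrow> \<bar>x\<bar> \<le> R \<Longrightarrow> norm (D 0 (p, x)) \<le> C"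
      unfolding bounded_iff by fastforce
    obtain K where K: "K > 0" "\<And>a b. norm (pr a b) \<le> norm a * norm b * K"
      using pos_bounded by blast
    define L where "L = \<bar>MA\<bar> * K"
    have L: "L \<ge> 0" using K by (simp add: L_def)
    have Dn: "norm (D n (p, x)) \<le> C * L ^ n / fact n * \<bar>x\<bar> ^ n" if "p \<in> N" "\<bar>x\<bar> \<le> R" for n p x
      using that
    proof (induction n arbitrary: x)
      case 0 then show ?case using C by simp
    next
      case (Suc n)
      have "norm (D (Suc n) (p, x)) \<le> (C * L ^ n / fact n * L) * \<bar>x\<bar> ^ Suc n / Suc n"
      proof (rule power_growth_bound)
        fix y assume y: "\<bar>y\<bar> \<le> R"
        show "((\<lambda>x. D (Suc n) (p, x)) has_vector_derivative pr (D n (p, y)) (A p y)) (at y)"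
          unfolding D_def using has_vector_derivative_diff[OF dZ[of "Suc n" p y] dZ[of n p y]]
          by (simp add: diff_left)
        have "norm (pr (D n (p, y)) (A p y)) \<le> norm (D n (p, y)) * (norm (A p y) * K)"
          using K(2)[of "D n (p, y)" "A p y"] by (simp add: mult.assoc)
        also have "\<dots> \<le> (C * L ^ n / fact n * \<bar>y\<bar> ^ n) * L"
        proof (rule mult_mono)
          show "norm (D n (p, y)) \<le> C * L ^ n / fact n * \<bar>y\<bar> ^ n"
            by (rule Suc.IH) (use Suc.prems y in auto)
          then show "0 \<le> C * L ^ n / fact n * \<bar>y\<bar> ^ n"
            using norm_ge_zero order_trans by blast
          show "norm (A p y) * K \<le> L"
            unfolding L_def using MA[OF Suc.prems(1) y] K by (intro mult_right_mono) auto
        qed (use K in auto)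
        finally show "norm (pr (D n (p, y)) (A p y)) \<le> (C * L ^ n / fact n * L) * \<bar>y\<bar> ^ n"
          by (simp add: mult_ac)
      next
        show "D (Suc n) (p, 0) = 0" by (simp add: D_def Z0)
      qed (use Suc in auto)
      then show ?case by (simp add: field_simps)
    qed
    have "uniform_limit (N \<times> {-R..R}) (\<lambda>n z. \<Sum>i<n. D i z) (\<lambda>z. \<Sum>i. D i z) sequentially"
    proof (rule Weierstrass_m_test)
      fix n and z :: "'p \<times> real" assume z: "z \<in> N \<times> {-R..R}"
      obtain p x where px: "z = (p, x)" by fastforce
      have p: "p \<in> N" and x: "\<bar>x\<bar> \<le> R" using z px by auto
      have C0: "0 \<le> C" using C[OF p x] norm_ge_zero order_trans by blast
      have "norm (D n z) \<le> C * L ^ n / fact n * \<bar>x\<bar> ^ n" using Dn[OF p x] px by simp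
      also have "\<dots> \<le> \<bar>C\<bar> * L ^ n / fact n * \<bar>R\<bar> ^ n"
        using x L C0 by (intro mult_mono power_mono) auto
      also have "\<dots> = \<bar>C\<bar> * (inverse (fact n) * (L * \<bar>R\<bar>) ^ n)"
        by (simp add: power_mult_distrib field_simps)
      finally show "norm (D n z) \<le> \<bar>C\<bar> * (inverse (fact n) * (L * \<bar>R\<bar>) ^ n)" .
    qed (intro summable_mult summable_exp)
    then have "uniform_limit (N \<times> {-R..R}) (\<lambda>n z. h (fst z) + (\<Sum>i<n. D i z)) (\<lambda>z. h (fst z) + (\<Sum>i. D i z)) sequentially"
      by (intro uniform_limit_add uniform_limit_const)
    moreover have "h (fst z) + (\<Sum>i<n. D i z) = Z n (fst z) (snd z)" for n z
      unfolding D_def by (subst sum_lessThan_telescope) (simp add: Z_0)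
    ultimately show ?thesis by (simp add: H_def)
  qed
  have contH: "continuous_on UNIV (\<lambda>(p, x). H p x)"
  proof -
    have c1: "continuous_on (cball p 1 \<times> {-R..R}) (\<lambda>(p, x). H p x)" for p R
      using uniform_limit_theorem[OF _ unif[OF compact_cball]] continuous_on_subset[OF cont]
      by (auto simp: split_beta)
    have *: "continuous_on (ball p 1 \<times> {-R<..<R}) (\<lambda>(p, x). H p x)" for p R
      by (rule continuous_on_subset[OF c1[of p R]]) auto
    have "isCont (\<lambda>(p, x). H p x) (p, x)" for p x
    proof (rule continuous_on_interior[OF *])
      show "(p, x) \<in> interior (ball p 1 \<times> {-(\<bar>x\<bar> + 1)<..<\<bar>x\<bar> + 1})"
        by (subst interior_open) (auto intro: open_Times)
    qed
    then show ?thesis by (auto intro: continuous_at_imp_continuous_on)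
  qed
  have lim: "(\<lambda>n. Z n p x) \<longlonglongrightarrow> H p x" for p x
  proof -
    have "(p, x) \<in> {p} \<times> {-\<bar>x\<bar>..\<bar>x\<bar>}" by auto
    from tendsto_uniform_limitI[OF unif this] show ?thesis by simp
  qed
  \<comment> \<open>On the segment from 0 to \<open>x\<close> the iterates converge uniformly, and
    \<open>H\<close> and \<open>A\<close> are bounded there, so the integrals converge and the
    recursion for \<open>Z\<close> passes to the limit.\<close>
  have eq: "H p x = h p + primitive (\<lambda>s. pr (H p s) (A p s)) x" for p x
  proof -
    have lineF: "continuous_on S (\<lambda>s. f (s * x))" if "continuous_on UNIV f" for f :: "real \<Rightarrow> 'b::topological_space" and S
      by (rule continuous_on_compose2[OF that]) (auto intro: continuous_on_mult_right continuous_on_id)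
    have m: "(p, s * x) \<in> {p} \<times> {-\<bar>x\<bar>..\<bar>x\<bar>}" if "s \<in> cbox 0 1" for s :: real
    proof -
      have "\<bar>s * x\<bar> \<le> \<bar>x\<bar>" using that by (simp add: abs_mult mult_left_le_one_le)
      then show ?thesis by auto
    qed
    have u1: "uniform_limit (cbox 0 1) (\<lambda>n s. Z n p (s * x)) (\<lambda>s. H p (s * x)) sequentially"
      using uniform_limit_compose'[OF unif[of "{p}" "\<bar>x\<bar>"], of "\<lambda>s. (p, s * x)" "cbox 0 1"] m
      by auto
    have "uniform_limit (cbox 0 1) (\<lambda>n s. pr (Z n p (s * x)) (A p (s * x))) (\<lambda>s. pr (H p (s * x)) (A p (s * x))) sequentially"
    proof (rule bounded_uniform_limit[OF u1 uniform_limit_const])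
      show "bounded ((\<lambda>s. H p (s * x)) ` cbox 0 1)"
        by (intro compact_imp_bounded compact_continuous_image lineF line contH) auto
      show "bounded ((\<lambda>s. A p (s * x)) ` cbox 0 1)"
        by (intro compact_imp_bounded compact_continuous_image lineF line A) auto
    qed
    then obtain I J where IJ: "\<And>n. ((\<lambda>s. pr (Z n p (s * x)) (A p (s * x))) has_integral I n) (cbox 0 1)"
      "((\<lambda>s. pr (H p (s * x)) (A p (s * x))) has_integral J) (cbox 0 1)" "I \<longlonglongrightarrow> J"
      using lineF[OF contF] by (rule uniform_limit_integral_cbox) auto
    have "primitive (\<lambda>s. pr (Z n p s) (A p s)) x = x *\<^sub>R I n" for n
      using integral_unique[OF IJ(1)[of n]] by (simp add: primitive_def)
    moreover have "primitive (\<lambda>s. pr (H p s) (A p s)) x = x *\<^sub>R J"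
      using integral_unique[OF IJ(2)] by (simp add: primitive_def)
    ultimately have "(\<lambda>n. h p + primitive (\<lambda>s. pr (Z n p s) (A p s)) x) \<longlonglongrightarrow> h p + primitive (\<lambda>s. pr (H p s) (A p s)) x"
      using IJ(3) by (simp add: tendsto_intros)
    moreover have "(\<lambda>n. h p + primitive (\<lambda>s. pr (Z n p s) (A p s)) x) \<longlonglongrightarrow> H p x"
      using LIMSEQ_Suc[OF lim[of p x]] by (simp add: Z_Suc)
    ultimately show ?thesis using LIMSEQ_unique by blast
  qed
  show thesis
  proof (rule that[OF contH])
    fix p x
    have "continuous_on UNIV (\<lambda>s. pr (H p s) (A p s))"
      by (intro continuous_on line contH A)
    from has_vector_derivative_add[OF has_vector_derivative_const primitive_has_vector_derivative[OF this]]
    have "((\<lambda>x. h p + primitive (\<lambda>s. pr (H p s) (A p s)) x) has_vector_derivative pr (H p x) (A p x)) (at x)"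
      by simp
    then show "(H p has_vector_derivative pr (H p x) (A p x)) (at x)"
      using eq by (metis (no_types, lifting) ext)
    show "H p 0 = h p" using eq[of p 0] by simp
  qed
qed

section \<open>Flat connections\<close>

lemma continuous_on_section:
  assumes "continuous_on UNIV (\<lambda>(s, x). f s x)"
  shows "continuous_on UNIV (f s)" "continuous_on UNIV (\<lambda>s. f s x)"
    "continuous_on UNIV (\<lambda>(x, s). f s x)"
proof -
  have "continuous_on UNIV (\<lambda>x. (s, x))" "continuous_on UNIV (\<lambda>s. (s, x))"
    by (intro continuous_intros)+
  then show "continuous_on UNIV (f s)" "continuous_on UNIV (\<lambda>s. f s x)"
    using continuous_on_compose2[OF assms] by fastforce+
  show "continuous_on UNIV (\<lambda>(x, s). f s x)"
    using continuous_on_compose2[OF assms continuous_on_swap, of UNIV] by (simp add: split_beta)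
qed

text \<open>\<open>flat\<close> is the vanishing of the curvature, tested on every vector
  \<open>v\<close> because \<open>'m\<close> carries no product. \<open>H\<close> is parallel in
  \<open>x\<close> everywhere, and in \<open>s\<close> on the line \<open>x = 0\<close>; off that
  line only continuity in \<open>s\<close> is known. So \<open>E\<close> integrates the desired
  derivative, and \<open>F = H - E\<close> is shown to vanish.\<close>

lemma flat_connection_parallel:
  fixes pr :: "'e::banach \<Rightarrow> 'm::real_normed_vector \<Rightarrow> 'e"
    and H :: "real \<Rightarrow> real \<Rightarrow> 'e" and A T A' T' :: "real \<Rightarrow> real \<Rightarrow> 'm"
  assumes bb: "bounded_bilinear pr"
    and cont: "continuous_on UNIV (\<lambda>(s, x). H s x)" "continuous_on UNIV (\<lambda>(s, x). A s x)"
      "continuous_on UNIV (\<lambda>(s, x). T s x)" "continuous_on UNIV (\<lambda>(s, x). A' s x)"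
      "continuous_on UNIV (\<lambda>(s, x). T' s x)"
    and dH: "\<And>s x. (H s has_vector_derivative pr (H s x) (A s x)) (at x)"
    and dH0: "\<And>s. ((\<lambda>s. H s 0) has_vector_derivative pr (H s 0) (T s 0)) (at s)"
    and dA: "\<And>s x. ((\<lambda>s. A s x) has_vector_derivative A' s x) (at s)"
    and dT: "\<And>s x. (T s has_vector_derivative T' s x) (at x)"
    and flat: "\<And>v s x. pr (pr v (A s x)) (T s x) + pr v (T' s x) =
      pr (pr v (T s x)) (A s x) + pr v (A' s x)"
  shows "((\<lambda>s. H s x) has_vector_derivative pr (H s x) (T s x)) (at s)"
proof -
  interpret bounded_bilinear pr by (rule bb)
  have cp: "continuous_on UNIV (\<lambda>(s, x). pr (f s x) (g s x))"
    if "continuous_on UNIV (\<lambda>(s, x). f s x)" "continuous_on UNIV (\<lambda>(s, x). g s x)"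
    for f :: "real \<Rightarrow> real \<Rightarrow> 'e" and g :: "real \<Rightarrow> real \<Rightarrow> 'm"
    using continuous_on[OF that] by (simp add: split_beta)
  define E where "E = (\<lambda>s x. H 0 x + primitive (\<lambda>\<sigma>. pr (H \<sigma> x) (T \<sigma> x)) s)"
  define F where "F = (\<lambda>s x. H s x - E s x)"
  have cHT: "continuous_on UNIV (\<lambda>(s, x). pr (H s x) (T s x))" by (intro cp cont)
  have dE: "((\<lambda>s. E s x) has_vector_derivative pr (H s x) (T s x)) (at s)" for s x
    unfolding E_def
    using has_vector_derivative_add[OF has_vector_derivative_const
      primitive_has_vector_derivative[OF continuous_on_section(2)[OF cHT]], of "H 0 x" x s] by simp
  have cE: "continuous_on UNIV (\<lambda>(s, x). E s x)"
  proof -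
    have "continuous_on UNIV (\<lambda>(x, s). primitive (\<lambda>\<sigma>. pr (H \<sigma> x) (T \<sigma> x)) s)"
      by (intro continuous_on_primitive continuous_on_section(3)[OF cHT])
    from continuous_on_section(3)[OF this]
    have 1: "continuous_on UNIV (\<lambda>(s, x). primitive (\<lambda>\<sigma>. pr (H \<sigma> x) (T \<sigma> x)) s)" .
    have 2: "continuous_on UNIV (\<lambda>(s::real, x). H 0 x)"
      unfolding split_beta
      by (rule continuous_on_compose2[OF continuous_on_section(1)[OF cont(1)]]) (auto intro: continuous_intros)
    show ?thesis using continuous_on_add[OF 2 1] by (simp add: E_def split_beta)
  qed
  have cF: "continuous_on UNIV (\<lambda>(s, x). F s x)"
    using continuous_on_diff[OF cont(1) cE] by (simp add: F_def split_beta)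
  have F0: "F s 0 = 0" for s
    using primitive_eq_diff[of s "\<lambda>s. H s 0" "\<lambda>s. pr (H s 0) (T s 0)"] dH0 by (simp add: F_def E_def)
  \<comment> \<open>The \<open>x\<close>-derivative of \<open>pr H T\<close>; by \<open>flat\<close>
    it also equals \<open>pr (pr H T) A + pr H A'\<close>.\<close>
  let ?W = "\<lambda>x \<sigma>. pr (pr (H \<sigma> x) (A \<sigma> x)) (T \<sigma> x) + pr (H \<sigma> x) (T' \<sigma> x)"
  have cW: "continuous_on UNIV (\<lambda>(s, x). ?W x s)"
    using continuous_on_add[OF cp[OF cp[OF cont(1,2)] cont(3)] cp[OF cont(1,5)]] by (simp add: split_beta)
  have dEx: "((\<lambda>x. E s x) has_vector_derivative pr (H 0 x) (A 0 x) + primitive (?W x) s) (at x)" for s x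
    unfolding E_def
  proof (intro has_vector_derivative_add dH primitive_has_vector_derivative_param)
    fix x s
    show "((\<lambda>x. pr (H s x) (T s x)) has_vector_derivative ?W x s) (at x)"
      using has_vector_derivative[OF dH[of s x] dT[of s x]] by (simp add: add.commute)
    show "continuous_on UNIV (\<lambda>\<sigma>. pr (H \<sigma> x) (T \<sigma> x))"
      by (rule continuous_on_section(2)[OF cHT])
    show "continuous_on UNIV (\<lambda>(x, s). ?W x s)"
      by (rule continuous_on_section(3)[OF cW])
  qed
  have cFA: "continuous_on UNIV (\<lambda>(s, x). pr (F s x) (A' s x))" by (intro cp cF cont)
  \<comment> \<open>Since \<open>E = H - F\<close> and \<open>pr H T\<close> is the derivative of
    \<open>E\<close> in \<open>s\<close>, the second form of \<open>?W\<close> is the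
    \<open>s\<close>-derivative of \<open>pr E A\<close> plus the error \<open>pr F A'\<close>.
    Integration in \<open>s\<close> leaves only this error under the integral.\<close>
  have W_eq: "primitive (?W x) s = pr (E s x) (A s x) - pr (H 0 x) (A 0 x)
      + primitive (\<lambda>\<sigma>. pr (F \<sigma> x) (A' \<sigma> x)) s" for s x
  proof -
    let ?g = "\<lambda>s. pr (E s x) (A s x) + primitive (\<lambda>\<sigma>. pr (F \<sigma> x) (A' \<sigma> x)) s"
    have "(?g has_vector_derivative ?W x s) (at s)" for s
    proof -
      have "(?g has_vector_derivative (pr (E s x) (A' s x) + pr (pr (H s x) (T s x)) (A s x))
          + pr (F s x) (A' s x)) (at s)"
        by (intro has_vector_derivative_add has_vector_derivative dE dA
            primitive_has_vector_derivative continuous_on_section(2)[OF cFA])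
      moreover have "(pr (E s x) (A' s x) + pr (pr (H s x) (T s x)) (A s x)) + pr (F s x) (A' s x) = ?W x s"
        by (simp add: F_def diff_left flat)
      ultimately show ?thesis by simp
    qed
    then have "primitive (?W x) s = ?g s - ?g 0" by (intro primitive_eq_diff)
    then show ?thesis by (simp add: E_def)
  qed
  \<comment> \<open>So \<open>F\<close> solves a homogeneous linear equation in \<open>x\<close>
    with a Volterra term in \<open>s\<close>, and it vanishes at \<open>x = 0\<close>. Iterating the
    resulting estimate gives factorial bounds that tend to 0.\<close>
  have dF: "((\<lambda>x. F s x) has_vector_derivative
      pr (F s x) (A s x) - primitive (\<lambda>\<sigma>. pr (F \<sigma> x) (A' \<sigma> x)) s) (at x)" for s x
    unfolding F_def using has_vector_derivative_diff[OF dH[of s x] dEx[of s x]]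
    by (simp add: W_eq diff_left F_def[symmetric]) (simp add: F_def diff_left algebra_simps)
  have F: "F s x = 0" for s x
  proof -
    define R where "R = max \<bar>s\<bar> \<bar>x\<bar>"
    have R: "\<bar>s\<bar> \<le> R" "\<bar>x\<bar> \<le> R" "R \<ge> 0" by (auto simp: R_def)
    have bnd: "\<exists>C. \<forall>s x. \<bar>s\<bar> \<le> R \<longrightarrow> \<bar>x\<bar> \<le> R \<longrightarrow> norm (f s x) \<le> C"
      if "continuous_on UNIV (\<lambda>(s, x). f s x)" for f :: "real \<Rightarrow> real \<Rightarrow> 'c::real_normed_vector"
    proof -
      have "bounded ((\<lambda>(s, x). f s x) ` ({-R..R} \<times> {-R..R}))"
        by (intro compact_imp_bounded compact_continuous_image compact_Times continuous_on_subset[OF that]) auto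
      then show ?thesis unfolding bounded_iff by fastforce
    qed
    obtain C where C: "\<And>s x. \<bar>s\<bar> \<le> R \<Longrightarrow> \<bar>x\<bar> \<le> R \<Longrightarrow> norm (F s x) \<le> C" using bnd[OF cF] by blast
    obtain CA where CA: "\<And>s x. \<bar>s\<bar> \<le> R \<Longrightarrow> \<bar>x\<bar> \<le> R \<Longrightarrow> norm (A s x) \<le> CA" using bnd[OF cont(2)] by blast
    obtain CA' where CA': "\<And>s x. \<bar>s\<bar> \<le> R \<Longrightarrow> \<bar>x\<bar> \<le> R \<Longrightarrow> norm (A' s x) \<le> CA'" using bnd[OF cont(4)] by blast
    obtain K where K: "K > 0" "\<And>a b. norm (pr a b) \<le> norm a * norm b * K"
      using pos_bounded by blast
    have pos: "0 \<le> C" "0 \<le> CA" "0 \<le> CA'"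
      using C[OF R(1,2)] CA[OF R(1,2)] CA'[OF R(1,2)] norm_ge_zero order_trans by blast+
    \<comment> \<open>The two summands account for \<open>pr F A\<close> and for the integral of
      \<open>pr F A'\<close> over a segment of length at most \<open>R\<close>.\<close>
    define L where "L = CA * K + R * (CA' * K)"
    have mono: "norm (pr v a) \<le> c * (c' * K)" if "norm v \<le> c" "norm a \<le> c'" for v a c c'
    proof -
      have "norm (pr v a) \<le> norm v * (norm a * K)" using K(2)[of v a] by (simp add: mult.assoc)
      also have "\<dots> \<le> c * (c' * K)"
        using that K norm_ge_zero[of v] by (intro mult_mono mult_right_mono) (auto intro: order_trans[OF norm_ge_zero])
      finally show ?thesis .
    qed
    have main: "norm (F s x) \<le> C * L ^ n / fact n * \<bar>x\<bar> ^ n" if "\<bar>s\<bar> \<le> R" "\<bar>x\<bar> \<le> R" for n s x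
      using that
    proof (induction n arbitrary: s x)
      case 0 then show ?case using C by simp
    next
      case (Suc n)
      let ?c = "C * L ^ n / fact n"
      have "norm (F s x) \<le> (?c * L) * \<bar>x\<bar> ^ Suc n / Suc n"
      proof (rule power_growth_bound[OF dF])
        fix y assume y: "\<bar>y\<bar> \<le> R"
        let ?B = "?c * \<bar>y\<bar> ^ n * (CA' * K)"
        have "norm (primitive (\<lambda>\<sigma>. pr (F \<sigma> y) (A' \<sigma> y)) s) \<le> ?B * \<bar>s\<bar> ^ Suc 0 / Suc 0"
        proof (rule power_growth_bound[where R = "\<bar>s\<bar>"])
          show "(primitive (\<lambda>\<sigma>. pr (F \<sigma> y) (A' \<sigma> y)) has_vector_derivative pr (F t y) (A' t y)) (at t)" for t
            by (intro primitive_has_vector_derivative continuous_on_section(2)[OF cFA])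
          show "norm (pr (F t y) (A' t y)) \<le> ?B * \<bar>t\<bar> ^ 0" if "\<bar>t\<bar> \<le> \<bar>s\<bar>" for t
            using mono[OF Suc.IH CA', of t y t y] that Suc.prems y by simp
        qed auto
        also have "?B * \<bar>s\<bar> ^ Suc 0 / Suc 0 \<le> ?B * R"
        proof -
          have "0 \<le> ?B" using pos K
            by (intro mult_nonneg_nonneg[OF order_trans[OF norm_ge_zero Suc.IH[OF Suc.prems(1) y]]]) simp
          from mult_left_mono[OF Suc.prems(1) this] show ?thesis by simp
        qed
        finally have 1: "norm (primitive (\<lambda>\<sigma>. pr (F \<sigma> y) (A' \<sigma> y)) s) \<le> ?B * R" .
        have 2: "norm (pr (F s y) (A s y)) \<le> ?c * \<bar>y\<bar> ^ n * (CA * K)"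
          using mono[OF Suc.IH CA] Suc.prems y by simp
        have "norm (pr (F s y) (A s y) - primitive (\<lambda>\<sigma>. pr (F \<sigma> y) (A' \<sigma> y)) s)
            \<le> ?c * \<bar>y\<bar> ^ n * (CA * K) + ?B * R"
          using norm_triangle_ineq4 add_mono[OF 2 1] order_trans by blast
        also have "\<dots> = (?c * L) * \<bar>y\<bar> ^ n" by (simp add: L_def algebra_simps add_divide_distrib)
        finally show "norm (pr (F s y) (A s y) - primitive (\<lambda>\<sigma>. pr (F \<sigma> y) (A' \<sigma> y)) s)
            \<le> (?c * L) * \<bar>y\<bar> ^ n" .
      qed (use Suc F0 in auto)
      then show ?case by (simp add: field_simps)
    qed
    have "(\<lambda>n. C * (inverse (fact n) * (L * \<bar>x\<bar>) ^ n)) \<longlonglongrightarrow> C * 0"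
      by (intro tendsto_mult tendsto_const summable_LIMSEQ_zero summable_exp)
    moreover have "norm (F s x) \<le> C * (inverse (fact n) * (L * \<bar>x\<bar>) ^ n)" for n
      using main[OF R(1,2), of n] by (simp add: power_mult_distrib field_simps)
    ultimately have "norm (F s x) \<le> 0"
      by (intro LIMSEQ_le_const[of "\<lambda>n. C * (inverse (fact n) * (L * \<bar>x\<bar>) ^ n)" 0]) auto
    then show ?thesis by simp
  qed
  then have "(\<lambda>s. H s x) = (\<lambda>s. E s x)" by (auto simp: F_def)
  then show ?thesis using dE[of x s] by simp
qed

section \<open>Calculus in the classes \<open>Ck\<close>\<close>

lemma has_dt_iff: "has_dt f \<longleftrightarrow>
    (\<forall>t x y. ((\<lambda>s. f (s, x, y)) has_vector_derivative dt f (t, x, y)) (at t))"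
  by (simp add: has_dt_def dt_def vector_derivative_works)

lemma has_d1_iff: "has_d1 f \<longleftrightarrow>
    (\<forall>t x y. ((\<lambda>s. f (t, s, y)) has_vector_derivative d1 f (t, x, y)) (at x))"
  by (simp add: has_d1_def d1_def vector_derivative_works)

lemma has_d2_iff: "has_d2 f \<longleftrightarrow>
    (\<forall>t x y. ((\<lambda>s. f (t, x, s)) has_vector_derivative d2 f (t, x, y)) (at y))"
  by (simp add: has_d2_def d2_def vector_derivative_works)

lemma has_dtI:
  assumes "\<And>t x y. ((\<lambda>s. f (s, x, y)) has_vector_derivative g (t, x, y)) (at t)"
  shows "has_dt f" "dt f = g"
  using assms by (auto simp: has_dt_def dt_def vector_derivative_at intro: differentiableI_vector)

lemma has_d1I:
  assumes "\<And>t x y. ((\<lambda>s. f (t, s, y)) has_vector_derivative g (t, x, y)) (at x)"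
  shows "has_d1 f" "d1 f = g"
  using assms by (auto simp: has_d1_def d1_def vector_derivative_at intro: differentiableI_vector)

lemma has_d2I:
  assumes "\<And>t x y. ((\<lambda>s. f (t, x, s)) has_vector_derivative g (t, x, y)) (at y)"
  shows "has_d2 f" "d2 f = g"
  using assms by (auto simp: has_d2_def d2_def vector_derivative_at intro: differentiableI_vector)

lemma has_partials_const:
  "has_dt (\<lambda>x. c)" "dt (\<lambda>x. c) = (\<lambda>x. 0)"
  "has_d1 (\<lambda>x. c)" "d1 (\<lambda>x. c) = (\<lambda>x. 0)"
  "has_d2 (\<lambda>x. c)" "d2 (\<lambda>x. c) = (\<lambda>x. 0)"
  by (auto simp: has_dt_def dt_def has_d1_def d1_def has_d2_def d2_def)

lemma has_dt_add:
  assumes "has_dt f" "has_dt g"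
  shows "has_dt (\<lambda>x. f x + g x)" "dt (\<lambda>x. f x + g x) = (\<lambda>x. dt f x + dt g x)"
  using assms unfolding has_dt_iff[of f] has_dt_iff[of g]
  by (intro has_dtI[where g = "\<lambda>x. dt f x + dt g x"] has_vector_derivative_add; blast)+

lemma has_d1_add:
  assumes "has_d1 f" "has_d1 g"
  shows "has_d1 (\<lambda>x. f x + g x)" "d1 (\<lambda>x. f x + g x) = (\<lambda>x. d1 f x + d1 g x)"
  using assms unfolding has_d1_iff[of f] has_d1_iff[of g]
  by (intro has_d1I[where g = "\<lambda>x. d1 f x + d1 g x"] has_vector_derivative_add; blast)+

lemma has_d2_add:
  assumes "has_d2 f" "has_d2 g"
  shows "has_d2 (\<lambda>x. f x + g x)" "d2 (\<lambda>x. f x + g x) = (\<lambda>x. d2 f x + d2 g x)"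
  using assms unfolding has_d2_iff[of f] has_d2_iff[of g]
  by (intro has_d2I[where g = "\<lambda>x. d2 f x + d2 g x"] has_vector_derivative_add; blast)+

lemma has_dt_bilinear:
  assumes "bounded_bilinear pr" "has_dt f" "has_dt g"
  shows "has_dt (\<lambda>x. pr (f x) (g x))"
    "dt (\<lambda>x. pr (f x) (g x)) = (\<lambda>x. pr (f x) (dt g x) + pr (dt f x) (g x))"
  using assms(2,3) unfolding has_dt_iff[of f] has_dt_iff[of g]
  by (intro has_dtI[where g = "\<lambda>x. pr (f x) (dt g x) + pr (dt f x) (g x)"]
      bounded_bilinear.has_vector_derivative[OF assms(1)]; blast)+

lemma has_d1_bilinear:
  assumes "bounded_bilinear pr" "has_d1 f" "has_d1 g"
  shows "has_d1 (\<lambda>x. pr (f x) (g x))"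
    "d1 (\<lambda>x. pr (f x) (g x)) = (\<lambda>x. pr (f x) (d1 g x) + pr (d1 f x) (g x))"
  using assms(2,3) unfolding has_d1_iff[of f] has_d1_iff[of g]
  by (intro has_d1I[where g = "\<lambda>x. pr (f x) (d1 g x) + pr (d1 f x) (g x)"]
      bounded_bilinear.has_vector_derivative[OF assms(1)]; blast)+

lemma has_d2_bilinear:
  assumes "bounded_bilinear pr" "has_d2 f" "has_d2 g"
  shows "has_d2 (\<lambda>x. pr (f x) (g x))"
    "d2 (\<lambda>x. pr (f x) (g x)) = (\<lambda>x. pr (f x) (d2 g x) + pr (d2 f x) (g x))"
  using assms(2,3) unfolding has_d2_iff[of f] has_d2_iff[of g]
  by (intro has_d2I[where g = "\<lambda>x. pr (f x) (d2 g x) + pr (d2 f x) (g x)"]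
      bounded_bilinear.has_vector_derivative[OF assms(1)]; blast)+

lemma has_dt_linear:
  assumes "bounded_linear L" "has_dt f"
  shows "has_dt (\<lambda>x. L (f x))" "dt (\<lambda>x. L (f x)) = (\<lambda>x. L (dt f x))"
  using assms(2) unfolding has_dt_iff[of f]
  by (intro has_dtI[where g = "\<lambda>x. L (dt f x)"]
      bounded_linear.has_vector_derivative[OF assms(1)]; blast)+

lemma has_d1_linear:
  assumes "bounded_linear L" "has_d1 f"
  shows "has_d1 (\<lambda>x. L (f x))" "d1 (\<lambda>x. L (f x)) = (\<lambda>x. L (d1 f x))"
  using assms(2) unfolding has_d1_iff[of f]
  by (intro has_d1I[where g = "\<lambda>x. L (d1 f x)"]
      bounded_linear.has_vector_derivative[OF assms(1)]; blast)+

lemma has_d2_linear: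
  assumes "bounded_linear L" "has_d2 f"
  shows "has_d2 (\<lambda>x. L (f x))" "d2 (\<lambda>x. L (f x)) = (\<lambda>x. L (d2 f x))"
  using assms(2) unfolding has_d2_iff[of f]
  by (intro has_d2I[where g = "\<lambda>x. L (d2 f x)"]
      bounded_linear.has_vector_derivative[OF assms(1)]; blast)+

lemma has_dt_field_chain:
  assumes "\<And>x. (\<phi> has_field_derivative \<phi>' x) (at (f x))" "has_dt f"
  shows "has_dt (\<lambda>x. \<phi> (f x))" "dt (\<lambda>x. \<phi> (f x)) = (\<lambda>x. dt f x * \<phi>' x)"
proof -
  have "((\<lambda>s. \<phi> (f (s, x, y))) has_vector_derivative dt f (t, x, y) * \<phi>' (t, x, y)) (at t)" for t x y
    using field_vector_diff_chain_at[where f = "\<lambda>s. f (s, x, y)" and x = t, OF _ assms(1)[of "(t, x, y)"]]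
      assms(2)[unfolded has_dt_iff] by (simp add: o_def)
  then show "has_dt (\<lambda>x. \<phi> (f x))" "dt (\<lambda>x. \<phi> (f x)) = (\<lambda>x. dt f x * \<phi>' x)"
    by (rule has_dtI)+
qed

lemma has_d1_field_chain:
  assumes "\<And>x. (\<phi> has_field_derivative \<phi>' x) (at (f x))" "has_d1 f"
  shows "has_d1 (\<lambda>x. \<phi> (f x))" "d1 (\<lambda>x. \<phi> (f x)) = (\<lambda>x. d1 f x * \<phi>' x)"
proof -
  have "((\<lambda>s. \<phi> (f (t, s, y))) has_vector_derivative d1 f (t, x, y) * \<phi>' (t, x, y)) (at x)" for t x y
    using field_vector_diff_chain_at[where f = "\<lambda>s. f (t, s, y)" and x = x, OF _ assms(1)[of "(t, x, y)"]]
      assms(2)[unfolded has_d1_iff] by (simp add: o_def)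
  then show "has_d1 (\<lambda>x. \<phi> (f x))" "d1 (\<lambda>x. \<phi> (f x)) = (\<lambda>x. d1 f x * \<phi>' x)"
    by (rule has_d1I)+
qed

lemma has_d2_field_chain:
  assumes "\<And>x. (\<phi> has_field_derivative \<phi>' x) (at (f x))" "has_d2 f"
  shows "has_d2 (\<lambda>x. \<phi> (f x))" "d2 (\<lambda>x. \<phi> (f x)) = (\<lambda>x. d2 f x * \<phi>' x)"
proof -
  have "((\<lambda>s. \<phi> (f (t, x, s))) has_vector_derivative d2 f (t, x, y) * \<phi>' (t, x, y)) (at y)" for t x y
    using field_vector_diff_chain_at[where f = "\<lambda>s. f (t, x, s)" and x = y, OF _ assms(1)[of "(t, x, y)"]]
      assms(2)[unfolded has_d2_iff] by (simp add: o_def)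
  then show "has_d2 (\<lambda>x. \<phi> (f x))" "d2 (\<lambda>x. \<phi> (f x)) = (\<lambda>x. d2 f x * \<phi>' x)"
    by (rule has_d2I)+
qed

lemma Ck_iff:
  assumes "0 < w"
  shows "Ck w k f \<longleftrightarrow> continuous_on UNIV f \<and>
    (0 < k \<longrightarrow> (has_d1 f \<and> Ck w (k - 1) (d1 f)) \<and> (has_d2 f \<and> Ck w (k - 1) (d2 f))) \<and>
    (w \<le> k \<longrightarrow> has_dt f \<and> Ck w (k - w) (dt f))"
  using assms by (simp add: Ck.simps[of w k f]) blast

lemma Ck_continuous: "Ck w k f \<Longrightarrow> continuous_on UNIV f"
  by (simp add: Ck.simps[of w k f])

lemma Ck_mono: "Ck w k f \<Longrightarrow> 0 < w \<Longrightarrow> j \<le> k \<Longrightarrow> Ck w j f"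
proof (induction k arbitrary: f j rule: less_induct)
  case (less k)
  show ?case
    using less.prems less.IH[of "k - 1" "d1 f" "j - 1"] less.IH[of "k - 1" "d2 f" "j - 1"]
      less.IH[of "k - w" "dt f" "j - w"]
    by (auto simp: Ck_iff[of w k f] Ck_iff[of w j f])
qed

lemma Ck_const: "0 < w \<Longrightarrow> Ck w k (\<lambda>x. c)"
proof (induction k arbitrary: c rule: less_induct)
  case (less k)
  then show ?case by (simp add: Ck_iff[of w k "\<lambda>x. c"] has_partials_const)
qed

lemma Ck_add:
  assumes "0 < w" "Ck w k f" "Ck w k g"
  shows "Ck w k (\<lambda>x. f x + g x)"
  using assms(2,3)
proof (induction k arbitrary: f g rule: less_induct)
  case (less k)
  then show ?case using assms(1)
    by (simp add: Ck_iff[of w k f] Ck_iff[of w k g] Ck_iff[of w k "\<lambda>x. f x + g x"]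
        has_d1_add has_d2_add has_dt_add continuous_on_add)
qed

lemma Ck_linear:
  assumes "0 < w" "bounded_linear L" "Ck w k f"
  shows "Ck w k (\<lambda>x. L (f x))"
  using assms(3)
proof (induction k arbitrary: f rule: less_induct)
  case (less k)
  then show ?case using assms(1)
    by (simp add: Ck_iff[of w k f] Ck_iff[of w k "\<lambda>x. L (f x)"] has_d1_linear[OF assms(2)]
        has_d2_linear[OF assms(2)] has_dt_linear[OF assms(2)] bounded_linear.continuous_on[OF assms(2)])
qed

lemma Ck_bilinear:
  assumes "0 < w" "bounded_bilinear pr" "Ck w k f" "Ck w k g"
  shows "Ck w k (\<lambda>x. pr (f x) (g x))"
  using assms(3,4)
proof (induction k arbitrary: f g rule: less_induct)
  case (less k)
  note IH = less.IH and fg = less.prems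
  have m: "Ck w (k - 1) f" "Ck w (k - w) f" "Ck w (k - 1) g" "Ck w (k - w) g"
    using Ck_mono fg assms(1) diff_le_self by blast+
  note IH' = IH[of "k - Suc 0"] IH[of "k - w"]
  show ?case using fg m assms(1)
    by (simp add: Ck_iff[of w k f] Ck_iff[of w k g] Ck_iff[of w k "\<lambda>x. pr (f x) (g x)"] has_d1_bilinear[OF assms(2)] has_d2_bilinear[OF assms(2)]
        has_dt_bilinear[OF assms(2)] bounded_bilinear.continuous_on[OF assms(2)] Ck_add IH')
qed

lemmas Ck_mult = Ck_bilinear[OF _ bounded_bilinear_mult]
lemmas Ck_of_real = Ck_linear[OF _ bounded_linear_of_real]
lemmas Ck_Re = Ck_linear[OF _ bounded_linear_Re]
lemmas Ck_Im = Ck_linear[OF _ bounded_linear_Im]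
lemmas Ck_cnj = Ck_linear[OF _ bounded_linear_cnj]
lemmas Ck_minus = Ck_linear[OF _ bounded_linear_minus[OF bounded_linear_ident]]

lemma Ck_diff: "0 < w \<Longrightarrow> Ck w k f \<Longrightarrow> Ck w k g \<Longrightarrow> Ck w k (\<lambda>x. f x - g x)"
  using Ck_add[of w k f "\<lambda>x. - g x"] Ck_minus[of w k g] by simp

text \<open>The hypothesis \<open>step\<close> makes the chain rule bootstrap: here \<open>\<phi>'\<close> is a function of the
  point, standing for the derivative of \<open>\<phi>\<close> at \<open>f x\<close>.\<close>

lemma Ck_field_chain:
  assumes w: "0 < w" and d: "\<And>x. (\<phi> has_field_derivative \<phi>' x) (at (f x))"
    and step: "\<And>j. j < k \<Longrightarrow> Ck w j (\<lambda>x. \<phi> (f x)) \<Longrightarrow> Ck w j \<phi>'"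
    and f: "Ck w k f"
  shows "Ck w k (\<lambda>x. \<phi> (f x))"
proof -
  have "j \<le> k \<Longrightarrow> Ck w j (\<lambda>x. \<phi> (f x))" for j
  proof (induction j rule: less_induct)
    case (less j)
    have fj: "Ck w j f" using Ck_mono[OF f w less.prems] .
    have c: "continuous_on UNIV (\<lambda>x. \<phi> (f x))"
      using Ck_continuous[OF f] DERIV_isCont[OF d]
      by (auto simp: continuous_on_eq_continuous_at intro: isCont_o2)
    have \<phi>': "Ck w i \<phi>'" if "i < j" for i
      using step less that by auto
    show ?case using w fj c
      by (simp add: Ck_iff[of w j f] Ck_iff[of w j "\<lambda>x. \<phi> (f x)"] has_d1_field_chain[OF d]
          has_d2_field_chain[OF d] has_dt_field_chain[OF d] Ck_mult \<phi>')
  qed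
  then show ?thesis by simp
qed

lemma Ck_exp:
  assumes "0 < w" "Ck w k f"
  shows "Ck w k (\<lambda>x. exp (f x :: 'a::{real_normed_field, banach}))"
  by (rule Ck_field_chain[OF assms(1) DERIV_exp _ assms(2)])

lemma Ck_inverse:
  assumes "0 < w" "Ck w k f" "\<And>x. f x \<noteq> (0 :: 'a::real_normed_field)"
  shows "Ck w k (\<lambda>x. inverse (f x))"
proof (rule Ck_field_chain[OF assms(1) _ _ assms(2)])
  \<comment> \<open>The derivative is written through \<open>inverse (f x)\<close> itself, so that
    closure under products completes the bootstrap.\<close>
  show "(inverse has_field_derivative - (inverse (f x) * inverse (f x))) (at (f x))" for x
    using DERIV_inverse[OF assms(3), of x] by (simp add: power2_eq_square)
qed (intro Ck_minus Ck_mult assms(1))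

lemma Ck_sqrt:
  assumes "0 < w" "Ck w k f" "\<And>x. f x > (0 :: real)"
  shows "Ck w k (\<lambda>x. sqrt (f x))"
proof (rule Ck_field_chain[OF assms(1) _ _ assms(2)])
  show "(sqrt has_field_derivative (inverse (sqrt (f x)) * (1 / 2))) (at (f x))" for x
    using DERIV_real_sqrt[OF assms(3), of x] by simp
next
  fix j assume "Ck w j (\<lambda>x. sqrt (f x))"
  moreover have "sqrt (f x) \<noteq> 0" for x using assms(3)[of x] by simp
  ultimately show "Ck w j (\<lambda>x. inverse (sqrt (f x)) * (1 / 2))"
    by (intro Ck_mult Ck_inverse Ck_const assms(1))
qed

section \<open>Integration of a flat connection in three variables\<close>

lemma continuous_on_planes:
  assumes "continuous_on UNIV (F :: pt \<Rightarrow> 'a::topological_space)"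
  shows "continuous_on UNIV (\<lambda>(t, x). F (t, x, y))" "continuous_on UNIV (\<lambda>(t, y). F (t, x, y))"
    "continuous_on UNIV (\<lambda>(x, y). F (t, x, y))" "continuous_on UNIV (\<lambda>t. F (t, x, y))"
  unfolding split_beta
  by (rule continuous_on_compose2[OF assms], intro continuous_intros, simp)+

text \<open>Flatness in \<open>(t, x1)\<close> makes the solution parallel in \<open>t\<close> on
  the plane \<open>x2 = 0\<close>. There lie the initial values from which flatness in
  \<open>(t, x2)\<close> and in \<open>(x1, x2)\<close> yields parallelism in \<open>t\<close> and
  in \<open>x1\<close> everywhere. Each use freezes the remaining variable.\<close>

lemma total_linear_system_exists:
  fixes pr :: "'e::banach \<Rightarrow> 'm::real_normed_vector \<Rightarrow> 'e" and X1 X2 T :: "pt \<Rightarrow> 'm"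
  assumes bb: "bounded_bilinear pr"
    and c: "continuous_on UNIV X1" "continuous_on UNIV X2" "continuous_on UNIV T"
    and h: "has_dt X1" "has_dt X2" "has_d1 T" "has_d2 T" "has_d2 X1" "has_d1 X2"
    and ch: "continuous_on UNIV (dt X1)" "continuous_on UNIV (dt X2)" "continuous_on UNIV (d1 T)"
      "continuous_on UNIV (d2 T)" "continuous_on UNIV (d2 X1)" "continuous_on UNIV (d1 X2)"
    and flat_t1: "\<And>v x. pr (pr v (X1 x)) (T x) + pr v (d1 T x) = pr (pr v (T x)) (X1 x) + pr v (dt X1 x)"
    and flat_t2: "\<And>v x. pr (pr v (X2 x)) (T x) + pr v (d2 T x) = pr (pr v (T x)) (X2 x) + pr v (dt X2 x)"
    and flat_12: "\<And>v x. pr (pr v (X2 x)) (X1 x) + pr v (d2 X1 x) = pr (pr v (X1 x)) (X2 x) + pr v (d1 X2 x)"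
  obtains V where "continuous_on UNIV V" "V (0, 0, 0) = v0" "has_dt V" "has_d1 V" "has_d2 V"
    "dt V = (\<lambda>x. pr (V x) (T x))" "d1 V = (\<lambda>x. pr (V x) (X1 x))" "d2 V = (\<lambda>x. pr (V x) (X2 x))"
proof -
  note h' = h[unfolded has_dt_iff has_d1_iff has_d2_iff, rule_format]
  note pl = continuous_on_planes
  \<comment> \<open>\<open>p\<close> is a dummy: the existence lemma with parameters is applied to a
    single equation, and the solution with parameter 0 is kept.\<close>
  have "continuous_on UNIV (\<lambda>(p::real, t). T (t, 0, 0))"
    unfolding split_beta by (rule continuous_on_compose2[OF pl(4)[OF c(3)]], intro continuous_intros, simp)
  from linear_ode_exists[OF bb this continuous_on_const[of UNIV v0]] obtain G0 :: "real \<Rightarrow> real \<Rightarrow> 'e" where G0: "continuous_on UNIV (\<lambda>(p, t). G0 p t)"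
    "\<And>p t. (G0 p has_vector_derivative pr (G0 p t) (T (t, 0, 0))) (at t)" "\<And>p. G0 p 0 = v0"
    by blast
  define g where "g = G0 0"
  have g: "continuous_on UNIV g" "\<And>t. (g has_vector_derivative pr (g t) (T (t, 0, 0))) (at t)" "g 0 = v0"
    using G0(2,3) continuous_on_section(1)[OF G0(1)] by (auto simp: g_def)
  obtain H where H: "continuous_on UNIV (\<lambda>(t, x). H t x)"
    "\<And>t x. (H t has_vector_derivative pr (H t x) (X1 (t, x, 0))) (at x)" "\<And>t. H t 0 = g t"
    by (rule linear_ode_exists[OF bb pl(1)[OF c(1)] g(1)]) (rule that)
  have Ht: "((\<lambda>t. H t x) has_vector_derivative pr (H t x) (T (t, x, 0))) (at t)" for t x
    by (rule flat_connection_parallel[OF bb H(1) pl(1)[OF c(1), of 0] pl(1)[OF c(3), of 0] pl(1)[OF ch(1), of 0] pl(1)[OF ch(3), of 0] H(2)])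
      (auto simp: H(3) g(2) h' flat_t1)
  have "continuous_on UNIV (\<lambda>(p, y). X2 (fst p, snd p, y))"
    unfolding split_beta by (rule continuous_on_compose2[OF c(2)], intro continuous_intros, simp)
  from linear_ode_exists[OF bb this H(1)] obtain K where K: "continuous_on UNIV (\<lambda>(p, y). K p y)"
    "\<And>p y. (K p has_vector_derivative pr (K p y) (X2 (fst p, snd p, y))) (at y)"
    "\<And>p. K p 0 = (\<lambda>(t, x). H t x) p"
    by blast
  define V where "V = (\<lambda>(t, x, y). K (t, x) y)"
  have cV: "continuous_on UNIV V"
  proof -
    have "continuous_on UNIV (\<lambda>z::pt. ((fst z, fst (snd z)), snd (snd z)))"
      by (intro continuous_intros)
    from continuous_on_compose2[OF K(1) this] show ?thesis by (simp add: V_def split_beta)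
  qed
  have V0: "V (t, x, 0) = H t x" for t x using K(3) by (simp add: V_def)
  have Vy: "((\<lambda>y. V (t, x, y)) has_vector_derivative pr (V (t, x, y)) (X2 (t, x, y))) (at y)" for t x y
    using K(2)[of "(t, x)" y] by (simp add: V_def)
  have Vt: "((\<lambda>t. V (t, x, y)) has_vector_derivative pr (V (t, x, y)) (T (t, x, y))) (at t)" for t x y
    by (rule flat_connection_parallel[OF bb pl(2)[OF cV, of x] pl(2)[OF c(2), of x] pl(2)[OF c(3), of x] pl(2)[OF ch(2), of x] pl(2)[OF ch(4), of x] Vy])
      (auto simp: V0 Ht h' flat_t2)
  have Vx: "((\<lambda>x. V (t, x, y)) has_vector_derivative pr (V (t, x, y)) (X1 (t, x, y))) (at x)" for t x y
    by (rule flat_connection_parallel[OF bb pl(3)[OF cV, of t] pl(3)[OF c(2), of t] pl(3)[OF c(1), of t] pl(3)[OF ch(6), of t] pl(3)[OF ch(5), of t] Vy])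
      (auto simp: V0 H(2) h' flat_12)
  show thesis
    by (rule that[OF cV]) (use V0[of 0 0] H(3)[of 0] g(3) Vt Vx Vy in \<open>auto intro!: has_dtI has_d1I has_d2I\<close>)
qed

section \<open>Commuting partial derivatives\<close>

text \<open>Existence of the other mixed derivative is a conclusion here: \<open>f\<close> is its
  value at \<open>x = 0\<close> plus the integral of \<open>fx\<close>, which is differentiated in
  \<open>y\<close> under the integral sign and then in \<open>x\<close> by the fundamental
  theorem.\<close>

lemma mixed_partials_commute:
  fixes f :: "real \<Rightarrow> real \<Rightarrow> 'a::banach"
  assumes fx: "\<And>x y. ((\<lambda>x. f x y) has_vector_derivative fx x y) (at x)"
    and fy: "\<And>x y. (f x has_vector_derivative fy x y) (at y)"
    and fxy: "\<And>x y. (fx x has_vector_derivative fxy x y) (at y)"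
    and c: "continuous_on UNIV (\<lambda>(x, y). fx x y)" "continuous_on UNIV (\<lambda>(x, y). fxy x y)"
  shows "((\<lambda>x. fy x y) has_vector_derivative fxy x y) (at x)"
proof -
  have f_eq: "f x y = f 0 y + primitive (\<lambda>s. fx s y) x" for x y
    using primitive_eq_diff[of x "\<lambda>x. f x y" "\<lambda>s. fx s y"] fx by simp
  have "((\<lambda>y. f 0 y + primitive (\<lambda>s. fx s y) x) has_vector_derivative fy 0 y + primitive (\<lambda>s. fxy s y) x) (at y)" for x
    by (intro has_vector_derivative_add fy primitive_has_vector_derivative_param fxy
        continuous_on_section(2)[OF c(1)] continuous_on_section(3)[OF c(2)])
  then have "fy x y = fy 0 y + primitive (\<lambda>s. fxy s y) x" for x
    using vector_derivative_unique_at[OF fy[of x y]] by (simp add: f_eq[symmetric])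
  then have fy_eq: "(\<lambda>x. fy x y) = (\<lambda>x. fy 0 y + primitive (\<lambda>s. fxy s y) x)"
    by blast
  have "(primitive (\<lambda>s. fxy s y) has_vector_derivative fxy x y) (at x)"
    by (intro primitive_has_vector_derivative continuous_on_section(2)[OF c(2)])
  from has_vector_derivative_add[OF has_vector_derivative_const[of "fy 0 y"] this]
  show ?thesis unfolding fy_eq by simp
qed

lemma Ck_dt: "0 < w \<Longrightarrow> Ck w k f \<Longrightarrow> j + w \<le> k \<Longrightarrow> Ck w j (dt f)"
  using Ck_mono[of w "k - w" "dt f" j] by (auto simp: Ck_iff[of w k f])

lemma Ck_d1: "0 < w \<Longrightarrow> Ck w k f \<Longrightarrow> Suc j \<le> k \<Longrightarrow> Ck w j (d1 f)"
  and Ck_d2: "0 < w \<Longrightarrow> Ck w k f \<Longrightarrow> Suc j \<le> k \<Longrightarrow> Ck w j (d2 f)"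
  using Ck_mono[of w "k - 1" "d1 f" j] Ck_mono[of w "k - 1" "d2 f" j] by (auto simp: Ck_iff[of w k f])

lemma Ck_has_partials:
  assumes "Ck w k f" "0 < w"
  shows "0 < k \<Longrightarrow> has_d1 f" "0 < k \<Longrightarrow> has_d2 f" "w \<le> k \<Longrightarrow> has_dt f"
  using assms by (auto simp: Ck_iff[of w k f])

lemma Ck_commute:
  assumes "0 < w" "Ck w 2 (f :: pt \<Rightarrow> 'a::banach)"
  shows "d1 (d2 f) = d2 (d1 f)"
proof -
  have c: "continuous_on UNIV (d1 f)" "continuous_on UNIV (d2 (d1 f))" "has_d1 f" "has_d2 f" "has_d2 (d1 f)"
    using Ck_continuous[OF Ck_d1[OF assms, of 0]] Ck_continuous[OF Ck_d2[OF assms(1) Ck_d1[OF assms, of 1], of 0]]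
      Ck_has_partials[OF assms(2,1)] Ck_has_partials[OF Ck_d1[OF assms, of 1] assms(1)] by simp_all
  show ?thesis
  proof (rule has_d1I)
    fix t x y
    show "((\<lambda>s. d2 f (t, s, y)) has_vector_derivative d2 (d1 f) (t, x, y)) (at x)"
      by (rule mixed_partials_commute[where f = "\<lambda>x y. f (t, x, y)"])
        (use c has_d1_iff has_d2_iff continuous_on_planes(3) in blast)+
  qed
qed

text \<open>Weight 2 for \<open>dt\<close> plus one space derivative makes 3 the order at which the
  mixed derivative is continuous.\<close>

lemma Ck_commute_dt:
  assumes "Ck 2 3 (f :: pt \<Rightarrow> 'a::banach)"
  shows "d1 (dt f) = dt (d1 f)" "d2 (dt f) = dt (d2 f)"
proof -
  have c: "continuous_on UNIV (d1 f)" "continuous_on UNIV (dt (d1 f))" "has_d1 f" "has_dt f" "has_dt (d1 f)"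
    "continuous_on UNIV (d2 f)" "continuous_on UNIV (dt (d2 f))" "has_d2 f" "has_dt (d2 f)"
    using Ck_continuous[OF Ck_d1[OF _ assms, of 0]] Ck_continuous[OF Ck_d2[OF _ assms, of 0]]
      Ck_continuous[OF Ck_dt[OF _ Ck_d1[OF _ assms, of 2], of 0]]
      Ck_continuous[OF Ck_dt[OF _ Ck_d2[OF _ assms, of 2], of 0]]
      Ck_has_partials[OF assms] Ck_has_partials[OF Ck_d1[OF _ assms, of 2]]
      Ck_has_partials[OF Ck_d2[OF _ assms, of 2]] by simp_all
  note pl = continuous_on_planes
  show "d1 (dt f) = dt (d1 f)"
  proof (rule has_d1I)
    fix t x y
    show "((\<lambda>s. dt f (t, s, y)) has_vector_derivative dt (d1 f) (t, x, y)) (at x)"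
      by (rule mixed_partials_commute[where f = "\<lambda>x t. f (t, x, y)" and fx = "\<lambda>x t. d1 f (t, x, y)"])
        (use c has_d1_iff has_dt_iff continuous_on_section(3)[OF pl(1)] in blast)+
  qed
  show "d2 (dt f) = dt (d2 f)"
  proof (rule has_d2I)
    fix t x y
    show "((\<lambda>s. dt f (t, x, s)) has_vector_derivative dt (d2 f) (t, x, y)) (at y)"
      by (rule mixed_partials_commute[where f = "\<lambda>y t. f (t, x, y)" and fx = "\<lambda>y t. d2 f (t, x, y)"])
        (use c has_d2_iff has_dt_iff continuous_on_section(3)[OF pl(2)] in blast)+
  qed
qed

text \<open>For \<open>w = 2\<close> a time derivative costs two orders instead of one, so the same
  \<open>k\<close> asks for fewer derivatives. Identities proved in the parabolic class thereby
  cover both cases.\<close>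

lemma Ck_weight_2: "w = 1 \<or> w = 2 \<Longrightarrow> Ck w k f \<Longrightarrow> Ck 2 k f"
proof (induction k arbitrary: f rule: less_induct)
  case (less k)
  show ?case
  proof (cases "w = 1")
    case True
    have "Ck 2 (k - 2) (dt f)" if "2 \<le> k"
    proof -
      have "Ck 1 (k - 2) (dt f)"
        using Ck_dt[of 1 k f "k - 2"] less.prems True that by simp
      then show ?thesis using less.IH[of "k - 2" "dt f"] that True by simp
    qed
    then show ?thesis using less.prems less.IH[of "k - 1" "d1 f"] less.IH[of "k - 1" "d2 f"] True
      by (auto simp: Ck_iff[of "Suc 0" k f] Ck_iff[of 2 k f])
  qed (use less in auto)
qed

section \<open>Sums, products and conjugates under the partial derivatives, \<open>dz\<close> and
  \<open>dzb\<close>\<close>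

lemma has_partials_minus:
  "has_d1 f \<Longrightarrow> has_d1 (\<lambda>x. - f x)" "has_d1 f \<Longrightarrow> d1 (\<lambda>x. - f x) = (\<lambda>x. - d1 f x)"
  "has_d2 f \<Longrightarrow> has_d2 (\<lambda>x. - f x)" "has_d2 f \<Longrightarrow> d2 (\<lambda>x. - f x) = (\<lambda>x. - d2 f x)"
  "has_dt f \<Longrightarrow> has_dt (\<lambda>x. - f x)" "has_dt f \<Longrightarrow> dt (\<lambda>x. - f x) = (\<lambda>x. - dt f x)"
  using has_d1_linear[OF bounded_linear_minus[OF bounded_linear_ident], of f]
    has_d2_linear[OF bounded_linear_minus[OF bounded_linear_ident], of f]
    has_dt_linear[OF bounded_linear_minus[OF bounded_linear_ident], of f] by auto

lemma has_partials_diff: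
  "has_d1 f \<Longrightarrow> has_d1 g \<Longrightarrow> has_d1 (\<lambda>x. f x - g x)"
  "has_d1 f \<Longrightarrow> has_d1 g \<Longrightarrow> d1 (\<lambda>x. f x - g x) = (\<lambda>x. d1 f x - d1 g x)"
  "has_d2 f \<Longrightarrow> has_d2 g \<Longrightarrow> has_d2 (\<lambda>x. f x - g x)"
  "has_d2 f \<Longrightarrow> has_d2 g \<Longrightarrow> d2 (\<lambda>x. f x - g x) = (\<lambda>x. d2 f x - d2 g x)"
  "has_dt f \<Longrightarrow> has_dt g \<Longrightarrow> has_dt (\<lambda>x. f x - g x)"
  "has_dt f \<Longrightarrow> has_dt g \<Longrightarrow> dt (\<lambda>x. f x - g x) = (\<lambda>x. dt f x - dt g x)"
  using has_d1_add[of f "\<lambda>x. - g x"] has_d2_add[of f "\<lambda>x. - g x"] has_dt_add[of f "\<lambda>x. - g x"]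
    has_partials_minus[of g] by auto

lemmas has_partials_mult =
  has_d1_bilinear[OF bounded_bilinear_mult] has_d2_bilinear[OF bounded_bilinear_mult]
  has_dt_bilinear[OF bounded_bilinear_mult]
lemmas has_partials_cnj =
  has_d1_linear[OF bounded_linear_cnj] has_d2_linear[OF bounded_linear_cnj] has_dt_linear[OF bounded_linear_cnj]
lemmas has_partials_of_real =
  has_d1_linear[OF bounded_linear_of_real] has_d2_linear[OF bounded_linear_of_real]
  has_dt_linear[OF bounded_linear_of_real]

lemmas has_partials =
  has_partials_const has_d1_add has_d2_add has_dt_add has_partials_minus has_partials_diff
  has_partials_mult has_partials_cnj has_partials_of_real

lemma dz_const: "dz (\<lambda>x. c) x = 0" "dzb (\<lambda>x. c) x = 0"
  by (simp_all add: dz_def dzb_def has_partials)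

lemma dz_add:
  assumes "has_d1 f" "has_d2 f" "has_d1 g" "has_d2 g"
  shows "dz (\<lambda>x. f x + g x) x = dz f x + dz g x" "dzb (\<lambda>x. f x + g x) x = dzb f x + dzb g x"
  using assms by (simp_all add: dz_def dzb_def has_partials algebra_simps)

lemma dz_diff:
  assumes "has_d1 f" "has_d2 f" "has_d1 g" "has_d2 g"
  shows "dz (\<lambda>x. f x - g x) x = dz f x - dz g x" "dzb (\<lambda>x. f x - g x) x = dzb f x - dzb g x"
  using assms by (simp_all add: dz_def dzb_def has_partials algebra_simps)

lemma dz_minus:
  assumes "has_d1 f" "has_d2 f"
  shows "dz (\<lambda>x. - f x) x = - dz f x" "dzb (\<lambda>x. - f x) x = - dzb f x"
  using assms by (simp_all add: dz_def dzb_def has_partials algebra_simps)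

lemma dz_mult:
  assumes "has_d1 f" "has_d2 f" "has_d1 g" "has_d2 g"
  shows "dz (\<lambda>x. f x * g x) x = dz f x * g x + f x * dz g x"
    "dzb (\<lambda>x. f x * g x) x = dzb f x * g x + f x * dzb g x"
  using assms by (simp_all add: dz_def dzb_def has_partials algebra_simps)

lemma dz_cnj:
  assumes "has_d1 f" "has_d2 f"
  shows "dz (\<lambda>x. cnj (f x)) x = cnj (dzb f x)" "dzb (\<lambda>x. cnj (f x)) x = cnj (dz f x)"
  using assms by (simp_all add: dz_def dzb_def has_partials)

lemmas dz_simps = dz_const dz_add dz_diff dz_minus dz_mult dz_cnj has_partials

lemma d1_eq_dz: "d1 f x = (dz f x + dzb f x) / 2" and d2_eq_dz: "d2 f x = \<i> * (dz f x - dzb f x) / 2"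
  by (simp_all add: dz_def dzb_def algebra_simps)

lemma Ck_dz:
  assumes "0 < w" "Ck w k f" "Suc j \<le> k"
  shows "Ck w j (dz f)" "Ck w j (dzb f)"
proof -
  have "Ck w j (d1 f)" "Ck w j (d2 f)" using Ck_d1 Ck_d2 assms by blast+
  then show "Ck w j (dz f)" "Ck w j (dzb f)"
    unfolding dz_def[abs_def] dzb_def[abs_def]
    by (simp_all add: Ck_diff Ck_add Ck_mult Ck_const assms(1))
qed

lemma dz_dzb_commute:
  assumes "0 < w" "Ck w 2 f"
  shows "dz (dzb f) x = dzb (dz f) x"
proof -
  have h: "has_d1 (d1 f)" "has_d2 (d1 f)" "has_d1 (d2 f)" "has_d2 (d2 f)"
    using Ck_has_partials[OF Ck_d1[OF assms, of 1] assms(1)] Ck_has_partials[OF Ck_d2[OF assms, of 1] assms(1)]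
    by simp_all
  then show ?thesis
    by (simp add: dz_def[abs_def] dzb_def[abs_def] has_partials Ck_commute[OF assms] algebra_simps)
qed

lemma dt_dz_commute:
  assumes "Ck 2 3 f"
  shows "dt (dz f) x = dz (dt f) x" "dt (dzb f) x = dzb (dt f) x"
proof -
  have h: "has_dt (d1 f)" "has_dt (d2 f)"
    using Ck_has_partials[OF Ck_d1[OF _ assms, of 2]] Ck_has_partials[OF Ck_d2[OF _ assms, of 2]]
    by simp_all
  then show "dt (dz f) x = dz (dt f) x" "dt (dzb f) x = dzb (dt f) x"
    by (simp_all add: dz_def[abs_def] dzb_def[abs_def] has_partials Ck_commute_dt[OF assms])
qed

section \<open>Gauge matrices and frames\<close>

lemma mat2_eq_iff: "mat2 a b c d = mat2 a' b' c' d' \<longleftrightarrow> a = a' \<and> b = b' \<and> c = c' \<and> d = d'"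
  by (auto simp: mat2_def vec_eq_iff forall_2)

lemma mat2_nth [simp]:
  "mat2 a b c d $ 1 $ 1 = a" "mat2 a b c d $ 1 $ 2 = b"
  "mat2 a b c d $ 2 $ 1 = c" "mat2 a b c d $ 2 $ 2 = d"
  by (simp_all add: mat2_def)

lemma mat2_arith:
  "mat2 a b c d ** mat2 e f g h = mat2 (a * e + b * g) (a * f + b * h) (c * e + d * g) (c * f + d * h)"
  "mat2 a b c d + mat2 e f g h = mat2 (a + e) (b + f) (c + g) (d + h)"
  "mat2 a b c d - mat2 e f g h = mat2 (a - e) (b - f) (c - g) (d - h)"
  "- mat2 a b c d = mat2 (- a) (- b) (- c) (- d)"
  "cscale e (mat2 a b c d) = mat2 (e * a) (e * b) (e * c) (e * d)"
  "mat 1 = mat2 1 0 0 1"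
  by (simp_all add: vec_eq_iff forall_2 mat2_def matrix_matrix_mult_def sum_2 cscale_def mat_def)

lemma bounded_linear_mat2:
  "bounded_linear (\<lambda>a. mat2 a 0 0 0)" "bounded_linear (\<lambda>a. mat2 0 a 0 0)"
  "bounded_linear (\<lambda>a. mat2 0 0 a 0)" "bounded_linear (\<lambda>a. mat2 0 0 0 a)"
  by (intro linear_conv_bounded_linear[THEN iffD1] linearI;
      simp add: mat2_arith vec_eq_iff forall_2)+

text \<open>Matrix-valued functions inherit regularity and derivatives from their entries through
  these four linear embeddings.\<close>

lemma mat2_decompose: "mat2 a b c d = mat2 a 0 0 0 + mat2 0 b 0 0 + mat2 0 0 c 0 + mat2 0 0 0 d"
  by (simp add: mat2_arith)

lemma bounded_linear_entry: "bounded_linear (\<lambda>M :: cmat. M $ i $ j)"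
  by (intro bounded_linear_compose[OF bounded_linear_vec_nth] bounded_linear_vec_nth)

lemma Ck_mat2:
  assumes "0 < w" "Ck w k a" "Ck w k b" "Ck w k c" "Ck w k d"
  shows "Ck w k (\<lambda>x. mat2 (a x) (b x) (c x) (d x))"
  by (subst mat2_decompose, intro Ck_add Ck_linear[OF _ bounded_linear_mat2(1)] Ck_linear[OF _ bounded_linear_mat2(2)]
      Ck_linear[OF _ bounded_linear_mat2(3)] Ck_linear[OF _ bounded_linear_mat2(4)] assms)

lemmas Ck_entry = Ck_linear[OF _ bounded_linear_entry]

lemma entry_partials:
  assumes "has_d1 F" "has_d2 F"
  shows "mdz F x $ i $ j = dz (\<lambda>x. F x $ i $ j) x" "mdzb F x $ i $ j = dzb (\<lambda>x. F x $ i $ j) x"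
  using has_d1_linear[OF bounded_linear_entry assms(1)] has_d2_linear[OF bounded_linear_entry assms(2)]
  by (simp_all add: mdz_def mdzb_def dz_def dzb_def cscale_def)

lemma entry_dt: "has_dt (F :: pt \<Rightarrow> cmat) \<Longrightarrow> dt F x $ i $ j = dt (\<lambda>x. F x $ i $ j) x"
  by (simp add: has_dt_linear(2)[OF bounded_linear_entry])

lemma mdz_mat2:
  assumes "Ck w 1 a" "Ck w 1 b" "Ck w 1 c" "Ck w 1 d" "0 < w"
  shows "mdz (\<lambda>x. mat2 (a x) (b x) (c x) (d x)) x = mat2 (dz a x) (dz b x) (dz c x) (dz d x)"
    "mdzb (\<lambda>x. mat2 (a x) (b x) (c x) (d x)) x = mat2 (dzb a x) (dzb b x) (dzb c x) (dzb d x)"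
proof -
  have "Ck w 1 (\<lambda>x. mat2 (a x) (b x) (c x) (d x))" using assms by (intro Ck_mat2)
  note h = Ck_has_partials(1,2)[OF this assms(5)]
  show "mdz (\<lambda>x. mat2 (a x) (b x) (c x) (d x)) x = mat2 (dz a x) (dz b x) (dz c x) (dz d x)"
    "mdzb (\<lambda>x. mat2 (a x) (b x) (c x) (d x)) x = mat2 (dzb a x) (dzb b x) (dzb c x) (dzb d x)"
    by (simp_all add: vec_eq_iff forall_2 entry_partials h)
qed

lemma dt_mat2:
  assumes "Ck w w a" "Ck w w b" "Ck w w c" "Ck w w d" "0 < w"
  shows "dt (\<lambda>x. mat2 (a x) (b x) (c x) (d x)) x = mat2 (dt a x) (dt b x) (dt c x) (dt d x)"
proof -
  have "Ck w w (\<lambda>x. mat2 (a x) (b x) (c x) (d x))" using assms by (intro Ck_mat2)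
  note h = Ck_has_partials(3)[OF this assms(5)]
  show ?thesis by (simp add: vec_eq_iff forall_2 entry_dt h)
qed

definition gauge_matrix :: "(pt \<Rightarrow> complex) \<Rightarrow> (pt \<Rightarrow> complex) \<Rightarrow> pt \<Rightarrow> cmat" where
  "gauge_matrix a b x = mat2 (a x) (b x) (cnj (b x)) (cnj (a x))"

text \<open>This is \<open>-i G sigma3 G^-1\<close> for \<open>G = gauge_matrix a b\<close>, with
  the inverse expanded under unimodularity. As a polynomial in \<open>a\<close>, \<open>b\<close>
  and their conjugates it stays within the classes \<open>Ck\<close>.\<close>

definition spin :: "(pt \<Rightarrow> complex) \<Rightarrow> (pt \<Rightarrow> complex) \<Rightarrow> pt \<Rightarrow> cmat" where
  "spin a b x = mat2 (- \<i> * (a x * cnj (a x) + b x * cnj (b x))) (2 * \<i> * (a x * b x))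
     (- 2 * \<i> * (cnj (a x) * cnj (b x))) (\<i> * (a x * cnj (a x) + b x * cnj (b x)))"

definition unimodular :: "(pt \<Rightarrow> complex) \<Rightarrow> (pt \<Rightarrow> complex) \<Rightarrow> bool" where
  "unimodular a b \<longleftrightarrow> (\<forall>x. a x * cnj (a x) - b x * cnj (b x) = 1)"

text \<open>The first rows of the equations for \<open>G_z\<close> and \<open>G_zbar\<close>. The
  second row of \<open>G\<close> is the conjugate of the first in reversed order, and conjugation
  exchanges \<open>dz\<close> and \<open>dzb\<close>, so the second rows of the two equations say
  the same.\<close>

definition space_frame ::
  "(pt \<Rightarrow> complex) \<Rightarrow> (pt \<Rightarrow> complex) \<Rightarrow> (pt \<Rightarrow> complex) \<Rightarrow> (pt \<Rightarrow> complex) \<Rightarrow> (pt \<Rightarrow> complex) \<Rightarrow> bool"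
where
  "space_frame a b p q r \<longleftrightarrow> (\<forall>x.
     dz a x = - (a x * p x + b x * r x) \<and>
     dz b x = - (a x * q x - b x * p x) \<and>
     dzb a x = a x * cnj (p x) - b x * cnj (q x) \<and>
     dzb b x = - (a x * cnj (r x)) - b x * cnj (p x))"

text \<open>\<open>\<beta>\<close> and \<open>\<gamma>\<close> stand for the off-diagonal entries of
  the time component. They are kept abstract because, starting from \<open>S\<close>, they are first
  read off from \<open>dt a\<close> and \<open>dt b\<close>, and only later identified with
  expressions in \<open>p\<close>, \<open>q\<close>, \<open>r\<close>.\<close>

definition time_frame ::
  "(pt \<Rightarrow> complex) \<Rightarrow> (pt \<Rightarrow> complex) \<Rightarrow> (pt \<Rightarrow> complex) \<Rightarrow> (pt \<Rightarrow> complex) \<Rightarrow> (pt \<Rightarrow> real) \<Rightarrow> bool"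
where
  "time_frame a b \<beta> \<gamma> u \<longleftrightarrow> (\<forall>x.
     dt a x = \<i> * (a x * of_real (u x) + b x * \<gamma> x) \<and>
     dt b x = - \<i> * (a x * \<beta> x + b x * of_real (u x)))"

lemma unimodular_iff_SU11: "gauge_matrix a b x \<in> SU11 \<longleftrightarrow> a x * cnj (a x) - b x * cnj (b x) = 1"
proof -
  have "(cmod A)\<^sup>2 - (cmod B)\<^sup>2 = 1 \<longleftrightarrow> A * cnj A - B * cnj B = 1" for A B
  proof -
    have "A * cnj A - B * cnj B = of_real ((cmod A)\<^sup>2 - (cmod B)\<^sup>2)"
      by (simp add: complex_norm_square[symmetric] del: of_real_power)
    then show ?thesis by (metis of_real_1 of_real_eq_iff)
  qed
  then show ?thesis unfolding gauge_matrix_def SU11_def by (auto simp: mat2_eq_iff)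
qed

lemma matrix_inv_eqI:
  fixes A B :: "'a::field^'n^'n"
  assumes "A ** B = mat 1" "B ** A = mat 1"
  shows "matrix_inv A = B"
proof -
  have "A ** matrix_inv A = mat 1 \<and> matrix_inv A ** A = mat 1"
    unfolding matrix_inv_def by (rule someI[of _ B]) (use assms in auto)
  then have "B = B ** (A ** matrix_inv A)" by simp
  then show ?thesis by (simp add: matrix_mul_assoc assms)
qed

lemma matrix_inv_gauge_matrix:
  assumes "a x * cnj (a x) - b x * cnj (b x) = 1"
  shows "matrix_inv (gauge_matrix a b x) = mat2 (cnj (a x)) (- b x) (- cnj (b x)) (a x)"
  unfolding gauge_matrix_def using assms
  by (intro matrix_inv_eqI) (simp_all add: mat2_arith mat2_eq_iff algebra_simps)

lemma spin_eq_conjugate: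
  assumes "a x * cnj (a x) - b x * cnj (b x) = 1"
  shows "cscale (- \<i>) (gauge_matrix a b x ** sigma3 ** matrix_inv (gauge_matrix a b x)) = spin a b x"
  unfolding matrix_inv_gauge_matrix[of a x b, OF assms]
  by (simp add: gauge_matrix_def sigma3_def spin_def mat2_arith mat2_eq_iff algebra_simps)

text \<open>\<open>nls5\<close>, the last equation of \<open>NLS\<close> in conjugated form, says
  that the time component takes values in su(1,1). This makes the second row of the equation for
  \<open>dt G\<close> conjugate to the first, so that one row suffices in time as well as in
  space.\<close>

lemma gauge_transforms_iff:
  assumes w: "0 < w" "w \<le> 2" and a: "Ck w 2 a" and b: "Ck w 2 b"
    and nls5: "\<And>x. dzb r x - 2 * cnj (p x) * r x = cnj (dzb q x + 2 * cnj (p x) * q x)"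
  shows "gauge_transforms (gauge_matrix a b) p q r u S \<longleftrightarrow>
    unimodular a b \<and> S = spin a b \<and> space_frame a b p q r \<and>
    time_frame a b (\<lambda>x. dzb q x + 2 * cnj (p x) * q x) (\<lambda>x. dzb r x - 2 * cnj (p x) * r x) u"
proof -
  note ab = Ck_mono[OF a w(1), of 1] Ck_mono[OF b w(1), of 1] Ck_mono[OF a w] Ck_mono[OF b w]
  have G: "gauge_matrix a b = (\<lambda>x. mat2 (a x) (b x) (cnj (b x)) (cnj (a x)))"
    by (auto simp: gauge_matrix_def)
  have D: "mdz (gauge_matrix a b) x = mat2 (dz a x) (dz b x) (dz (\<lambda>x. cnj (b x)) x) (dz (\<lambda>x. cnj (a x)) x)"
    "mdzb (gauge_matrix a b) x = mat2 (dzb a x) (dzb b x) (dzb (\<lambda>x. cnj (b x)) x) (dzb (\<lambda>x. cnj (a x)) x)"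
    "dt (gauge_matrix a b) x = mat2 (dt a x) (dt b x) (dt (\<lambda>x. cnj (b x)) x) (dt (\<lambda>x. cnj (a x)) x)" for x
    unfolding G using ab w by (intro mdz_mat2[where w = w] dt_mat2[where w = w] Ck_cnj; simp)+
  note h = Ck_has_partials[OF a w(1)] Ck_has_partials[OF b w(1)]
  have D': "mdz (gauge_matrix a b) x = mat2 (dz a x) (dz b x) (cnj (dzb b x)) (cnj (dzb a x))"
    "mdzb (gauge_matrix a b) x = mat2 (dzb a x) (dzb b x) (cnj (dz b x)) (cnj (dz a x))"
    "dt (gauge_matrix a b) x = mat2 (dt a x) (dt b x) (cnj (dt b x)) (cnj (dt a x))" for x
    unfolding D using h w by (simp_all add: dz_simps)
  define \<beta> where "\<beta> = (\<lambda>x. dzb q x + 2 * cnj (p x) * q x)"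
  define \<gamma> where "\<gamma> = (\<lambda>x. dzb r x - 2 * cnj (p x) * r x)"
  have bg: "\<gamma> x = cnj (\<beta> x)" for x unfolding \<beta>_def \<gamma>_def by (rule nls5)
  have fold: "- dzb q x - 2 * cnj (p x) * q x = - \<beta> x" "dzb q x + 2 * cnj (p x) * q x = \<beta> x"
    "dzb r x - 2 * cnj (p x) * r x = \<gamma> x" for x
    by (simp_all add: \<beta>_def \<gamma>_def)
  have E: "(gauge_matrix a b x \<in> SU11 \<and>
     S x = cscale (- \<i>) (gauge_matrix a b x ** sigma3 ** matrix_inv (gauge_matrix a b x)) \<and>
     mdz (gauge_matrix a b) x = - (gauge_matrix a b x ** mat2 (p x) (q x) (r x) (- p x)) \<and>
     mdzb (gauge_matrix a b) x = gauge_matrix a b x ** mat2 (cnj (p x)) (- cnj (r x)) (- cnj (q x)) (- cnj (p x)) \<and>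
     dt (gauge_matrix a b) x = cscale \<i> (gauge_matrix a b x ** mat2 (of_real (u x)) (- \<beta> x) (\<gamma> x) (- of_real (u x))))
    \<longleftrightarrow> a x * cnj (a x) - b x * cnj (b x) = 1 \<and> S x = spin a b x \<and>
     (dz a x = - (a x * p x + b x * r x) \<and>
     dz b x = - (a x * q x - b x * p x) \<and>
     dzb a x = a x * cnj (p x) - b x * cnj (q x) \<and>
     dzb b x = - (a x * cnj (r x)) - b x * cnj (p x)) \<and>
     (dt a x = \<i> * (a x * of_real (u x) + b x * \<gamma> x) \<and>
     dt b x = - \<i> * (a x * \<beta> x + b x * of_real (u x)))" for x
  proof (cases "a x * cnj (a x) - b x * cnj (b x) = 1")
    case True
    have swap: "cnj z = y \<longleftrightarrow> z = cnj y" for z y by auto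
    show ?thesis
      unfolding D' unimodular_iff_SU11 spin_eq_conjugate[of a x b, OF True]
      unfolding gauge_matrix_def mat2_arith mat2_eq_iff bg
      unfolding swap[of "dzb b x"] swap[of "dzb a x"] swap[of "dz b x"] swap[of "dz a x"]
        swap[of "dt b x"] swap[of "dt a x"]
      using True by (auto simp: algebra_simps eq_neg_iff_add_eq_0)
  qed (simp add: unimodular_iff_SU11)
  show ?thesis
    unfolding gauge_transforms_def unimodular_def space_frame_def time_frame_def fun_eq_iff fold E
    by blast
qed

lemma unimodularD: "unimodular a b \<Longrightarrow> a x * cnj (a x) - b x * cnj (b x) = 1"
  unfolding unimodular_def by blast

lemma space_frameD:
  assumes "space_frame a b p q r"
  shows "dz a = (\<lambda>x. - (a x * p x + b x * r x))" "dz b = (\<lambda>x. - (a x * q x - b x * p x))"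
    "dzb a = (\<lambda>x. a x * cnj (p x) - b x * cnj (q x))"
    "dzb b = (\<lambda>x. - (a x * cnj (r x)) - b x * cnj (p x))"
  using assms by (simp_all add: space_frame_def fun_eq_iff)

lemma time_frameD:
  assumes "time_frame a b \<beta> \<gamma> u"
  shows "dt a = (\<lambda>x. \<i> * (a x * of_real (u x) + b x * \<gamma> x))"
    "dt b = (\<lambda>x. - \<i> * (a x * \<beta> x + b x * of_real (u x)))"
  using assms by (simp_all add: time_frame_def fun_eq_iff)

lemma Ck_spin:
  assumes "0 < w" "Ck w k a" "Ck w k b"
  shows "Ck w k (spin a b)"
  unfolding spin_def[abs_def]
  by (intro Ck_mat2 Ck_mult Ck_add Ck_cnj Ck_const assms)

lemma spin_hyperbolic:
  assumes "unimodular a b"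
  shows "spin a b x \<in> hyperbolic_plane"
proof -
  define A B where "A = a x" and "B = b x"
  have u: "A * cnj A - B * cnj B = 1" using unimodularD[OF assms, of x] by (simp add: A_def B_def)
  moreover have "A * cnj A - B * cnj B = of_real ((cmod A)\<^sup>2 - (cmod B)\<^sup>2)"
    by (simp add: complex_norm_square[symmetric] del: of_real_power)
  ultimately have u': "(cmod A)\<^sup>2 - (cmod B)\<^sup>2 = 1"
    by (metis of_real_1 of_real_eq_iff)
  define s3 where "s3 = - ((cmod A)\<^sup>2 + (cmod B)\<^sup>2)"
  define W where "W = 2 * \<i> * (A * B)"
  have S: "spin a b x = mat2 (\<i> * of_real s3) W (cnj W) (- \<i> * of_real s3)"
    unfolding spin_def s3_def W_def A_def B_def mat2_eq_iff
    by (simp add: complex_norm_square algebra_simps del: of_real_power)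
  have "(Re W)\<^sup>2 + (Im W)\<^sup>2 = 4 * (cmod A)\<^sup>2 * (cmod B)\<^sup>2"
    unfolding cmod_power2[symmetric] by (simp add: W_def norm_mult power_mult_distrib)
  then have "(Re W)\<^sup>2 + (Im W)\<^sup>2 - s3\<^sup>2 = - (((cmod A)\<^sup>2 - (cmod B)\<^sup>2)\<^sup>2)"
    by (simp add: s3_def power2_eq_square algebra_simps)
  then have *: "(Re W)\<^sup>2 + (Im W)\<^sup>2 - s3\<^sup>2 = -1" using u' by simp
  have "s3 < 0"
    using u' unfolding s3_def by (smt (verit) zero_le_power2)
  moreover have "spin a b x = mat2 (\<i> * of_real s3) (of_real (Re W) + \<i> * of_real (Im W))
      (of_real (Re W) - \<i> * of_real (Im W)) (- \<i> * of_real s3)"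
    unfolding S mat2_eq_iff by (simp add: complex_eq_iff)
  moreover have "spin a b x \<in> su11" using S by (auto simp: su11_def)
  ultimately show ?thesis using * unfolding hyperbolic_plane_def by blast
qed

text \<open>With \<open>G = gauge_matrix a b\<close>, the right side is \<open>G X G^-1\<close>,
  where \<open>X\<close> has zero diagonal and off-diagonal entries \<open>2 * \<beta> x\<close> and
  \<open>2 * \<gamma> x\<close>. The same matrix appears in \<open>dt_spin\<close>, which is how the
  time equation of the frame meets the map equation.\<close>

lemma commutator_spin:
  assumes c: "Ck 2 2 a" "Ck 2 2 b" "Ck 2 1 p" "Ck 2 1 q" "Ck 2 1 r"
    and u: "unimodular a b" and f: "space_frame a b p q r"
    and \<beta>: "\<beta> x = dzb q x + 2 * cnj (p x) * q x" and \<gamma>: "\<gamma> x = dzb r x - 2 * cnj (p x) * r x"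
  shows "cscale (- 1 / 2) (commutator (spin a b x) (mdzb (mdz (spin a b)) x)) =
    mat2 (2 * (cnj (a x) * b x * \<gamma> x - a x * cnj (b x) * \<beta> x)) (2 * ((a x)\<^sup>2 * \<beta> x - (b x)\<^sup>2 * \<gamma> x))
      (2 * ((cnj (a x))\<^sup>2 * \<gamma> x - (cnj (b x))\<^sup>2 * \<beta> x)) (- 2 * (cnj (a x) * b x * \<gamma> x - a x * cnj (b x) * \<beta> x))"
proof -
  note D = space_frameD[OF f]
  have h: "has_d1 a" "has_d2 a" "has_d1 b" "has_d2 b" "has_d1 p" "has_d2 p" "has_d1 q" "has_d2 q" "has_d1 r" "has_d2 r"
    using c[THEN Ck_has_partials(1)] c[THEN Ck_has_partials(2)] by simp_all
  have c1: "Ck 2 1 a" "Ck 2 1 b" using c(1,2)[THEN Ck_mono] by simp_all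
  let ?\<sigma> = "\<lambda>x. a x * cnj (a x) + b x * cnj (b x)"
  let ?K = "\<lambda>x. cnj (a x) * b x * r x + a x * cnj (b x) * q x"
  let ?M = "\<lambda>x. b x * b x * r x + a x * a x * q x"
  let ?N = "\<lambda>x. cnj (b x) * cnj (b x) * q x + cnj (a x) * cnj (a x) * r x"
  have 1: "dz (\<lambda>x. - \<i> * ?\<sigma> x) = (\<lambda>x. 2 * \<i> * ?K x)"
    by (rule ext) (simp add: h dz_simps D algebra_simps)
  have 2: "dz (\<lambda>x. 2 * \<i> * (a x * b x)) = (\<lambda>x. - 2 * \<i> * ?M x)"
    by (rule ext) (simp add: h dz_simps D algebra_simps)
  have 3: "dz (\<lambda>x. - 2 * \<i> * (cnj (a x) * cnj (b x))) = (\<lambda>x. 2 * \<i> * ?N x)"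
    by (rule ext) (simp add: h dz_simps D algebra_simps)
  have 4: "dz (\<lambda>x. \<i> * ?\<sigma> x) = (\<lambda>x. - 2 * \<i> * ?K x)"
    by (rule ext) (simp add: h dz_simps D algebra_simps)
  have "mdz (spin a b) = (\<lambda>x. mat2 (2 * \<i> * ?K x) (- 2 * \<i> * ?M x) (2 * \<i> * ?N x) (- 2 * \<i> * ?K x))"
  proof
    fix x
    have "mdz (spin a b) x = mat2 (dz (\<lambda>x. - \<i> * ?\<sigma> x) x) (dz (\<lambda>x. 2 * \<i> * (a x * b x)) x)
        (dz (\<lambda>x. - 2 * \<i> * (cnj (a x) * cnj (b x))) x) (dz (\<lambda>x. \<i> * ?\<sigma> x) x)"
      unfolding spin_def[abs_def]
      by (rule mdz_mat2[where w = 2]) (intro Ck_mult Ck_add Ck_cnj Ck_const c1 zero_less_numeral)+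
    then show "mdz (spin a b) x = mat2 (2 * \<i> * ?K x) (- 2 * \<i> * ?M x) (2 * \<i> * ?N x) (- 2 * \<i> * ?K x)"
      by (simp only: 1 2 3 4)
  qed
  then have "mdzb (mdz (spin a b)) x = mat2 (dzb (\<lambda>x. 2 * \<i> * ?K x) x) (dzb (\<lambda>x. - 2 * \<i> * ?M x) x)
      (dzb (\<lambda>x. 2 * \<i> * ?N x) x) (dzb (\<lambda>x. - 2 * \<i> * ?K x) x)"
    by (simp only:) (rule mdz_mat2[where w = 2], (intro Ck_mult Ck_add Ck_cnj Ck_const c c1 zero_less_numeral)+)
  \<comment> \<open>The terms with \<open>\<kappa>\<close> add up to \<open>2 * \<kappa>\<close>
    times the spin matrix, hence disappear from the commutator.\<close>
  moreover define \<kappa> where "\<kappa> = q x * cnj (q x) + r x * cnj (r x)"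
  have "dzb (\<lambda>x. 2 * \<i> * ?K x) x = - 2 * \<i> * (\<kappa> * ?\<sigma> x - cnj (a x) * b x * \<gamma> x - a x * cnj (b x) * \<beta> x)"
    by (simp add: h dz_simps D \<beta> \<gamma> \<kappa>_def algebra_simps)
  moreover have "dzb (\<lambda>x. - 2 * \<i> * ?K x) x = 2 * \<i> * (\<kappa> * ?\<sigma> x - cnj (a x) * b x * \<gamma> x - a x * cnj (b x) * \<beta> x)"
    by (simp add: h dz_simps D \<beta> \<gamma> \<kappa>_def algebra_simps)
  moreover have "dzb (\<lambda>x. - 2 * \<i> * ?M x) x = - 2 * \<i> * ((b x)\<^sup>2 * \<gamma> x + (a x)\<^sup>2 * \<beta> x - 2 * a x * b x * \<kappa>)"
    by (simp add: h dz_simps D \<beta> \<gamma> \<kappa>_def power2_eq_square algebra_simps)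
  moreover have "dzb (\<lambda>x. 2 * \<i> * ?N x) x = - 2 * \<i> * (2 * cnj (a x) * cnj (b x) * \<kappa> - (cnj (a x))\<^sup>2 * \<gamma> x - (cnj (b x))\<^sup>2 * \<beta> x)"
    by (simp add: h dz_simps D \<beta> \<gamma> \<kappa>_def power2_eq_square algebra_simps)
  ultimately have Y: "mdzb (mdz (spin a b)) x = mat2
      (- 2 * \<i> * (\<kappa> * ?\<sigma> x - cnj (a x) * b x * \<gamma> x - a x * cnj (b x) * \<beta> x))
      (- 2 * \<i> * ((b x)\<^sup>2 * \<gamma> x + (a x)\<^sup>2 * \<beta> x - 2 * a x * b x * \<kappa>))
      (- 2 * \<i> * (2 * cnj (a x) * cnj (b x) * \<kappa> - (cnj (a x))\<^sup>2 * \<gamma> x - (cnj (b x))\<^sup>2 * \<beta> x))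
      (2 * \<i> * (\<kappa> * ?\<sigma> x - cnj (a x) * b x * \<gamma> x - a x * cnj (b x) * \<beta> x))" by simp
  \<comment> \<open>Conjugates become independent variables, which makes this a polynomial identity:
    before unimodularity is applied, the left side is \<open>A * A' - B * B'\<close> times the right
    side.\<close>
  have alg: "A * A' - B * B' = 1 \<Longrightarrow> cscale (- 1 / 2) (commutator
      (mat2 (- \<i> * (A * A' + B * B')) (2 * \<i> * (A * B)) (- 2 * \<i> * (A' * B')) (\<i> * (A * A' + B * B')))
      (mat2 (- 2 * \<i> * (k * (A * A' + B * B') - A' * B * g - A * B' * e))
        (- 2 * \<i> * (B\<^sup>2 * g + A\<^sup>2 * e - 2 * A * B * k))
        (- 2 * \<i> * (2 * A' * B' * k - A'\<^sup>2 * g - B'\<^sup>2 * e))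
        (2 * \<i> * (k * (A * A' + B * B') - A' * B * g - A * B' * e)))) =
      mat2 (2 * (A' * B * g - A * B' * e)) (2 * (A\<^sup>2 * e - B\<^sup>2 * g))
        (2 * (A'\<^sup>2 * g - B'\<^sup>2 * e)) (- 2 * (A' * B * g - A * B' * e))" for A A' B B' k e g
  proof -
    assume u: "A * A' - B * B' = 1"
    have "cscale (- 1 / 2) (commutator
      (mat2 (- \<i> * (A * A' + B * B')) (2 * \<i> * (A * B)) (- 2 * \<i> * (A' * B')) (\<i> * (A * A' + B * B')))
      (mat2 (- 2 * \<i> * (k * (A * A' + B * B') - A' * B * g - A * B' * e))
        (- 2 * \<i> * (B\<^sup>2 * g + A\<^sup>2 * e - 2 * A * B * k))
        (- 2 * \<i> * (2 * A' * B' * k - A'\<^sup>2 * g - B'\<^sup>2 * e))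
        (2 * \<i> * (k * (A * A' + B * B') - A' * B * g - A * B' * e)))) =
      cscale (A * A' - B * B') (mat2 (2 * (A' * B * g - A * B' * e)) (2 * (A\<^sup>2 * e - B\<^sup>2 * g))
        (2 * (A'\<^sup>2 * g - B'\<^sup>2 * e)) (- 2 * (A' * B * g - A * B' * e)))"
      unfolding commutator_def mat2_arith mat2_eq_iff
      by (simp add: power2_eq_square algebra_simps)
    then show ?thesis unfolding u by (simp add: mat2_arith)
  qed
  show ?thesis unfolding Y unfolding spin_def by (rule alg[OF unimodularD[OF u]])
qed

text \<open>If \<open>G_t = \<i> G U\<close>, the derivative of \<open>-i G sigma3 G^-1\<close> is
  \<open>G [U, sigma3] G^-1\<close>. The diagonal part \<open>u\<close> of \<open>U\<close> commutes
  with \<open>sigma3\<close> and drops out, which reflects the phase freedom of the frame.\<close>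

lemma dt_spin:
  assumes c: "Ck 2 2 a" "Ck 2 2 b" and t: "time_frame a b \<beta> \<gamma> u" and \<gamma>: "\<gamma> x = cnj (\<beta> x)"
  shows "dt (spin a b) x =
    mat2 (2 * (cnj (a x) * b x * \<gamma> x - a x * cnj (b x) * \<beta> x)) (2 * ((a x)\<^sup>2 * \<beta> x - (b x)\<^sup>2 * \<gamma> x))
      (2 * ((cnj (a x))\<^sup>2 * \<gamma> x - (cnj (b x))\<^sup>2 * \<beta> x)) (- 2 * (cnj (a x) * b x * \<gamma> x - a x * cnj (b x) * \<beta> x))"
proof -
  have h: "has_dt a" "has_dt b"
    using c[THEN Ck_has_partials(3)] by simp_all
  let ?\<sigma> = "\<lambda>x. a x * cnj (a x) + b x * cnj (b x)"
  have "dt (spin a b) x = mat2 (dt (\<lambda>x. - \<i> * ?\<sigma> x) x) (dt (\<lambda>x. 2 * \<i> * (a x * b x)) x)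
      (dt (\<lambda>x. - 2 * \<i> * (cnj (a x) * cnj (b x))) x) (dt (\<lambda>x. \<i> * ?\<sigma> x) x)"
    unfolding spin_def[abs_def]
    by (rule dt_mat2[where w = 2]) (intro Ck_mult Ck_add Ck_cnj Ck_const c zero_less_numeral)+
  then show ?thesis
    unfolding mat2_eq_iff
    by (simp add: has_partials h time_frameD[OF t] \<gamma> power2_eq_square algebra_simps)
qed

section \<open>Zero curvature\<close>

text \<open>The coefficient matrix has determinant 1, and both proofs are Cramer's rule. Curvature
  identities arise multiplied by the rows of a frame; this removes the frame.\<close>

lemma unimodular_rows_independent:
  fixes A B X Y :: complex
  assumes "A * cnj A - B * cnj B = 1" "A * X + B * Y = 0" "cnj B * X + cnj A * Y = 0"
  shows "X = 0" "Y = 0"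
proof -
  have "X = cnj A * (A * X + B * Y) - B * (cnj B * X + cnj A * Y)"
    using arg_cong[OF assms(1), of "\<lambda>z. z * X"] by (simp add: algebra_simps)
  then show "X = 0" by (simp add: assms)
  have "Y = A * (cnj B * X + cnj A * Y) - cnj B * (A * X + B * Y)"
    using arg_cong[OF assms(1), of "\<lambda>z. z * Y"] by (simp add: algebra_simps)
  then show "Y = 0" by (simp add: assms)
qed

lemma unimodular_nonzero: "unimodular a b \<Longrightarrow> a x \<noteq> 0"
proof
  assume "unimodular a b" "a x = 0"
  then have "- (b x * cnj (b x)) = 1" using unimodularD[of a b x] by simp
  then have "Re (- (b x * cnj (b x))) = 1" by simp
  then show False by (simp add: complex_mult_cnj) (smt (verit) zero_le_power2)
qed

text \<open>The commutators of \<open>dz\<close> and \<open>dzb\<close> on \<open>a\<close> and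
  \<open>b\<close> are the row \<open>(a, b)\<close> applied to a curvature matrix with diagonal
  entries \<open>?X\<close>, \<open>- ?X\<close> and off-diagonal entries \<open>?Z\<close>,
  \<open>- cnj ?Z\<close>. Its vanishing is the purely spatial part of \<open>NLS\<close>.\<close>

lemma space_frame_compatible:
  assumes c: "Ck 2 2 a" "Ck 2 2 b" "Ck 2 1 p" "Ck 2 1 q" "Ck 2 1 r"
    and uni: "unimodular a b" and sf: "space_frame a b p q r"
  shows "cnj (dzb p x) + dzb p x + q x * cnj (q x) - r x * cnj (r x) = 0"
    "dzb q x - cnj (dzb r x) + 2 * p x * cnj (r x) + 2 * cnj (p x) * q x = 0"
proof -
  note S = space_frameD[OF sf]
  have h: "has_d1 a" "has_d2 a" "has_d1 b" "has_d2 b" "has_d1 p" "has_d2 p"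
    "has_d1 q" "has_d2 q" "has_d1 r" "has_d2 r"
    using c[THEN Ck_has_partials(1)] c[THEN Ck_has_partials(2)] by simp_all
  let ?X = "cnj (dzb p x) + dzb p x + q x * cnj (q x) - r x * cnj (r x)"
  let ?Z = "dzb q x - cnj (dzb r x) + 2 * p x * cnj (r x) + 2 * cnj (p x) * q x"
  have "dz (dzb a) x - dzb (dz a) x = a x * ?X - b x * cnj ?Z"
    by (simp add: S h dz_simps algebra_simps)
  then have 1: "a x * ?X - b x * cnj ?Z = 0" using dz_dzb_commute[OF _ c(1)] by simp
  have "dz (dzb b) x - dzb (dz b) x = a x * ?Z - b x * ?X"
    by (simp add: S h dz_simps algebra_simps)
  then have 2: "a x * ?Z - b x * ?X = 0" using dz_dzb_commute[OF _ c(2)] by simp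
  \<comment> \<open>\<open>?X\<close> is real, so conjugating the first relation supplies the
    missing second equation of a linear system with an SU(1,1) coefficient matrix.\<close>
  have "cnj ?X = ?X" by (simp add: algebra_simps)
  then have "cnj (a x) * ?X - cnj (b x) * ?Z = cnj (a x * ?X - b x * cnj ?Z)"
    by (simp only: complex_cnj_diff complex_cnj_mult complex_cnj_cnj)
  then have "cnj (a x) * ?X - cnj (b x) * ?Z = 0" by (simp only: 1 complex_cnj_zero)
  then have "cnj (b x) * (- ?Z) + cnj (a x) * ?X = 0" "a x * (- ?Z) + b x * ?X = 0"
    using 2 by (simp_all add: algebra_simps)
  note null = unimodular_rows_independent[OF unimodularD[OF uni] this(2,1)]
  show "?X = 0" by (rule null(2))
  show "?Z = 0" using null(1) by (simp only: neg_equal_0_iff_equal)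
qed

text \<open>The evolution equations come from commuting \<open>dt\<close> with \<open>dz\<close>,
  which takes order 3 in the parabolic class. The hypothesis \<open>tf\<close> has the conjugate of
  the \<open>q\<close> expression in place of the \<open>r\<close> expression; spatial compatibility
  shows that they agree.\<close>

lemma frame_imp_NLS:
  assumes c: "Ck 2 3 a" "Ck 2 3 b" "Ck 2 2 p" "Ck 2 2 q" "Ck 2 2 r" and cu: "Ck 2 1 u"
    and uni: "unimodular a b" and sf: "space_frame a b p q r"
    and tf: "time_frame a b (\<lambda>x. dzb q x + 2 * cnj (p x) * q x) (\<lambda>x. cnj (dzb q x + 2 * cnj (p x) * q x)) u"
  shows "NLS p q r u"
proof -
  define \<beta> where "\<beta> = (\<lambda>x. dzb q x + 2 * cnj (p x) * q x)"
  define \<gamma> where "\<gamma> = (\<lambda>x. dzb r x - 2 * cnj (p x) * r x)"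
  note S = space_frameD[OF sf]
  have h: "has_d1 a" "has_d2 a" "has_dt a" "has_d1 b" "has_d2 b" "has_dt b" "has_d1 p" "has_d2 p" "has_dt p"
    "has_d1 q" "has_d2 q" "has_dt q" "has_d1 r" "has_d2 r" "has_dt r"
    using c[THEN Ck_has_partials(1)] c[THEN Ck_has_partials(2)] c[THEN Ck_has_partials(3)] by simp_all
  have hu: "has_d1 u" "has_d2 u" using Ck_has_partials[OF cu] by simp_all
  have h2: "has_d1 (dzb q)" "has_d2 (dzb q)" "has_d1 (dzb r)" "has_d2 (dzb r)"
    using Ck_has_partials[OF Ck_dz(2)[OF _ c(4), of 1]] Ck_has_partials[OF Ck_dz(2)[OF _ c(5), of 1]]
    by simp_all
  have nls45: "cnj (dzb p x) + dzb p x + q x * cnj (q x) - r x * cnj (r x) = 0"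
    "dzb q x - cnj (dzb r x) + 2 * p x * cnj (r x) + 2 * cnj (p x) * q x = 0" for x
    by (rule space_frame_compatible[OF _ _ _ _ _ uni sf]; (intro c[THEN Ck_mono])?; simp)+
  have \<gamma>_eq: "(\<lambda>x. cnj (dzb q x + 2 * cnj (p x) * q x)) = \<gamma>"
  proof
    fix x
    have "cnj (dzb q x - cnj (dzb r x) + 2 * p x * cnj (r x) + 2 * cnj (p x) * q x) = cnj 0"
      by (simp only: nls45)
    then show "cnj (dzb q x + 2 * cnj (p x) * q x) = \<gamma> x" by (simp add: \<gamma>_def algebra_simps)
  qed
  then have cnj_\<beta>: "cnj (\<beta> x) = \<gamma> x" for x by (auto simp: \<beta>_def dest: fun_cong)
  have cnj_\<gamma>: "cnj (\<gamma> x) = \<beta> x" for x by (simp add: cnj_\<beta>[symmetric])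
  have T: "dt a = (\<lambda>x. \<i> * (a x * of_real (u x) + b x * \<gamma> x))"
    "dt b = (\<lambda>x. - \<i> * (a x * \<beta> x + b x * of_real (u x)))"
    using time_frameD[OF tf[unfolded \<gamma>_eq, folded \<beta>_def]] .
  have h3: "has_d1 \<beta>" "has_d2 \<beta>" "has_d1 \<gamma>" "has_d2 \<gamma>"
    unfolding \<beta>_def \<gamma>_def by (simp_all add: has_partials h h2)
  have dz\<beta>\<gamma>: "dz \<beta> x = dzb (dz q) x + 2 * dz (\<lambda>y. cnj (p y) * q y) x"
    "dz \<gamma> x = dzb (dz r) x - 2 * dz (\<lambda>y. cnj (p y) * r y) x" for x
    unfolding \<beta>_def \<gamma>_def
    by (simp_all add: dz_simps h h2 dz_dzb_commute[OF _ c(4)] dz_dzb_commute[OF _ c(5)] algebra_simps)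
  have qr: "dzb (\<lambda>y. q y * r y) x = \<beta> x * r x + q x * \<gamma> x" for x
    by (simp add: \<beta>_def \<gamma>_def dz_simps h algebra_simps)
  \<comment> \<open>Left sides of the evolution equations regrouped by \<open>\<beta>\<close> and
    \<open>\<gamma>\<close>: the terms \<open>- 2 * p * dzb q\<close> and
    \<open>- 4 * (cmod p)^2 * q\<close> combine into \<open>- 2 * p * \<beta>\<close>, and similarly
    for \<open>r\<close>.\<close>
  define E1 where "E1 = (\<lambda>x. \<i> * dt q x + dz \<beta> x - 2 * of_real (u x) * q x - 2 * p x * \<beta> x)"
  define E2 where "E2 = (\<lambda>x. \<i> * dt r x - dz \<gamma> x + 2 * of_real (u x) * r x - 2 * p x * \<gamma> x)"
  define E3 where "E3 = (\<lambda>x. \<i> * dt p x + \<beta> x * r x + q x * \<gamma> x - dz (\<lambda>y. of_real (u y)) x)"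
  \<comment> \<open>\<open>cnj b\<close> is the entry of \<open>G\<close> below \<open>a\<close>.
    Commuting its derivatives gives the second relation between \<open>E3\<close> and
    \<open>E2\<close>; the first comes from \<open>a\<close>.\<close>
  have bc: "dz (\<lambda>x. cnj (b x)) = (\<lambda>x. - (cnj (a x) * r x) - cnj (b x) * p x)"
    "dt (\<lambda>x. cnj (b x)) = (\<lambda>x. \<i> * (cnj (a x) * \<gamma> x + cnj (b x) * of_real (u x)))"
    by (auto simp: dz_simps h S T cnj_\<beta> cnj_\<gamma> algebra_simps simp del: split_paired_All)
  have E: "E1 x = 0" "E2 x = 0" "E3 x = 0" for x
  proof -
    have "dt (dz a) x - dz (dt a) x = \<i> * (a x * E3 x + b x * E2 x)"
      unfolding S(1) T(1) by (simp add: E2_def E3_def dz_simps h hu h3 S(1,2) T algebra_simps)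
    then have 1: "a x * E3 x + b x * E2 x = 0" using dt_dz_commute[OF c(1)] by simp
    have "dt (dz (\<lambda>x. cnj (b x))) x - dz (dt (\<lambda>x. cnj (b x))) x = \<i> * (cnj (b x) * E3 x + cnj (a x) * E2 x)"
      unfolding bc by (simp add: E2_def E3_def dz_simps h hu h3 S(3,4) T cnj_\<beta> cnj_\<gamma> algebra_simps)
    then have 2: "cnj (b x) * E3 x + cnj (a x) * E2 x = 0"
      using dt_dz_commute[OF Ck_cnj[OF _ c(2)]] by simp
    show 3: "E3 x = 0" "E2 x = 0"
      using unimodular_rows_independent[OF unimodularD[OF uni] 1 2] by simp_all
    have "dt (dz b) x - dz (dt b) x = \<i> * (a x * E1 x - b x * E3 x)"
      unfolding S(2) T(2) by (simp add: E1_def E3_def dz_simps h hu h3 S(1,2) T algebra_simps)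
    then have "a x * E1 x = 0" using dt_dz_commute[OF c(2)] 3 by simp
    moreover have "a x \<noteq> 0" by (rule unimodular_nonzero[OF uni])
    ultimately show "E1 x = 0" by simp
  qed
  show ?thesis
    unfolding NLS_def
  proof (intro allI conjI)
    fix x
    show "\<i> * dt q x + dzb (dz q) x - 2 * of_real (u x) * q x + 2 * dz (\<lambda>y. cnj (p y) * q y) x
        - 2 * p x * dzb q x - 4 * of_real ((cmod (p x))\<^sup>2) * q x = 0"
      using E(1)[of x] unfolding E1_def dz\<beta>\<gamma> by (simp add: \<beta>_def complex_norm_square algebra_simps del: of_real_power)
    show "\<i> * dt r x - dzb (dz r) x + 2 * of_real (u x) * r x + 2 * dz (\<lambda>y. cnj (p y) * r y) x
        - 2 * p x * dzb r x + 4 * of_real ((cmod (p x))\<^sup>2) * r x = 0"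
      using E(2)[of x] unfolding E2_def dz\<beta>\<gamma> by (simp add: \<gamma>_def complex_norm_square algebra_simps del: of_real_power)
    show "\<i> * dt p x + dzb (\<lambda>y. q y * r y) x - dz (\<lambda>y. of_real (u y)) x = 0"
      using E(3)[of x] unfolding E3_def qr by (simp add: algebra_simps)
    show "dz (\<lambda>y. cnj (p y)) x + dzb p x = - of_real ((cmod (q x))\<^sup>2) + of_real ((cmod (r x))\<^sup>2)"
      using nls45(1)[of x] by (simp add: dz_simps h complex_norm_square algebra_simps del: of_real_power)
    show "- dz (\<lambda>y. cnj (r y)) x + dzb q x = - 2 * (p x * cnj (r x) + cnj (p x) * q x)"
      using nls45(2)[of x] by (simp add: dz_simps h algebra_simps add_eq_0_iff)
  qed
qed

section \<open>Invariant pairings and uniqueness of frames\<close>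

lemma constant_if_partials_zero:
  fixes f :: "pt \<Rightarrow> 'a::real_normed_vector"
  assumes "has_dt f" "has_d1 f" "has_d2 f" "\<And>x. dt f x = 0" "\<And>x. d1 f x = 0" "\<And>x. d2 f x = 0"
  shows "f x = f (0, 0, 0)"
proof -
  have const: "g s = g 0" if "\<And>s. (g has_vector_derivative 0) (at s)" for g :: "real \<Rightarrow> 'a" and s
    using has_vector_derivative_zero_constant[of UNIV g] that by (metis UNIV_I convex_UNIV)
  obtain t y z where x: "x = (t, y, z)" by (cases x)
  have "f (t, y, z) = f (0, y, z)"
    using const[of "\<lambda>s. f (s, y, z)"] assms(1,4) unfolding has_dt_iff by simp
  also have "\<dots> = f (0, 0, z)"
    using const[of "\<lambda>s. f (0, s, z)"] assms(2,5) unfolding has_d1_iff by simp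
  also have "\<dots> = f (0, 0, 0)"
    using const[of "\<lambda>s. f (0, 0, s)"] assms(3,6) unfolding has_d2_iff by simp
  finally show ?thesis by (simp add: x)
qed

lemma constant_if_dz_zero:
  assumes "has_dt f" "has_d1 f" "has_d2 f" "\<And>x. dt f x = 0" "\<And>x. dz f x = 0" "\<And>x. dzb f x = 0"
  shows "f x = f (0, 0, 0)"
  by (rule constant_if_partials_zero) (simp_all add: assms d1_eq_dz d2_eq_dz)

text \<open>An su(1,1)-valued connection preserves the Hermitian form of signature (1,1) and, being
  trace free, the determinant of two rows. Pairing a frame with itself gives unimodularity, pairing
  two frames gives uniqueness.\<close>

lemma frame_pairing_constant:
  assumes h: "has_d1 a" "has_d2 a" "has_dt a" "has_d1 b" "has_d2 b" "has_dt b"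
    "has_d1 a'" "has_d2 a'" "has_dt a'" "has_d1 b'" "has_d2 b'" "has_dt b'"
    and sf: "space_frame a b p q r" "space_frame a' b' p q r"
    and tf: "time_frame a b \<beta> \<gamma> u" "time_frame a' b' \<beta> \<gamma> u" and \<gamma>: "\<And>x. \<gamma> x = cnj (\<beta> x)"
  shows "a x * cnj (a' x) - b x * cnj (b' x) =
      a (0, 0, 0) * cnj (a' (0, 0, 0)) - b (0, 0, 0) * cnj (b' (0, 0, 0))"
    "a x * b' x - b x * a' x = a (0, 0, 0) * b' (0, 0, 0) - b (0, 0, 0) * a' (0, 0, 0)"
proof -
  note D = space_frameD[OF sf(1)] space_frameD[OF sf(2)] time_frameD[OF tf(1)] time_frameD[OF tf(2)]
  show "a x * cnj (a' x) - b x * cnj (b' x) =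
      a (0, 0, 0) * cnj (a' (0, 0, 0)) - b (0, 0, 0) * cnj (b' (0, 0, 0))"
    by (rule constant_if_dz_zero) (simp_all add: dz_simps h D \<gamma> algebra_simps)
  show "a x * b' x - b x * a' x = a (0, 0, 0) * b' (0, 0, 0) - b (0, 0, 0) * a' (0, 0, 0)"
    by (rule constant_if_dz_zero) (simp_all add: dz_simps h D \<gamma> algebra_simps)
qed

text \<open>At the origin the two rows have determinant 0 and Hermitian pairing 1. Both persist: the
  rows are proportional everywhere, and the pairing forces the factor 1.\<close>

lemma frame_unique:
  assumes h: "has_d1 a" "has_d2 a" "has_dt a" "has_d1 b" "has_d2 b" "has_dt b"
    "has_d1 a'" "has_d2 a'" "has_dt a'" "has_d1 b'" "has_d2 b'" "has_dt b'"
    and sf: "space_frame a b p q r" "space_frame a' b' p q r"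
    and tf: "time_frame a b \<beta> \<gamma> u" "time_frame a' b' \<beta> \<gamma> u" and \<gamma>: "\<And>x. \<gamma> x = cnj (\<beta> x)"
    and uni: "unimodular a' b'"
    and init: "a (0, 0, 0) = 1" "b (0, 0, 0) = 0" "a' (0, 0, 0) = 1" "b' (0, 0, 0) = 0"
  shows "a = a'" "b = b'"
proof -
  have "a x = a' x \<and> b x = b' x" for x
  proof -
    have 1: "a x * cnj (a' x) - b x * cnj (b' x) = 1" and 2: "a x * b' x = b x * a' x"
      using frame_pairing_constant[OF h sf tf \<gamma>, of x] by (simp_all add: init)
    have 3: "a' x * cnj (a' x) - b' x * cnj (b' x) = 1" by (rule unimodularD[OF uni])
    have "a x = a x * (a' x * cnj (a' x) - b' x * cnj (b' x))" by (simp add: 3)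
    also have "\<dots> = a' x * (a x * cnj (a' x)) - (a x * b' x) * cnj (b' x)" by (simp add: algebra_simps)
    also have "\<dots> = a' x * (a x * cnj (a' x) - b x * cnj (b' x))" by (simp add: 2 algebra_simps)
    finally have "a x = a' x" by (simp add: 1)
    moreover have "b x = b' x"
    proof -
      have "b x = b x * (a' x * cnj (a' x) - b' x * cnj (b' x))" by (simp add: 3)
      also have "\<dots> = (b x * a' x) * cnj (a' x) - b' x * (b x * cnj (b' x))" by (simp add: algebra_simps)
      also have "\<dots> = b' x * (a x * cnj (a' x) - b x * cnj (b' x))"
        by (simp only: 2[symmetric]) (simp add: algebra_simps)
      finally show ?thesis by (simp add: 1)
    qed
    ultimately show ?thesis by simp
  qed
  then show "a = a'" "b = b'" by (auto simp del: split_paired_All)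
qed

section \<open>Frames from solutions of the Schroedinger system\<close>

lemma has_partials_Pair:
  "has_d1 f \<Longrightarrow> has_d1 g \<Longrightarrow> has_d1 (\<lambda>x. (f x, g x))"
  "has_d1 f \<Longrightarrow> has_d1 g \<Longrightarrow> d1 (\<lambda>x. (f x, g x)) = (\<lambda>x. (d1 f x, d1 g x))"
  "has_d2 f \<Longrightarrow> has_d2 g \<Longrightarrow> has_d2 (\<lambda>x. (f x, g x))"
  "has_d2 f \<Longrightarrow> has_d2 g \<Longrightarrow> d2 (\<lambda>x. (f x, g x)) = (\<lambda>x. (d2 f x, d2 g x))"
  "has_dt f \<Longrightarrow> has_dt g \<Longrightarrow> has_dt (\<lambda>x. (f x, g x))"
  "has_dt f \<Longrightarrow> has_dt g \<Longrightarrow> dt (\<lambda>x. (f x, g x)) = (\<lambda>x. (dt f x, dt g x))"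
  unfolding has_d1_iff[of f] has_d1_iff[of g] has_d2_iff[of f] has_d2_iff[of g] has_dt_iff[of f] has_dt_iff[of g]
  by (intro has_d1I[where g = "\<lambda>x. (d1 f x, d1 g x)"] has_d2I[where g = "\<lambda>x. (d2 f x, d2 g x)"]
      has_dtI[where g = "\<lambda>x. (dt f x, dt g x)"] has_vector_derivative_Pair; blast)+

lemmas has_partials_divide =
  has_d1_linear[OF bounded_linear_divide] has_d2_linear[OF bounded_linear_divide]
  has_dt_linear[OF bounded_linear_divide]

lemma Ck_Pair:
  assumes "0 < w" "Ck w k f" "Ck w k g"
  shows "Ck w k (\<lambda>x. (f x, g x))"
proof -
  have "bounded_linear (\<lambda>a. (a, 0))" "bounded_linear (\<lambda>b. (0, b))"
    by (intro bounded_linear_Pair bounded_linear_ident bounded_linear_zero)+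
  from Ck_add[OF assms(1) Ck_linear[OF assms(1) this(1) assms(2)] Ck_linear[OF assms(1) this(2) assms(3)]]
  show ?thesis by simp
qed

text \<open>A row vector times the trace free matrix with rows \<open>(c, w)\<close> and \<open>(y, -c)\<close>.\<close>

definition row_act :: "complex \<times> complex \<Rightarrow> complex \<times> complex \<times> complex \<Rightarrow> complex \<times> complex" where
  "row_act v X = (case v of (a, b) \<Rightarrow> case X of (c, w, y) \<Rightarrow> (a * c + b * y, a * w - b * c))"

lemma bounded_bilinear_row_act: "bounded_bilinear row_act"
proof -
  have "bilinear row_act"
    unfolding bilinear_def
    by (auto intro!: linearI simp: row_act_def algebra_simps split: prod.split)
  then show ?thesis by (simp add: bilinear_conv_bounded_bilinear)
qed

text \<open>The system in solved form, oriented as rewrite rules: once \<open>dt p\<close>,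
  \<open>dt q\<close>, \<open>dt r\<close>, \<open>dzb p\<close> and \<open>dzb r\<close> are
  eliminated, flatness of the connection is a polynomial identity in what is left.\<close>

lemma NLS_flat:
  assumes c: "Ck 2 2 p" "Ck 2 2 q" "Ck 2 2 r" and nls: "NLS p q r u"
    and \<beta>: "\<beta> = (\<lambda>x. dzb q x + 2 * cnj (p x) * q x)" and \<gamma>: "\<gamma> = (\<lambda>x. dzb r x - 2 * cnj (p x) * r x)"
  shows "\<gamma> x = cnj (\<beta> x)"
    "dzb p x = - cnj (dzb p x) - q x * cnj (q x) + r x * cnj (r x)"
    "dzb r x = cnj (dzb q x) + 2 * cnj (p x) * r x + 2 * p x * cnj (q x)"
    "dt p x = \<i> * (\<beta> x * r x + q x * \<gamma> x - dz (\<lambda>y. of_real (u y)) x)"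
    "dt q x = \<i> * (dz \<beta> x - 2 * of_real (u x) * q x - 2 * p x * \<beta> x)"
    "dt r x = - \<i> * (dz \<gamma> x - 2 * of_real (u x) * r x + 2 * p x * \<gamma> x)"
proof -
  have h: "has_d1 p" "has_d2 p" "has_d1 q" "has_d2 q" "has_d1 r" "has_d2 r"
    using c[THEN Ck_has_partials(1)] c[THEN Ck_has_partials(2)] by simp_all
  have h2: "has_d1 (dzb q)" "has_d2 (dzb q)" "has_d1 (dzb r)" "has_d2 (dzb r)"
    using Ck_has_partials[OF Ck_dz(2)[OF _ c(2), of 1]] Ck_has_partials[OF Ck_dz(2)[OF _ c(3), of 1]]
    by simp_all
  have dz\<beta>\<gamma>: "dz \<beta> x = dzb (dz q) x + 2 * dz (\<lambda>y. cnj (p y) * q y) x"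
    "dz \<gamma> x = dzb (dz r) x - 2 * dz (\<lambda>y. cnj (p y) * r y) x"
    unfolding \<beta> \<gamma>
    by (simp_all add: dz_simps h h2 dz_dzb_commute[OF _ c(2)] dz_dzb_commute[OF _ c(3)] algebra_simps)
  have qr: "dzb (\<lambda>y. q y * r y) x = \<beta> x * r x + q x * \<gamma> x"
    by (simp add: \<beta> \<gamma> dz_simps h algebra_simps)
  note n = nls[unfolded NLS_def, rule_format, of x]
  have n4: "cnj (dzb p x) + dzb p x = - (q x * cnj (q x)) + r x * cnj (r x)"
    using n by (simp add: dz_simps h complex_norm_square del: of_real_power)
  then show "dzb p x = - cnj (dzb p x) - q x * cnj (q x) + r x * cnj (r x)"
    by (simp add: algebra_simps)
  have "- cnj (dzb r x) + dzb q x = - 2 * (p x * cnj (r x) + cnj (p x) * q x)"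
    using n by (simp add: dz_simps h)
  then have "cnj (- cnj (dzb r x) + dzb q x) = cnj (- 2 * (p x * cnj (r x) + cnj (p x) * q x))"
    by (simp only:)
  then show n5: "dzb r x = cnj (dzb q x) + 2 * cnj (p x) * r x + 2 * p x * cnj (q x)"
    by (simp add: algebra_simps)
  show "\<gamma> x = cnj (\<beta> x)" by (simp add: \<beta> \<gamma> n5)
  have "\<i> * dt p x + (\<beta> x * r x + q x * \<gamma> x) - dz (\<lambda>y. of_real (u y)) x = 0"
    using n qr by simp
  from arg_cong[OF this, of "\<lambda>z. - \<i> * z"]
  show "dt p x = \<i> * (\<beta> x * r x + q x * \<gamma> x - dz (\<lambda>y. of_real (u y)) x)"
    by (simp add: algebra_simps)
  have "\<i> * dt q x + dz \<beta> x - 2 * of_real (u x) * q x - 2 * p x * \<beta> x = 0"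
    using n unfolding dz\<beta>\<gamma> by (simp add: \<beta> complex_norm_square algebra_simps del: of_real_power)
  from arg_cong[OF this, of "\<lambda>z. - \<i> * z"]
  show "dt q x = \<i> * (dz \<beta> x - 2 * of_real (u x) * q x - 2 * p x * \<beta> x)"
    by (simp add: algebra_simps)
  have "\<i> * dt r x - dz \<gamma> x + 2 * of_real (u x) * r x - 2 * p x * \<gamma> x = 0"
    using n unfolding dz\<beta>\<gamma> by (simp add: \<gamma> complex_norm_square algebra_simps del: of_real_power)
  from arg_cong[OF this, of "\<lambda>z. - \<i> * z"]
  show "dt r x = - \<i> * (dz \<gamma> x - 2 * of_real (u x) * r x + 2 * p x * \<gamma> x)"
    by (simp add: algebra_simps)
qed

lemma NLS_imp_frame:
  assumes c: "Ck 2 2 p" "Ck 2 2 q" "Ck 2 2 r" and cu: "Ck 2 1 u" and nls: "NLS p q r u"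
    and \<beta>: "\<beta> = (\<lambda>x. dzb q x + 2 * cnj (p x) * q x)" and \<gamma>: "\<gamma> = (\<lambda>x. dzb r x - 2 * cnj (p x) * r x)"
  obtains a b where "continuous_on UNIV a" "continuous_on UNIV b"
    "has_dt a" "has_d1 a" "has_d2 a" "has_dt b" "has_d1 b" "has_d2 b"
    "a (0, 0, 0) = 1" "b (0, 0, 0) = 0" "space_frame a b p q r" "time_frame a b \<beta> \<gamma> u" "unimodular a b"
proof -
  note flat = NLS_flat[OF c nls \<beta> \<gamma>]
  have \<gamma>_eq: "\<gamma> = (\<lambda>x. cnj (\<beta> x))" using flat(1) by blast
  have c\<beta>: "Ck 2 1 \<beta>" "Ck 2 1 \<gamma>"
    unfolding \<gamma>_eq unfolding \<beta>
    by (intro Ck_cnj Ck_add Ck_mult Ck_const zero_less_numeral Ck_dz[OF _ c(2)] c[THEN Ck_mono]; simp)+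
  have h: "has_d1 p" "has_d2 p" "has_dt p" "has_d1 q" "has_d2 q" "has_dt q" "has_d1 r" "has_d2 r" "has_dt r"
    "has_d1 \<beta>" "has_d2 \<beta>" "has_d1 \<gamma>" "has_d2 \<gamma>" "has_d1 u" "has_d2 u"
    using c[THEN Ck_has_partials(1)] c[THEN Ck_has_partials(2)] c[THEN Ck_has_partials(3)]
      c\<beta>[THEN Ck_has_partials(1)] c\<beta>[THEN Ck_has_partials(2)] cu[THEN Ck_has_partials(1)] cu[THEN Ck_has_partials(2)]
    by simp_all
  \<comment> \<open>In triples \<open>(c, w, y)\<close> as in \<open>row_act\<close>, the connection
    has \<open>dz\<close> component \<open>(- p, - q, - r)\<close> and \<open>dzb\<close> component
    \<open>(cnj p, - cnj r, - cnj q)\<close>. \<open>X1\<close> is half their sum and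
    \<open>X2\<close> is \<open>\<i> / 2\<close> times their difference, as in
    \<open>d1_eq_dz\<close> and \<open>d2_eq_dz\<close>.\<close>
  define X1 where "X1 = (\<lambda>x. (1 / 2 * (cnj (p x) - p x), - 1 / 2 * (q x + cnj (r x)), - 1 / 2 * (r x + cnj (q x))))"
  define X2 where "X2 = (\<lambda>x. (- \<i> / 2 * (cnj (p x) + p x), - \<i> / 2 * (q x - cnj (r x)), - \<i> / 2 * (r x - cnj (q x))))"
  define T where "T = (\<lambda>x. (\<i> * of_real (u x), - \<i> * \<beta> x, \<i> * \<gamma> x))"
  have cX: "Ck 2 2 X1" "Ck 2 2 X2" "Ck 2 1 T"
    unfolding X1_def X2_def T_def
    by (intro Ck_Pair Ck_mult Ck_add Ck_diff Ck_cnj Ck_const Ck_of_real c cu c\<beta> zero_less_numeral)+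
  note hX = cX[THEN Ck_has_partials(1), simplified] cX[THEN Ck_has_partials(2), simplified]
    cX(1,2)[THEN Ck_has_partials(3), simplified]
  have cdX: "continuous_on UNIV (dt X1)" "continuous_on UNIV (dt X2)" "continuous_on UNIV (d1 T)"
      "continuous_on UNIV (d2 T)" "continuous_on UNIV (d2 X1)" "continuous_on UNIV (d1 X2)"
    by (rule Ck_continuous[of 2 0]; intro Ck_dt[OF _ cX(1)] Ck_dt[OF _ cX(2)] Ck_d1[OF _ cX(3)]
      Ck_d2[OF _ cX(3)] Ck_d2[OF _ cX(1)] Ck_d1[OF _ cX(2)]; simp)+
  let ?uz = "\<lambda>x. dz (\<lambda>y. complex_of_real (u y)) x"
  \<comment> \<open>\<open>u\<close> is real and \<open>\<gamma>\<close> is conjugate to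
    \<open>\<beta>\<close>, so each \<open>dzb\<close> is a conjugate of a \<open>dz\<close>. This
    brings the derivatives of \<open>T\<close> to the form in which \<open>NLS_flat\<close>
    expresses the time derivatives.\<close>
  have ub: "dzb (\<lambda>y. complex_of_real (u y)) x = cnj (?uz x)" for x
    using dz_cnj(2)[of "\<lambda>y. complex_of_real (u y)" x] by (simp add: has_partials h)
  have \<gamma>b: "dzb \<gamma> x = cnj (dz \<beta> x)" for x unfolding \<gamma>_eq by (simp add: dz_cnj h)
  have \<beta>b: "dzb \<beta> x = cnj (dz \<gamma> x)" for x unfolding \<gamma>_eq by (simp add: dz_cnj h)
  have d_half: "d1 f x = 1 / 2 * (dz f x + dzb f x)" "d2 f x = \<i> / 2 * (dz f x - dzb f x)" for f x
    by (simp_all add: d1_eq_dz d2_eq_dz)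
  have D: "dt X1 x = (1 / 2 * (cnj (dt p x) - dt p x), - 1 / 2 * (dt q x + cnj (dt r x)), - 1 / 2 * (dt r x + cnj (dt q x)))"
    "dt X2 x = (- \<i> / 2 * (cnj (dt p x) + dt p x), - \<i> / 2 * (dt q x - cnj (dt r x)), - \<i> / 2 * (dt r x - cnj (dt q x)))"
    "d1 T x = (\<i> * (1 / 2 * (?uz x + cnj (?uz x))), - \<i> * (1 / 2 * (dz \<beta> x + cnj (dz \<gamma> x))), \<i> * (1 / 2 * (dz \<gamma> x + cnj (dz \<beta> x))))"
    "d2 T x = (\<i> * (\<i> / 2 * (?uz x - cnj (?uz x))), - \<i> * (\<i> / 2 * (dz \<beta> x - cnj (dz \<gamma> x))), \<i> * (\<i> / 2 * (dz \<gamma> x - cnj (dz \<beta> x))))" for x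
  proof -
    show "dt X1 x = (1 / 2 * (cnj (dt p x) - dt p x), - 1 / 2 * (dt q x + cnj (dt r x)), - 1 / 2 * (dt r x + cnj (dt q x)))"
      "dt X2 x = (- \<i> / 2 * (cnj (dt p x) + dt p x), - \<i> / 2 * (dt q x - cnj (dt r x)), - \<i> / 2 * (dt r x - cnj (dt q x)))"
      unfolding X1_def X2_def by (simp_all add: has_partials_Pair has_partials_divide has_partials h)
    have "d1 T x = (\<i> * d1 (\<lambda>y. of_real (u y)) x, - \<i> * d1 \<beta> x, \<i> * d1 \<gamma> x)"
      "d2 T x = (\<i> * d2 (\<lambda>y. of_real (u y)) x, - \<i> * d2 \<beta> x, \<i> * d2 \<gamma> x)"
      unfolding T_def by (simp_all add: has_partials_Pair has_partials_divide has_partials h)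
    then show "d1 T x = (\<i> * (1 / 2 * (?uz x + cnj (?uz x))), - \<i> * (1 / 2 * (dz \<beta> x + cnj (dz \<gamma> x))), \<i> * (1 / 2 * (dz \<gamma> x + cnj (dz \<beta> x))))"
      "d2 T x = (\<i> * (\<i> / 2 * (?uz x - cnj (?uz x))), - \<i> * (\<i> / 2 * (dz \<beta> x - cnj (dz \<gamma> x))), \<i> * (\<i> / 2 * (dz \<gamma> x - cnj (dz \<beta> x))))"
      by (simp_all only: d_half ub \<beta>b \<gamma>b)
  qed
  have D12: "d2 X1 x = (1 / 2 * (cnj (d2 p x) - d2 p x), - 1 / 2 * (d2 q x + cnj (d2 r x)), - 1 / 2 * (d2 r x + cnj (d2 q x)))"
    "d1 X2 x = (- \<i> / 2 * (cnj (d1 p x) + d1 p x), - \<i> / 2 * (d1 q x - cnj (d1 r x)), - \<i> / 2 * (d1 r x - cnj (d1 q x)))" for x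
    unfolding X1_def X2_def by (simp_all add: has_partials_Pair has_partials_divide has_partials h)
  have cnj\<gamma>: "cnj (\<gamma> x) = \<beta> x" for x by (simp add: flat(1))
  have pz: "cnj (dzb p x) = r x * cnj (r x) - q x * cnj (q x) - dzb p x" for x
    using flat(2)[of x] by (simp add: algebra_simps)
  obtain V where V: "continuous_on UNIV V" "V (0, 0, 0) = (1, 0)" "has_dt V" "has_d1 V" "has_d2 V"
    "dt V = (\<lambda>x. row_act (V x) (T x))" "d1 V = (\<lambda>x. row_act (V x) (X1 x))" "d2 V = (\<lambda>x. row_act (V x) (X2 x))"
  proof (rule total_linear_system_exists[OF bounded_bilinear_row_act Ck_continuous[OF cX(1)]
      Ck_continuous[OF cX(2)] Ck_continuous[OF cX(3)] hX(7,8,3,6,4,2) cdX])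
    fix v :: "complex \<times> complex" and x
    obtain a b where v: "v = (a, b)" by fastforce
    show "row_act (row_act v (X1 x)) (T x) + row_act v (d1 T x) = row_act (row_act v (T x)) (X1 x) + row_act v (dt X1 x)"
      unfolding D flat(4,5,6) unfolding v X1_def T_def
      by (simp add: row_act_def cnj\<gamma> flat(1)[symmetric] field_simps)
    show "row_act (row_act v (X2 x)) (T x) + row_act v (d2 T x) = row_act (row_act v (T x)) (X2 x) + row_act v (dt X2 x)"
      unfolding D flat(4,5,6) unfolding v X2_def T_def
      by (simp add: row_act_def cnj\<gamma> flat(1)[symmetric] field_simps)
    show "row_act (row_act v (X2 x)) (X1 x) + row_act v (d2 X1 x) = row_act (row_act v (X1 x)) (X2 x) + row_act v (d1 X2 x)"
      unfolding D12 d_half flat(3) unfolding v X1_def X2_def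
      by (simp add: row_act_def pz field_simps)
  qed (rule that)
  define a where "a = (\<lambda>x. fst (V x))"
  define b where "b = (\<lambda>x. snd (V x))"
  have V_eq: "V x = (a x, b x)" for x by (simp add: a_def b_def)
  have hab: "has_dt a" "has_d1 a" "has_d2 a" "has_dt b" "has_d1 b" "has_d2 b"
    "dt a = (\<lambda>x. fst (dt V x))" "d1 a = (\<lambda>x. fst (d1 V x))" "d2 a = (\<lambda>x. fst (d2 V x))"
    "dt b = (\<lambda>x. snd (dt V x))" "d1 b = (\<lambda>x. snd (d1 V x))" "d2 b = (\<lambda>x. snd (d2 V x))"
    unfolding a_def b_def
    by (simp_all add: has_dt_linear[OF bounded_linear_fst] has_dt_linear[OF bounded_linear_snd]
        has_d1_linear[OF bounded_linear_fst] has_d1_linear[OF bounded_linear_snd]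
        has_d2_linear[OF bounded_linear_fst] has_d2_linear[OF bounded_linear_snd] V(3-5))
  have sf: "space_frame a b p q r"
    unfolding space_frame_def dz_def dzb_def hab V(6-8) V_eq X1_def X2_def
    by (intro allI) (simp add: row_act_def field_simps)
  have tf: "time_frame a b \<beta> \<gamma> u"
    unfolding time_frame_def hab V(6-8) V_eq T_def
    by (intro allI) (simp add: row_act_def algebra_simps)
  have init: "a (0, 0, 0) = 1" "b (0, 0, 0) = 0" using V(2) by (simp_all add: a_def b_def)
  \<comment> \<open>The frame is paired with itself; its initial values give 1.\<close>
  have "unimodular a b"
    unfolding unimodular_def
    using frame_pairing_constant(1)[OF hab(2,3,1,5,6,4,2,3,1,5,6,4) sf sf tf tf flat(1)] init by simp
  then show thesis
    using V(1) init hab(1-6) sf tf by (intro that) (auto simp: a_def b_def intro: continuous_on_fst continuous_on_snd)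
qed

section \<open>From the Schroedinger system to Schroedinger maps\<close>

abbreviation off_diag_q :: "(pt \<Rightarrow> complex) \<Rightarrow> (pt \<Rightarrow> complex) \<Rightarrow> pt \<Rightarrow> complex" where
  "off_diag_q p q \<equiv> \<lambda>x. dzb q x + 2 * cnj (p x) * q x"

abbreviation off_diag_r :: "(pt \<Rightarrow> complex) \<Rightarrow> (pt \<Rightarrow> complex) \<Rightarrow> pt \<Rightarrow> complex" where
  "off_diag_r p r \<equiv> \<lambda>x. dzb r x - 2 * cnj (p x) * r x"

definition frame_of ::
  "(pt \<Rightarrow> complex) \<Rightarrow> (pt \<Rightarrow> complex) \<Rightarrow> (pt \<Rightarrow> complex) \<Rightarrow> (pt \<Rightarrow> complex) \<Rightarrow> (pt \<Rightarrow> complex)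
     \<Rightarrow> (pt \<Rightarrow> real) \<Rightarrow> bool"
where
  "frame_of a b p q r u \<longleftrightarrow> unimodular a b \<and> space_frame a b p q r \<and>
     time_frame a b (off_diag_q p q) (off_diag_r p r) u"

lemma NLS_off_diag:
  assumes "Ck 2 1 r" "NLS p q r u"
  shows "off_diag_r p r x = cnj (off_diag_q p q x)"
proof -
  have "- dz (\<lambda>y. cnj (r y)) x + dzb q x = - 2 * (p x * cnj (r x) + cnj (p x) * q x)"
    using assms(2) unfolding NLS_def by blast
  then have "- cnj (dzb r x) + dzb q x = - 2 * (p x * cnj (r x) + cnj (p x) * q x)"
    using Ck_has_partials[OF assms(1)] by (simp add: dz_cnj)
  from arg_cong[OF this, of cnj] show ?thesis by (simp add: algebra_simps)
qed

text \<open>Initially the frame is only continuous with partial derivatives. Its equations express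
  these by \<open>a\<close>, \<open>b\<close> and coefficients of class \<open>m\<close> in space,
  but \<open>m - 1\<close> in time, where \<open>dzb q\<close>, \<open>dzb r\<close> and
  \<open>u\<close> enter. So space derivatives reach class \<open>m\<close>, and class
  \<open>m - 1\<close> for \<open>dt\<close> is just what order \<open>m + 1\<close> demands when
  time counts twice.\<close>

lemma frame_of_regularity:
  assumes w: "w = 1 \<or> w = 2" and m: "2 \<le> m"
    and c: "Ck w m p" "Ck w m q" "Ck w m r" "Ck w (m + 1 - w) u"
    and ab: "continuous_on UNIV a" "continuous_on UNIV b"
      "has_dt a" "has_d1 a" "has_d2 a" "has_dt b" "has_d1 b" "has_d2 b"
    and f: "frame_of a b p q r u"
  shows "Ck w m a" "Ck w m (d1 a)" "Ck w m (d2 a)" "Ck 2 (m + 1) a"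
    "Ck w m b" "Ck w m (d1 b)" "Ck w m (d2 b)" "Ck 2 (m + 1) b"
proof -
  have w0: "0 < w" using w by auto
  note S = space_frameD[of a b p q r] and T = time_frameD[of a b]
  have sf: "space_frame a b p q r" and tf: "time_frame a b (off_diag_q p q) (off_diag_r p r) u"
    using f by (auto simp: frame_of_def)
  have D: "d1 a = (\<lambda>x. 1 / 2 * (- (a x * p x + b x * r x) + (a x * cnj (p x) - b x * cnj (q x))))"
    "d2 a = (\<lambda>x. \<i> / 2 * (- (a x * p x + b x * r x) - (a x * cnj (p x) - b x * cnj (q x))))"
    "d1 b = (\<lambda>x. 1 / 2 * (- (a x * q x - b x * p x) + (- (a x * cnj (r x)) - b x * cnj (p x))))"
    "d2 b = (\<lambda>x. \<i> / 2 * (- (a x * q x - b x * p x) - (- (a x * cnj (r x)) - b x * cnj (p x))))"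
    by (rule ext, simp add: d1_eq_dz d2_eq_dz S[OF sf])+
  note T' = T[OF tf]
  note Ck_closed = Ck_mult Ck_add Ck_diff Ck_minus Ck_cnj Ck_const Ck_of_real Ck_dz(2)[OF w0]
  have pqr: "Ck w j p" "Ck w j q" "Ck w j r" if "j \<le> m" for j
    using Ck_mono c w0 that by blast+
  have du: "Ck w j (dzb q)" "Ck w j (dzb r)" "Ck w j u" if "j \<le> m - 1" for j
  proof -
    show "Ck w j (dzb q)" "Ck w j (dzb r)" using Ck_dz(2)[OF w0] c that m by simp_all
    show "Ck w j u" by (rule Ck_mono[OF c(4) w0]) (use that w m in auto)
  qed
  have space: "Ck w j (d1 a)" "Ck w j (d2 a)" "Ck w j (d1 b)" "Ck w j (d2 b)"
    if "j \<le> m" "Ck w j a" "Ck w j b" for j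
    unfolding D by (intro Ck_closed w0 pqr that)+
  have time: "Ck w j (dt a)" "Ck w j (dt b)" if "j \<le> m - 1" "Ck w j a" "Ck w j b" for j
    unfolding T' by (intro Ck_closed w0 pqr du that; use that in simp)+
  \<comment> \<open>Class \<open>j\<close> follows from class \<open>j - 1\<close>, which passes to
    the space derivatives, and class \<open>j - w\<close>, which passes to \<open>dt\<close>; the
    latter respects the bound \<open>m - 1\<close> because \<open>w\<close> is positive.\<close>
  have "Ck w j a \<and> Ck w j b" if "j \<le> m" for j
    using that
  proof (induction j rule: less_induct)
    case (less j)
    show ?case
      using less space[of "j - 1"] time[of "j - w"] ab w0
      by (auto simp: Ck_iff[of w j a] Ck_iff[of w j b])
  qed
  then show m': "Ck w m a" "Ck w m b" by auto
  show s: "Ck w m (d1 a)" "Ck w m (d2 a)" "Ck w m (d1 b)" "Ck w m (d2 b)"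
    using space[OF _ m'] by auto
  have t: "Ck w (m - 1) (dt a)" "Ck w (m - 1) (dt b)"
    using time[of "m - 1"] Ck_mono[OF m'(1) w0, of "m - 1"] Ck_mono[OF m'(2) w0, of "m - 1"] by auto
  have eq: "Suc m - 2 = m - 1" by simp
  show "Ck 2 (m + 1) a" "Ck 2 (m + 1) b"
    using s[THEN Ck_weight_2[OF w]] t[THEN Ck_weight_2[OF w]] ab m
    by (auto simp: Ck_iff[of 2 "Suc m" a] Ck_iff[of 2 "Suc m" b] eq)
qed

lemma mat2_partials:
  assumes "has_d1 a" "has_d1 b" "has_d1 c" "has_d1 d" "has_d2 a" "has_d2 b" "has_d2 c" "has_d2 d"
  shows "d1 (\<lambda>x. mat2 (a x) (b x) (c x) (d x)) = (\<lambda>x. mat2 (d1 a x) (d1 b x) (d1 c x) (d1 d x))"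
    "d2 (\<lambda>x. mat2 (a x) (b x) (c x) (d x)) = (\<lambda>x. mat2 (d2 a x) (d2 b x) (d2 c x) (d2 d x))"
  by (subst (1 2) mat2_decompose, simp add: has_d1_add has_d2_add assms
      has_d1_linear[OF bounded_linear_mat2(1)] has_d1_linear[OF bounded_linear_mat2(2)]
      has_d1_linear[OF bounded_linear_mat2(3)] has_d1_linear[OF bounded_linear_mat2(4)]
      has_d2_linear[OF bounded_linear_mat2(1)] has_d2_linear[OF bounded_linear_mat2(2)]
      has_d2_linear[OF bounded_linear_mat2(3)] has_d2_linear[OF bounded_linear_mat2(4)])+

lemma spin_is_SM_solution:
  assumes w: "w = 1 \<or> w = 2" and m: "2 \<le> m"
    and c: "Ck w m p" "Ck w m q" "Ck w m r"
    and ab: "Ck w m a" "Ck w m (d1 a)" "Ck w m (d2 a)" "Ck 2 (m + 1) a"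
      "Ck w m b" "Ck w m (d1 b)" "Ck w m (d2 b)" "Ck 2 (m + 1) b"
    and f: "frame_of a b p q r u" and off: "\<And>x. off_diag_r p r x = cnj (off_diag_q p q x)"
  shows "SM_solution_space w (m + 1) (spin a b)"
proof -
  have w0: "0 < w" using w by auto
  have ab2: "Ck 2 2 a" "Ck 2 2 b" using ab(4,8)[THEN Ck_mono] m by simp_all
  have c2: "Ck 2 1 p" "Ck 2 1 q" "Ck 2 1 r"
    using c[THEN Ck_weight_2[OF w], THEN Ck_mono] m by simp_all
  have h: "has_d1 a" "has_d2 a" "has_d1 b" "has_d2 b"
    using ab2[THEN Ck_has_partials(1)] ab2[THEN Ck_has_partials(2)] by simp_all
  have uni: "unimodular a b" and sf: "space_frame a b p q r"
    and tf: "time_frame a b (off_diag_q p q) (off_diag_r p r) u"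
    using f by (auto simp: frame_of_def)
  have "SM (spin a b)"
    unfolding SM_def
  proof (intro allI conjI)
    fix x
    show "spin a b x \<in> hyperbolic_plane" by (rule spin_hyperbolic[OF uni])
    show "dt (spin a b) x = cscale (- 1 / 2) (commutator (spin a b x) (mdzb (mdz (spin a b)) x))"
      using dt_spin[OF ab2 tf off, of x]
        commutator_spin[OF ab2 c2 uni sf, of "off_diag_q p q" x "off_diag_r p r", OF refl refl]
      by (rule trans[OF _ sym])
  qed
  moreover have "Ck w m (d1 (spin a b))" "Ck w m (d2 (spin a b))"
    unfolding spin_def[abs_def]
    by (simp_all add: mat2_partials has_partials h)
      (intro Ck_mat2 Ck_minus Ck_mult Ck_add Ck_cnj Ck_const w0 ab)+
  ultimately show ?thesis
    unfolding SM_solution_space_def SM_solution_def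
    using Ck_spin[OF w0 ab(1,5)] Ck_spin[OF _ ab(4,8)] by simp
qed

lemma NLS_solution_frame:
  assumes w: "w = 1 \<or> w = 2" and m: "2 \<le> m" and nls: "NLS_solution w m p q r u"
  obtains a b where "Ck w m a" "Ck w m b" "a (0, 0, 0) = 1" "b (0, 0, 0) = 0"
    "frame_of a b p q r u" "SM_solution_space w (m + 1) (spin a b)"
proof -
  have w0: "0 < w" using w by auto
  have c: "Ck w m p" "Ck w m q" "Ck w m r" "Ck w (m + 1 - w) u" and n: "NLS p q r u"
    using nls by (auto simp: NLS_solution_def)
  have c2: "Ck 2 2 p" "Ck 2 2 q" "Ck 2 2 r"
    using c(1-3)[THEN Ck_weight_2[OF w], THEN Ck_mono] m by simp_all
  have cu: "Ck 2 1 u"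
    by (rule Ck_mono[OF Ck_weight_2[OF w c(4)]]) (use w m in auto)
  obtain a b where ab: "continuous_on UNIV a" "continuous_on UNIV b"
    "has_dt a" "has_d1 a" "has_d2 a" "has_dt b" "has_d1 b" "has_d2 b"
    and init: "a (0, 0, 0) = 1" "b (0, 0, 0) = 0"
    and fr: "space_frame a b p q r" "time_frame a b (off_diag_q p q) (off_diag_r p r) u" "unimodular a b"
    by (rule NLS_imp_frame[OF c2 cu n refl refl])
  have f: "frame_of a b p q r u" using fr by (simp add: frame_of_def)
  note reg = frame_of_regularity[OF w m c ab f]
  have "off_diag_r p r x = cnj (off_diag_q p q x)" for x
    by (rule NLS_off_diag[OF _ n]) (rule Ck_mono[OF c2(3)], auto)
  from spin_is_SM_solution[OF w m c(1-3) reg f this]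
  show thesis using that reg(1,5) init f by blast
qed

lemma gauge_transforms_iff_frame_of:
  assumes w: "w = 1 \<or> w = 2" and "2 \<le> m" "NLS_solution w m p q r u" and ab: "Ck w 2 a" "Ck w 2 b"
  shows "gauge_transforms (gauge_matrix a b) p q r u S \<longleftrightarrow> S = spin a b \<and> frame_of a b p q r u"
proof -
  have w': "0 < w" "w \<le> 2" using w by auto
  have "Ck w m r" "NLS p q r u" using assms by (auto simp: NLS_solution_def)
  then have "Ck 2 1 r" "NLS p q r u" using Ck_mono[OF Ck_weight_2[OF w], of m r 1] assms(2) by auto
  from gauge_transforms_iff[OF w' ab NLS_off_diag[OF this]] show ?thesis
    by (auto simp: frame_of_def)
qed

lemma SU11_valued_eq_gauge_matrix:
  assumes "0 < w" "Ck w k G" "\<And>x. G x \<in> SU11"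
  obtains a b where "Ck w k a" "Ck w k b" "G = gauge_matrix a b"
proof (rule that)
  show "Ck w k (\<lambda>x. G x $ 1 $ 1)" "Ck w k (\<lambda>x. G x $ 1 $ 2)"
    by (intro Ck_entry assms)+
  show "G = gauge_matrix (\<lambda>x. G x $ 1 $ 1) (\<lambda>x. G x $ 1 $ 2)"
  proof
    fix x
    obtain A B where "G x = mat2 A B (cnj B) (cnj A)" using assms(3)[of x] by (auto simp: SU11_def)
    then show "G x = gauge_matrix (\<lambda>x. G x $ 1 $ 1) (\<lambda>x. G x $ 1 $ 2) x" by (simp add: gauge_matrix_def)
  qed
qed

lemma gauge_matrix_eq_1_iff: "gauge_matrix a b x = mat 1 \<longleftrightarrow> a x = 1 \<and> b x = 0"
  by (auto simp: gauge_matrix_def mat2_arith mat2_eq_iff)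

text \<open>Reduction to rows: a map into SU(1,1) is the \<open>gauge_matrix\<close> of its first
  row, and \<open>G = I\<close> at the origin becomes \<open>a = 1\<close>,
  \<open>b = 0\<close>.\<close>

lemma corresponds_iff:
  assumes w: "w = 1 \<or> w = 2" and "2 \<le> m" "NLS_solution w m p q r u"
  shows "corresponds w p q r u S \<longleftrightarrow> (\<exists>a b. Ck w 2 a \<and> Ck w 2 b \<and>
    a (0, 0, 0) = 1 \<and> b (0, 0, 0) = 0 \<and> frame_of a b p q r u \<and> S = spin a b)"
proof
  have w0: "0 < w" using w by auto
  note iff = gauge_transforms_iff_frame_of[OF assms]
  {
    assume "corresponds w p q r u S"
    then obtain G where G: "Ck w 2 G" "G (0, 0, 0) = mat 1" "gauge_transforms G p q r u S"
      by (auto simp: corresponds_def)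
    then have "G x \<in> SU11" for x unfolding gauge_transforms_def by blast
    then obtain a b where ab: "Ck w 2 a" "Ck w 2 b" "G = gauge_matrix a b"
      using SU11_valued_eq_gauge_matrix[OF w0 G(1)] by blast
    then show "\<exists>a b. Ck w 2 a \<and> Ck w 2 b \<and> a (0, 0, 0) = 1 \<and> b (0, 0, 0) = 0 \<and>
        frame_of a b p q r u \<and> S = spin a b"
      using G iff[OF ab(1,2)] gauge_matrix_eq_1_iff by blast
  next
    assume "\<exists>a b. Ck w 2 a \<and> Ck w 2 b \<and> a (0, 0, 0) = 1 \<and> b (0, 0, 0) = 0 \<and>
        frame_of a b p q r u \<and> S = spin a b"
    then obtain a b where ab: "Ck w 2 a" "Ck w 2 b" "a (0, 0, 0) = 1 \<and> b (0, 0, 0) = 0"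
        "S = spin a b \<and> frame_of a b p q r u" by blast
    have "Ck w 2 (gauge_matrix a b)"
      unfolding gauge_matrix_def[abs_def] by (intro Ck_mat2 Ck_cnj w0 ab(1,2))
    then show "corresponds w p q r u S"
      unfolding corresponds_def using ab iff[OF ab(1,2)] gauge_matrix_eq_1_iff by blast
  }
qed

text \<open>Uniqueness of \<open>S\<close> is inherited from \<open>G\<close> through
  \<open>frame_unique\<close>: a competing gauge matrix of class \<open>Ck w 2\<close> has the same
  coefficients and initial value as the constructed frame, hence gives the same spin matrix.\<close>

theorem NLS_to_SM:
  assumes w: "w = 1 \<or> w = 2" and m: "2 \<le> m" and nls: "NLS_solution w m p q r u"
  shows "\<exists>!S. SM_solution_space w (m + 1) S \<and> corresponds w p q r u S"
proof -
  have w': "0 < w" "w \<le> 2" using w by auto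
  obtain a b where ab: "Ck w m a" "Ck w m b" "a (0, 0, 0) = 1" "b (0, 0, 0) = 0"
    "frame_of a b p q r u" "SM_solution_space w (m + 1) (spin a b)"
    by (rule NLS_solution_frame[OF assms])
  have ab2: "Ck w 2 a" "Ck w 2 b" using Ck_mono ab w' m by blast+
  note h = Ck_has_partials[OF ab2(1) w'(1)] Ck_has_partials[OF ab2(2) w'(1)]
  have "Ck 2 1 r" "NLS p q r u"
    using nls Ck_mono[OF Ck_weight_2[OF w], of m r 1] m by (auto simp: NLS_solution_def)
  note off = NLS_off_diag[OF this]
  show ?thesis
  proof (rule ex1I)
    show "SM_solution_space w (m + 1) (spin a b) \<and> corresponds w p q r u (spin a b)"
      unfolding corresponds_iff[OF assms] using ab ab2 by blast
    fix S assume "SM_solution_space w (m + 1) S \<and> corresponds w p q r u S"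
    then obtain a' b' where ab': "Ck w 2 a'" "Ck w 2 b'" "a' (0, 0, 0) = 1" "b' (0, 0, 0) = 0"
      "frame_of a' b' p q r u" "S = spin a' b'"
      unfolding corresponds_iff[OF assms] by blast
    note h' = Ck_has_partials[OF ab'(1) w'(1)] Ck_has_partials[OF ab'(2) w'(1)]
    have "a' = a" "b' = b"
      by (rule frame_unique[of a' b' a b p q r "off_diag_q p q" "off_diag_r p r" u];
        use h h' w' ab ab' off in \<open>simp add: frame_of_def\<close>)+
    then show "S = spin a b" using ab' by simp
  qed
qed

section \<open>From Schroedinger maps to the Schroedinger system\<close>

text \<open>The hyperbolic plane is the set of cosets \<open>SU(1,1)/U(1)\<close>; requiring \<open>a > 0\<close> picks a
  representative that depends smoothly on \<open>S\<close>.\<close>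

lemma hyperbolic_plane_lift:
  assumes w: "0 < w" and S: "Ck w k S" "\<And>x. S x \<in> hyperbolic_plane"
  obtains a b where "Ck w k a" "Ck w k b" "unimodular a b" "S = spin a b"
    "\<And>x. S x = cscale (- \<i>) sigma3 \<Longrightarrow> a x = 1 \<and> b x = 0"
proof -
  define s where "s = (\<lambda>x. Im (S x $ 1 $ 1))"
  define W where "W = (\<lambda>x. S x $ 1 $ 2)"
  have Sx: "S x = mat2 (\<i> * of_real (s x)) (W x) (cnj (W x)) (- \<i> * of_real (s x))"
    and WW: "W x * cnj (W x) = of_real ((s x)\<^sup>2 - 1)" and neg: "s x < 0" for x
  proof -
    obtain s1 s2 s3 where *: "S x = mat2 (\<i> * of_real s3) (of_real s1 + \<i> * of_real s2)
        (of_real s1 - \<i> * of_real s2) (- \<i> * of_real s3)" "s1\<^sup>2 + s2\<^sup>2 - s3\<^sup>2 = -1" "s3 < 0"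
      using S(2)[of x] unfolding hyperbolic_plane_def by blast
    have "s x = s3" "W x = Complex s1 s2" by (simp_all add: s_def W_def * complex_eq_iff)
    then show "S x = mat2 (\<i> * of_real (s x)) (W x) (cnj (W x)) (- \<i> * of_real (s x))" "s x < 0"
      unfolding * mat2_eq_iff using *(3) by (simp_all add: complex_eq_iff)
    have "s1\<^sup>2 + s2\<^sup>2 = s3\<^sup>2 - 1" using *(2) by simp
    then show "W x * cnj (W x) = of_real ((s x)\<^sup>2 - 1)"
      unfolding \<open>s x = s3\<close> \<open>W x = Complex s1 s2\<close> complex_mult_cnj by simp
  qed
  \<comment> \<open>Solving \<open>spin a b = S\<close> with \<open>a > 0\<close>: the diagonal
    gives \<open>(cmod a)^2 + (cmod b)^2 = - s\<close>, which with unimodularity yields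
    \<open>a^2 = (1 - s) / 2\<close>; the corner \<open>2 * \<i> * a * b = W\<close> then gives
    \<open>b\<close>. As \<open>s < 0\<close>, the radicand exceeds 1/2, so the root is
    smooth.\<close>
  define A where "A = (\<lambda>x. sqrt (1 / 2 * (1 - s x)))"
  have A2: "A x * A x = 1 / 2 * (1 - s x)" and A0: "A x > 0" for x
    using neg[of x] by (simp_all add: A_def)
  define a where "a = (\<lambda>x. complex_of_real (A x))"
  define b where "b = (\<lambda>x. W x * inverse (2 * \<i> * a x))"
  have a0: "a x \<noteq> 0" for x using A0[of x] by (simp add: a_def)
  have aa: "a x * cnj (a x) = of_real (1 / 2 * (1 - s x))" for x
    by (simp add: a_def A2 flip: of_real_mult)
  have bb: "b x * cnj (b x) = of_real (- 1 / 2 * (1 + s x))" for x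
  proof -
    have "b x * cnj (b x) = (W x * cnj (W x)) * inverse (4 * (a x * cnj (a x)))"
      by (simp add: b_def mult_ac)
    also have "\<dots> = of_real (((s x)\<^sup>2 - 1) * inverse (4 * (1 / 2 * (1 - s x))))"
      unfolding WW aa by (simp only: of_real_mult of_real_inverse of_real_numeral)
    also have "((s x)\<^sup>2 - 1) * inverse (4 * (1 / 2 * (1 - s x))) = - 1 / 2 * (1 + s x)"
      using neg[of x] by (simp add: field_simps power2_eq_square)
    finally show ?thesis .
  qed
  show thesis
  proof (rule that)
    have "Ck w k s" unfolding s_def by (intro Ck_Im Ck_entry w S)
    moreover have "0 < 1 / 2 * (1 - s x)" for x using neg[of x] by simp
    ultimately have "Ck w k A" unfolding A_def
      by (intro Ck_sqrt Ck_mult Ck_diff Ck_const w)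
    then show "Ck w k a" unfolding a_def by (intro Ck_of_real w)
    then show "Ck w k b" unfolding b_def W_def
      by (intro Ck_mult Ck_inverse Ck_const Ck_entry w S) (simp_all add: a0)
    show "unimodular a b"
      unfolding unimodular_def aa bb by (simp add: field_simps)
    show "S = spin a b"
    proof
      fix x
      have ab: "2 * \<i> * (a x * b x) = W x" using a0[of x] by (simp add: b_def field_simps)
      then have ab': "- 2 * \<i> * (cnj (a x) * cnj (b x)) = cnj (W x)"
        unfolding ab[symmetric] by simp
      show "S x = spin a b x"
        unfolding Sx spin_def mat2_eq_iff ab ab' aa bb by (simp add: field_simps)
    qed
    fix x assume "S x = cscale (- \<i>) sigma3"
    then have "s x = -1" "W x = 0" by (simp_all add: s_def W_def sigma3_def mat2_arith)
    then show "a x = 1 \<and> b x = 0" by (simp add: a_def A_def b_def)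
  qed
qed

lemma unimodular_derivatives:
  assumes "unimodular a b"
    and h: "has_d1 a" "has_d2 a" "has_dt a" "has_d1 b" "has_d2 b" "has_dt b"
  shows "dz a x * cnj (a x) + a x * cnj (dzb a x) - dz b x * cnj (b x) - b x * cnj (dzb b x) = 0"
    "dt a x * cnj (a x) + a x * cnj (dt a x) - dt b x * cnj (b x) - b x * cnj (dt b x) = 0"
proof -
  have const: "(\<lambda>x. a x * cnj (a x) - b x * cnj (b x)) = (\<lambda>x. 1)"
    using unimodularD[OF assms(1)] by blast
  have "dz (\<lambda>x. a x * cnj (a x) - b x * cnj (b x)) x = 0"
    "dt (\<lambda>x. a x * cnj (a x) - b x * cnj (b x)) x = 0"
    unfolding const by (simp_all add: dz_simps)
  then show "dz a x * cnj (a x) + a x * cnj (dzb a x) - dz b x * cnj (b x) - b x * cnj (dzb b x) = 0"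
    "dt a x * cnj (a x) + a x * cnj (dt a x) - dt b x * cnj (b x) - b x * cnj (dt b x) = 0"
    by (simp_all add: dz_simps h algebra_simps)
qed

text \<open>The coefficients are entries of \<open>- G^-1 G_z\<close>, with
  \<open>dz (cnj b)\<close> written as \<open>cnj (dzb b)\<close> and likewise for \<open>a\<close>.
  Every differentiable unimodular pair is thus a space frame; the map equation constrains only the
  time component.\<close>

lemma unimodular_space_frame:
  assumes uni: "unimodular a b"
    and h: "has_d1 a" "has_d2 a" "has_dt a" "has_d1 b" "has_d2 b" "has_dt b"
  shows "space_frame a b (\<lambda>x. - (cnj (a x) * dz a x - b x * cnj (dzb b x)))
    (\<lambda>x. - (cnj (a x) * dz b x - b x * cnj (dzb a x)))
    (\<lambda>x. cnj (b x) * dz a x - a x * cnj (dzb b x))"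
  unfolding space_frame_def
proof
  fix x
  \<comment> \<open>Conjugates are again independent variables; the two premises are unimodularity
    and its derivative.\<close>
  have alg: "A * A' - B * B' = 1 \<Longrightarrow> Az * A' + A * A'z - Bz * B' - B * B'z = 0 \<Longrightarrow>
      Az = - (A * (- (A' * Az - B * B'z)) + B * (B' * Az - A * B'z)) \<and>
      Bz = - (A * (- (A' * Bz - B * A'z)) - B * (- (A' * Az - B * B'z)))"
    for A A' B B' Az Bz A'z B'z :: complex
  proof
    assume u: "A * A' - B * B' = 1" and d: "Az * A' + A * A'z - Bz * B' - B * B'z = 0"
    show "Az = - (A * (- (A' * Az - B * B'z)) + B * (B' * Az - A * B'z))"
      using arg_cong[OF u, of "\<lambda>z. z * Az"] by (simp add: algebra_simps)
    have p: "A' * Az - B * B'z = B' * Bz - A * A'z" using d by (simp add: algebra_simps)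
    show "Bz = - (A * (- (A' * Bz - B * A'z)) - B * (- (A' * Az - B * B'z)))"
      unfolding p using arg_cong[OF u, of "\<lambda>z. z * Bz"] by (simp add: algebra_simps)
  qed
  have u: "a x * cnj (a x) - b x * cnj (b x) = 1" by (rule unimodularD[OF uni])
  have d: "dz a x * cnj (a x) + a x * cnj (dzb a x) - dz b x * cnj (b x) - b x * cnj (dzb b x) = 0"
    by (rule unimodular_derivatives(1)[OF uni h])
  \<comment> \<open>The derivative of unimodularity says that \<open>G^-1 G_z\<close> is trace free.
    This second form of the diagonal entry is the one needed for \<open>dz b\<close> and
    \<open>dzb a\<close>.\<close>
  have p: "cnj (a x) * dz a x - b x * cnj (dzb b x) = cnj (b x) * dz b x - a x * cnj (dzb a x)"
    using d by (simp add: algebra_simps)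
  have "dzb a x = (a x * cnj (a x) - b x * cnj (b x)) * dzb a x"
    "dzb b x = (a x * cnj (a x) - b x * cnj (b x)) * dzb b x" by (simp_all add: u)
  then have "dzb a x = a x * cnj (- (cnj (b x) * dz b x - a x * cnj (dzb a x)))
        - b x * cnj (- (cnj (a x) * dz b x - b x * cnj (dzb a x)))"
    "dzb b x = - (a x * cnj (cnj (b x) * dz a x - a x * cnj (dzb b x)))
        - b x * cnj (- (cnj (a x) * dz a x - b x * cnj (dzb b x)))"
    by (simp_all add: algebra_simps)
  then show "dz a x = - (a x * - (cnj (a x) * dz a x - b x * cnj (dzb b x)) +
            b x * (cnj (b x) * dz a x - a x * cnj (dzb b x))) \<and>
        dz b x = - (a x * - (cnj (a x) * dz b x - b x * cnj (dzb a x)) -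
            b x * - (cnj (a x) * dz a x - b x * cnj (dzb b x))) \<and>
        dzb a x = a x * cnj (- (cnj (a x) * dz a x - b x * cnj (dzb b x)))
          - b x * cnj (- (cnj (a x) * dz b x - b x * cnj (dzb a x))) \<and>
        dzb b x = - (a x * cnj (cnj (b x) * dz a x - a x * cnj (dzb b x)))
          - b x * cnj (- (cnj (a x) * dz a x - b x * cnj (dzb b x)))"
    using alg[OF u d] unfolding p by blast
qed

text \<open>Entries of \<open>G^-1 G_t\<close>: the upper left one is \<open>\<i> * u\<close>, the
  upper right one is \<open>- \<i> * \<beta>\<close>.\<close>

lemma unimodular_time_frame:
  assumes uni: "unimodular a b"
    and h: "has_d1 a" "has_d2 a" "has_dt a" "has_d1 b" "has_d2 b" "has_dt b"
  shows "time_frame a b (\<lambda>x. \<i> * (cnj (a x) * dt b x - b x * cnj (dt a x)))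
    (\<lambda>x. cnj (\<i> * (cnj (a x) * dt b x - b x * cnj (dt a x))))
    (\<lambda>x. Im (cnj (a x) * dt a x - b x * cnj (dt b x)))"
  unfolding time_frame_def
proof
  fix x
  have u: "a x * cnj (a x) - b x * cnj (b x) = 1" by (rule unimodularD[OF uni])
  have d: "dt a x * cnj (a x) + a x * cnj (dt a x) - dt b x * cnj (b x) - b x * cnj (dt b x) = 0"
    by (rule unimodular_derivatives(2)[OF uni h])
  define z where "z = cnj (a x) * dt a x - b x * cnj (dt b x)"
  have z': "z = - (a x * cnj (dt a x) - cnj (b x) * dt b x)"
    using d by (simp add: z_def algebra_simps eq_neg_iff_add_eq_0)
  \<comment> \<open>Unimodularity makes the diagonal entry purely imaginary, so \<open>u\<close>
    determines it.\<close>
  have "cnj z = - z" by (subst (2) z') (simp add: z_def algebra_simps)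
  then have iu: "\<i> * of_real (Im z) = z" by (auto simp: complex_eq_iff)
  have "dt a x = (a x * cnj (a x) - b x * cnj (b x)) * dt a x"
    "dt b x = (a x * cnj (a x) - b x * cnj (b x)) * dt b x" by (simp_all add: u)
  then have dts: "dt a x = a x * z + b x * (a x * cnj (dt b x) - cnj (b x) * dt a x)"
    "dt b x = a x * (cnj (a x) * dt b x - b x * cnj (dt a x)) - b x * z"
    by (simp add: z_def algebra_simps, subst z', simp add: algebra_simps)
  have e: "\<i> * (A * of_real (Im z) + B * cnj (\<i> * y)) = A * z + B * cnj y"
    "- \<i> * (A * (\<i> * y) + B * of_real (Im z)) = A * y - B * z" for A B y
    by (subst (2) iu[symmetric], simp add: algebra_simps)+
  show "dt a x = \<i> * (a x * of_real (Im (cnj (a x) * dt a x - b x * cnj (dt b x))) +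
        b x * cnj (\<i> * (cnj (a x) * dt b x - b x * cnj (dt a x)))) \<and>
      dt b x = - \<i> * (a x * (\<i> * (cnj (a x) * dt b x - b x * cnj (dt a x))) +
        b x * of_real (Im (cnj (a x) * dt a x - b x * cnj (dt b x))))"
    unfolding z_def[symmetric] e using dts by simp
qed

text \<open>The explicit lift supplies a frame with an abstract \<open>\<beta>\<close>, and
  \<open>SM\<close> identifies \<open>\<beta>\<close> with \<open>off_diag_q p q\<close>. Against
  \<open>S\<close>, the functions \<open>p\<close>, \<open>q\<close>, \<open>r\<close> lose one
  space derivative and \<open>u\<close> loses one time derivative, whence the class
  \<open>m + 1 - w\<close>.\<close>

lemma SM_solution_frame:
  assumes w: "w = 1 \<or> w = 2" and m: "2 \<le> m" and S: "SM_solution w (m + 1) S"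
    and S0: "S (0, 0, 0) = cscale (- \<i>) sigma3"
  obtains a b p q r u where "Ck w (m + 1) a" "Ck w (m + 1) b" "a (0, 0, 0) = 1" "b (0, 0, 0) = 0"
    "frame_of a b p q r u" "S = spin a b" "NLS_solution w m p q r u"
proof -
  have w0: "0 < w" "w \<le> m + 1" "w \<le> 2" using w m by auto
  have "SM S" "Ck w (m + 1) S" using S by (auto simp: SM_solution_def)
  then have hyp: "S x \<in> hyperbolic_plane"
    and sm: "dt S x = cscale (- 1 / 2) (commutator (S x) (mdzb (mdz S) x))" for x
    unfolding SM_def by blast+
  obtain a b where ab: "Ck w (m + 1) a" "Ck w (m + 1) b" and uni: "unimodular a b" and Sab: "S = spin a b"
    and "\<And>x. S x = cscale (- \<i>) sigma3 \<Longrightarrow> a x = 1 \<and> b x = 0"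
    using hyperbolic_plane_lift[OF w0(1) \<open>Ck w (m + 1) S\<close> hyp] by blast
  then have init: "a (0, 0, 0) = 1" "b (0, 0, 0) = 0" using S0 by blast+
  have h: "has_d1 a" "has_d2 a" "has_dt a" "has_d1 b" "has_d2 b" "has_dt b"
    using Ck_has_partials[OF ab(1) w0(1)] Ck_has_partials[OF ab(2) w0(1)] w0 by simp_all
  define p where "p = (\<lambda>x. - (cnj (a x) * dz a x - b x * cnj (dzb b x)))"
  define q where "q = (\<lambda>x. - (cnj (a x) * dz b x - b x * cnj (dzb a x)))"
  define r where "r = (\<lambda>x. cnj (b x) * dz a x - a x * cnj (dzb b x))"
  define u where "u = (\<lambda>x. Im (cnj (a x) * dt a x - b x * cnj (dt b x)))"
  define \<beta> where "\<beta> = (\<lambda>x. \<i> * (cnj (a x) * dt b x - b x * cnj (dt a x)))"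
  have sf: "space_frame a b p q r" unfolding p_def q_def r_def by (rule unimodular_space_frame[OF uni h])
  have tf: "time_frame a b \<beta> (\<lambda>x. cnj (\<beta> x)) u" unfolding \<beta>_def u_def by (rule unimodular_time_frame[OF uni h])
  note closed = Ck_mult Ck_diff Ck_minus Ck_cnj Ck_const
  have abm: "Ck w m a" "Ck w m b" using ab[THEN Ck_mono] w0 by simp_all
  have c: "Ck w m p" "Ck w m q" "Ck w m r"
    unfolding p_def q_def r_def by (intro closed w0 abm Ck_dz[OF w0(1) ab(1)] Ck_dz[OF w0(1) ab(2)]; simp)+
  have cu: "Ck w (m + 1 - w) u"
    unfolding u_def by (intro Ck_Im closed w0 Ck_dt[OF w0(1) ab(1)] Ck_dt[OF w0(1) ab(2)] ab[THEN Ck_mono];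
        use w0 in simp)
  have ab3: "Ck 2 3 a" "Ck 2 3 b"
    using ab[THEN Ck_weight_2[OF w], THEN Ck_mono] m by simp_all
  then have ab2: "Ck 2 2 a" "Ck 2 2 b" by (auto intro: Ck_mono)
  have c2: "Ck 2 2 p" "Ck 2 2 q" "Ck 2 2 r"
    using c[THEN Ck_weight_2[OF w], THEN Ck_mono] m by simp_all
  then have c1: "Ck 2 1 p" "Ck 2 1 q" "Ck 2 1 r" by (auto intro: Ck_mono)
  have cu1: "Ck 2 1 u" by (rule Ck_mono[OF Ck_weight_2[OF w cu]]) (use w m in auto)
  have off: "off_diag_r p r x = cnj (off_diag_q p q x)" for x
    using arg_cong[OF space_frame_compatible(2)[OF ab2 c1 uni sf, of x], of cnj] by (simp add: algebra_simps)
  \<comment> \<open>\<open>SM\<close> equates two matrices \<open>G X G^-1\<close>, one built from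
    \<open>\<beta> x\<close> and one from \<open>B\<close>. Conjugation by \<open>G\<close> is
    injective: explicitly, two entries and unimodularity give
    \<open>a x * (\<beta> x - B) = 0\<close>.\<close>
  have "\<beta> x = off_diag_q p q x" for x
  proof -
    have two: "(2 :: complex) \<noteq> 0" by simp
    define B where "B = off_diag_q p q x"
    have u: "a x * cnj (a x) - b x * cnj (b x) = 1" by (rule unimodularD[OF uni])
    have "dt (spin a b) x = cscale (- 1 / 2) (commutator (spin a b x) (mdzb (mdz (spin a b)) x))"
      using sm Sab by simp
    from this[unfolded dt_spin[OF ab2 tf refl]
        commutator_spin[OF ab2 c1 uni sf, of "off_diag_q p q" x "off_diag_r p r", OF refl refl] off,
        folded B_def, unfolded mat2_eq_iff mult_left_cancel[OF two]]
    have "cnj (a x) * b x * cnj (\<beta> x) - a x * cnj (b x) * \<beta> x = cnj (a x) * b x * cnj B - a x * cnj (b x) * B"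
      "(a x)\<^sup>2 * \<beta> x - (b x)\<^sup>2 * cnj (\<beta> x) = (a x)\<^sup>2 * B - (b x)\<^sup>2 * cnj B"
      by blast+
    then have 1: "cnj (a x) * b x * cnj (\<beta> x - B) = a x * cnj (b x) * (\<beta> x - B)"
      and 2: "(a x)\<^sup>2 * (\<beta> x - B) = (b x)\<^sup>2 * cnj (\<beta> x - B)"
      by (simp_all add: algebra_simps)
    have "a x * (\<beta> x - B) = (a x * cnj (a x) - b x * cnj (b x)) * (a x * (\<beta> x - B))" by (simp add: u)
    also have "\<dots> = cnj (a x) * ((a x)\<^sup>2 * (\<beta> x - B)) - b x * (a x * cnj (b x) * (\<beta> x - B))"
      by (simp add: power2_eq_square algebra_simps)
    also have "\<dots> = 0" by (simp only: 2 1[symmetric]) (simp add: power2_eq_square algebra_simps)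
    finally show ?thesis using unimodular_nonzero[OF uni, of x] by (simp add: B_def)
  qed
  then have \<beta>: "\<beta> = off_diag_q p q" by blast
  have "NLS p q r u" by (rule frame_imp_NLS[OF ab3 c2 cu1 uni sf tf[unfolded \<beta>]])
  then have "NLS_solution w m p q r u" using c cu by (simp add: NLS_solution_def)
  moreover have "frame_of a b p q r u"
    unfolding frame_of_def using uni sf tf[unfolded \<beta>] by (simp add: off)
  ultimately show thesis using that ab init Sab by blast
qed

section \<open>The phase ambiguity\<close>

text \<open>\<open>cnj (g s) * g y\<close> has argument \<open>\<theta> y - \<theta> s\<close>,
  which continuity keeps below \<open>pi / 2\<close> in modulus near \<open>s\<close>. There
  \<open>\<theta> y\<close> is \<open>\<theta> s\<close> plus the arcsine of the imaginary part, and
  arcsine has derivative 1 at 0.\<close>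

lemma phase_has_vector_derivative:
  assumes g: "(g has_vector_derivative g') (at s)" and \<theta>: "isCont \<theta> s"
    and eq: "\<And>y. g y = cis (\<theta> y)"
  shows "(\<theta> has_vector_derivative Im (cnj (g s) * g')) (at s)"
proof -
  let ?h = "\<lambda>y. Im (cnj (g s) * g y)"
  have h: "?h y = sin (\<theta> y - \<theta> s)" for y by (simp add: eq sin_diff algebra_simps)
  have "bounded_linear (\<lambda>z. Im (cnj (g s) * z))"
    by (intro bounded_linear_compose[OF bounded_linear_Im] bounded_linear_mult_right)
  from bounded_linear.has_vector_derivative[OF this g]
  have "(?h has_vector_derivative Im (cnj (g s) * g')) (at s)" .
  moreover have "(arcsin has_real_derivative 1) (at (?h s))"
    using DERIV_arcsin[of 0] by (simp add: h)
  ultimately have "((arcsin \<circ> ?h) has_vector_derivative Im (cnj (g s) * g') * 1) (at s)"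
    by (rule field_vector_diff_chain_at)
  then have d: "((\<lambda>y. arcsin (?h y) + \<theta> s) has_vector_derivative Im (cnj (g s) * g')) (at s)"
    unfolding o_def using has_vector_derivative_add[OF _ has_vector_derivative_const] by fastforce
  obtain e where e: "e > 0" "\<And>y. \<bar>y - s\<bar> < e \<Longrightarrow> \<bar>\<theta> y - \<theta> s\<bar> < pi / 2"
    using \<theta> unfolding continuous_at_eps_delta dist_real_def by (metis pi_half_gt_zero)
  show ?thesis
  proof (rule has_vector_derivative_transform_within_open[OF d])
    show "open {s - e<..<s + e}" "s \<in> {s - e<..<s + e}" using e(1) by auto
    fix y assume "y \<in> {s - e<..<s + e}"
    then have "\<bar>\<theta> y - \<theta> s\<bar> < pi / 2" by (intro e(2)) auto
    then have "- (pi / 2) \<le> \<theta> y - \<theta> s" "\<theta> y - \<theta> s \<le> pi / 2" by linarith+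
    then show "arcsin (?h y) + \<theta> s = \<theta> y" unfolding h by (simp only: arcsin_sin)
  qed
qed

text \<open>A continuous logarithm exists because the domain is contractible. Derivatives along
  coordinate lines come from \<open>phase_has_vector_derivative\<close>; higher regularity is
  obtained later from the coefficients.\<close>

lemma phase_lift:
  fixes c :: "pt \<Rightarrow> complex"
  assumes cont: "continuous_on UNIV c" and h: "has_dt c" "has_d1 c" "has_d2 c"
    and unit: "\<And>x. cmod (c x) = 1" and init: "c (0, 0, 0) = 1"
  obtains \<theta> :: "pt \<Rightarrow> real" where "continuous_on UNIV \<theta>" "\<theta> (0, 0, 0) = 0" "\<And>x. c x = cis (\<theta> x)"
    "has_dt \<theta>" "has_d1 \<theta>" "has_d2 \<theta>"
proof -
  have "c x \<noteq> 0" if "x \<in> UNIV" for x using unit[of x] by auto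
  from continuous_logarithm_on_contractible[OF cont contractible_UNIV this]
  obtain l where l: "continuous_on UNIV l" "\<And>x. x \<in> UNIV \<Longrightarrow> c x = exp (l x)" by blast
  note l = l(1) l(2)[OF UNIV_I]
  have Re0: "Re (l x) = 0" for x using unit[of x] by (simp add: l(2))
  have cis_l: "c x = cis (Im (l x))" for x unfolding l(2) by (simp add: exp_eq_polar Re0)
  \<comment> \<open>That \<open>c\<close> is 1 at the origin only makes the initial angle a multiple
    of \<open>2 * pi\<close>; subtracting it leaves \<open>cis\<close> unchanged.\<close>
  define \<theta> where "\<theta> = (\<lambda>x. Im (l x) - Im (l (0, 0, 0)))"
  have \<theta>: "c x = cis (\<theta> x)" for x
    using cis_l[of "(0, 0, 0)"] cis_l[of x] init by (simp add: \<theta>_def cis_divide[symmetric])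
  have c\<theta>: "continuous_on UNIV \<theta>" unfolding \<theta>_def by (intro continuous_intros l)
  have iso: "isCont (\<lambda>s. \<theta> (s, x, y)) t" "isCont (\<lambda>s. \<theta> (t, s, y)) x" "isCont (\<lambda>s. \<theta> (t, x, s)) y" for t x y
  proof -
    have "isCont \<theta> (t, x, y)" using c\<theta> by (simp add: continuous_on_eq_continuous_at)
    then show "isCont (\<lambda>s. \<theta> (s, x, y)) t" "isCont (\<lambda>s. \<theta> (t, s, y)) x" "isCont (\<lambda>s. \<theta> (t, x, s)) y"
      by (auto intro!: isCont_o2[where g = \<theta>] continuous_intros)
  qed
  show thesis
  proof (rule that[OF c\<theta> _ \<theta>])
    show "\<theta> (0, 0, 0) = 0" by (simp add: \<theta>_def)
    show "has_dt \<theta>"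
      by (rule has_dtI(1), rule phase_has_vector_derivative[OF h(1)[unfolded has_dt_iff, rule_format] iso(1) \<theta>])
    show "has_d1 \<theta>"
      by (rule has_d1I(1), rule phase_has_vector_derivative[OF h(2)[unfolded has_d1_iff, rule_format] iso(2) \<theta>])
    show "has_d2 \<theta>"
      by (rule has_d2I(1), rule phase_has_vector_derivative[OF h(3)[unfolded has_d2_iff, rule_format] iso(3) \<theta>])
  qed
qed

lemma phase_partials:
  fixes \<theta> :: "pt \<Rightarrow> real"
  assumes h: "has_dt \<theta>" "has_d1 \<theta>" "has_d2 \<theta>"
  defines "C \<equiv> \<lambda>x. cis (\<theta> x)" and "\<phi> \<equiv> dz (\<lambda>y. of_real (\<theta> y))"
  shows "has_dt C" "has_d1 C" "has_d2 C" "dt C x = \<i> * of_real (dt \<theta> x) * C x"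
    "dz C x = \<i> * \<phi> x * C x" "dzb C x = \<i> * cnj (\<phi> x) * C x"
    "\<phi> x = of_real (d1 \<theta> x) - \<i> * of_real (d2 \<theta> x)"
proof -
  have C: "C = (\<lambda>x. exp (\<i> * of_real (\<theta> x)))" by (simp add: C_def cis_conv_exp)
  have hf: "has_dt (\<lambda>x. \<i> * complex_of_real (\<theta> x))" "has_d1 (\<lambda>x. \<i> * complex_of_real (\<theta> x))"
    "has_d2 (\<lambda>x. \<i> * complex_of_real (\<theta> x))"
    by (simp_all add: has_partials h)
  note chain = has_dt_field_chain[OF DERIV_exp hf(1)] has_d1_field_chain[OF DERIV_exp hf(2)]
    has_d2_field_chain[OF DERIV_exp hf(3)]
  show "has_dt C" "has_d1 C" "has_d2 C" unfolding C by (rule chain)+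
  have d: "dt C = (\<lambda>x. \<i> * of_real (dt \<theta> x) * C x)" "d1 C = (\<lambda>x. \<i> * of_real (d1 \<theta> x) * C x)"
    "d2 C = (\<lambda>x. \<i> * of_real (d2 \<theta> x) * C x)"
    unfolding C chain by (simp_all add: has_partials h)
  show \<phi>: "\<phi> x = of_real (d1 \<theta> x) - \<i> * of_real (d2 \<theta> x)"
    by (simp add: \<phi>_def dz_def has_partials h)
  show "dt C x = \<i> * of_real (dt \<theta> x) * C x" by (simp add: d)
  show "dz C x = \<i> * \<phi> x * C x" "dzb C x = \<i> * cnj (\<phi> x) * C x"
    unfolding dz_def dzb_def \<phi> by (simp_all add: d algebra_simps)
qed

text \<open>With \<open>C = cis \<theta>\<close> the new frame is \<open>G diag(C, cnj C)\<close>.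
  \<open>off_diag_q\<close> behaves as a covariant derivative: the derivative of the phase of
  \<open>q\<close> cancels against the shift of \<open>cnj p\<close>, so it picks up the same factor
  as \<open>q\<close>; likewise for \<open>r\<close>.\<close>

lemma frame_of_rotate:
  fixes \<theta> :: "pt \<Rightarrow> real"
  assumes h: "has_dt a" "has_d1 a" "has_d2 a" "has_dt b" "has_d1 b" "has_d2 b"
    and hq: "has_d1 q" "has_d2 q" "has_d1 r" "has_d2 r" and h\<theta>: "has_dt \<theta>" "has_d1 \<theta>" "has_d2 \<theta>"
    and f: "frame_of a b p q r u"
  shows "frame_of (\<lambda>x. a x * cis (\<theta> x)) (\<lambda>x. b x * cnj (cis (\<theta> x)))
      (\<lambda>x. p x - \<i> * dz (\<lambda>y. of_real (\<theta> y)) x) (\<lambda>x. cis (- 2 * \<theta> x) * q x) (\<lambda>x. cis (2 * \<theta> x) * r x)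
      (\<lambda>x. u x + dt \<theta> x)"
    and "spin (\<lambda>x. a x * cis (\<theta> x)) (\<lambda>x. b x * cnj (cis (\<theta> x))) = spin a b"
    and "off_diag_q (\<lambda>x. p x - \<i> * dz (\<lambda>y. of_real (\<theta> y)) x) (\<lambda>x. cis (- 2 * \<theta> x) * q x) =
      (\<lambda>x. cis (- 2 * \<theta> x) * off_diag_q p q x)"
    and "off_diag_r (\<lambda>x. p x - \<i> * dz (\<lambda>y. of_real (\<theta> y)) x) (\<lambda>x. cis (2 * \<theta> x) * r x) =
      (\<lambda>x. cis (2 * \<theta> x) * off_diag_r p r x)"
proof -
  define C where "C = (\<lambda>x. cis (\<theta> x))"
  define \<phi> where "\<phi> = dz (\<lambda>y. complex_of_real (\<theta> y))"
  have hC: "has_dt C" "has_d1 C" "has_d2 C" "dt C x = \<i> * of_real (dt \<theta> x) * C x"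
    "dz C x = \<i> * \<phi> x * C x" "dzb C x = \<i> * cnj (\<phi> x) * C x" for x
    unfolding C_def \<phi>_def using phase_partials(1-6)[OF h\<theta>] by simp_all
  have CC: "C x * cnj (C x) = 1" for x by (simp add: C_def cis_cnj cis_mult)
  then have CC': "cnj (C x) * C x = 1" for x by (simp add: mult.commute)
  have sq: "cis (- 2 * \<theta> x) = (cnj (C x))\<^sup>2" "cis (2 * \<theta> x) = (C x)\<^sup>2" for x
    by (simp_all add: C_def cis_cnj power2_eq_square cis_mult)
  \<comment> \<open>For a rotated frame entry times a rotated coefficient: of three phase factors
    two cancel, leaving that of the other frame entry.\<close>
  have cancel: "(A * z) * (w\<^sup>2 * y) = A * y * w" if "z * w = 1" for A z w y :: complex
  proof -
    have "(A * z) * (w\<^sup>2 * y) = A * y * w * (z * w)" by (simp add: power2_eq_square mult_ac)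
    then show ?thesis by (simp add: that)
  qed
  have sf: "space_frame a b p q r" and tf: "time_frame a b (off_diag_q p q) (off_diag_r p r) u"
    and uni: "unimodular a b"
    using f by (simp_all add: frame_of_def)
  note S = space_frameD[OF sf] and T = time_frameD[OF tf]
  let ?a = "\<lambda>x. a x * C x" and ?b = "\<lambda>x. b x * cnj (C x)" and ?p = "\<lambda>x. p x - \<i> * \<phi> x"
    and ?q = "\<lambda>x. (cnj (C x))\<^sup>2 * q x" and ?r = "\<lambda>x. (C x)\<^sup>2 * r x"
  have norms: "?a x * cnj (?a x) = a x * cnj (a x)" "?b x * cnj (?b x) = b x * cnj (b x)" "?a x * ?b x = a x * b x"
    "cnj (?a x) * cnj (?b x) = cnj (a x) * cnj (b x)" for x
  proof -
    have "?a x * cnj (?a x) = a x * cnj (a x) * (C x * cnj (C x))"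
      "?b x * cnj (?b x) = b x * cnj (b x) * (C x * cnj (C x))"
      "?a x * ?b x = a x * b x * (C x * cnj (C x))"
      "cnj (?a x) * cnj (?b x) = cnj (a x) * cnj (b x) * (C x * cnj (C x))"
      by (simp_all add: mult_ac)
    then show "?a x * cnj (?a x) = a x * cnj (a x)" "?b x * cnj (?b x) = b x * cnj (b x)" "?a x * ?b x = a x * b x"
      "cnj (?a x) * cnj (?b x) = cnj (a x) * cnj (b x)" by (simp_all only: CC mult_1_right)
  qed
  show spin: "spin (\<lambda>x. a x * cis (\<theta> x)) (\<lambda>x. b x * cnj (cis (\<theta> x))) = spin a b"
    unfolding C_def[THEN fun_cong, symmetric] by (rule ext) (simp only: spin_def norms)
  have sf': "space_frame ?a ?b ?p ?q ?r"
    unfolding space_frame_def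
    by (intro allI conjI)
      (simp_all only: complex_cnj_mult complex_cnj_power complex_cnj_cnj cancel[OF CC] cancel[OF CC'],
       simp_all add: dz_simps h hC S algebra_simps)
  have off: "off_diag_q ?p ?q = (\<lambda>x. (cnj (C x))\<^sup>2 * off_diag_q p q x)"
    "off_diag_r ?p ?r = (\<lambda>x. (C x)\<^sup>2 * off_diag_r p r x)"
    by (rule ext, simp add: power2_eq_square dz_simps hq hC algebra_simps)+
  show "off_diag_q (\<lambda>x. p x - \<i> * dz (\<lambda>y. of_real (\<theta> y)) x) (\<lambda>x. cis (- 2 * \<theta> x) * q x) =
      (\<lambda>x. cis (- 2 * \<theta> x) * off_diag_q p q x)"
    "off_diag_r (\<lambda>x. p x - \<i> * dz (\<lambda>y. of_real (\<theta> y)) x) (\<lambda>x. cis (2 * \<theta> x) * r x) =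
      (\<lambda>x. cis (2 * \<theta> x) * off_diag_r p r x)"
    using off unfolding sq \<phi>_def .
  have tf': "time_frame ?a ?b (off_diag_q ?p ?q) (off_diag_r ?p ?r) (\<lambda>x. u x + dt \<theta> x)"
    unfolding off time_frame_def
    by (intro allI conjI)
      (simp_all only: cancel[OF CC] cancel[OF CC'], simp_all add: has_partials h hC T algebra_simps)
  have "unimodular ?a ?b" using uni unfolding unimodular_def norms .
  then show "frame_of (\<lambda>x. a x * cis (\<theta> x)) (\<lambda>x. b x * cnj (cis (\<theta> x)))
      (\<lambda>x. p x - \<i> * dz (\<lambda>y. of_real (\<theta> y)) x) (\<lambda>x. cis (- 2 * \<theta> x) * q x) (\<lambda>x. cis (2 * \<theta> x) * r x)
      (\<lambda>x. u x + dt \<theta> x)"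
    unfolding sq unfolding frame_of_def using sf' tf' by (simp add: C_def \<phi>_def)
qed

text \<open>A frame determines its connection, since \<open>G\<close> is invertible:
  \<open>p\<close> and \<open>r\<close> come from \<open>dz a\<close> and the conjugate of
  \<open>dzb b\<close>, \<open>q\<close> from \<open>dz b\<close>, and \<open>u\<close> from
  \<open>dt a\<close> and the conjugate of \<open>dt b\<close>, which \<open>off\<close> turns into
  a system in the same unknowns.\<close>

lemma frame_of_coefficients_unique:
  assumes f: "frame_of a b p q r u" "frame_of a b p' q' r' u'"
    and off: "\<And>x. off_diag_r p r x = cnj (off_diag_q p q x)" "\<And>x. off_diag_r p' r' x = cnj (off_diag_q p' q' x)"
  shows "p = p'" "q = q'" "r = r'" "u = u'"
proof -
  have uni: "unimodular a b" using f(1) by (simp add: frame_of_def)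
  note ind = unimodular_rows_independent[OF unimodularD[OF uni]]
  have S: "space_frame a b p q r" "space_frame a b p' q' r'"
    "time_frame a b (off_diag_q p q) (off_diag_r p r) u" "time_frame a b (off_diag_q p' q') (off_diag_r p' r') u'"
    using f by (auto simp: frame_of_def)
  have "p x = p' x \<and> q x = q' x \<and> r x = r' x \<and> u x = u' x" for x
  proof -
    have e: "- (a x * p x + b x * r x) = - (a x * p' x + b x * r' x)"
      "- (a x * q x - b x * p x) = - (a x * q' x - b x * p' x)"
      "- (a x * cnj (r x)) - b x * cnj (p x) = - (a x * cnj (r' x)) - b x * cnj (p' x)"
      using S(1,2) unfolding space_frame_def by metis+
    have 1: "a x * (p x - p' x) + b x * (r x - r' x) = 0" using e(1) by (simp add: algebra_simps)
    have "cnj (- (a x * cnj (r x)) - b x * cnj (p x)) = cnj (- (a x * cnj (r' x)) - b x * cnj (p' x))"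
      by (simp only: e(3))
    then have 2: "cnj (b x) * (p x - p' x) + cnj (a x) * (r x - r' x) = 0" by (simp add: algebra_simps)
    have pr: "p x = p' x" "r x = r' x" using ind[OF 1 2] by simp_all
    have q: "q x = q' x" using e(2) unimodular_nonzero[OF uni, of x] by (simp add: pr)
    define B B' where "B = off_diag_q p q x" and "B' = off_diag_q p' q' x"
    have t: "\<i> * (a x * of_real (u x) + b x * cnj B) = \<i> * (a x * of_real (u' x) + b x * cnj B')"
      "- \<i> * (a x * B + b x * of_real (u x)) = - \<i> * (a x * B' + b x * of_real (u' x))"
      using S(3,4) unfolding time_frame_def off B_def B'_def by metis+
    let ?U = "complex_of_real (u x) - complex_of_real (u' x)"
    have "a x * of_real (u x) + b x * cnj B = a x * of_real (u' x) + b x * cnj B'" using t(1) by simp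
    then have 3: "a x * ?U + b x * cnj (B - B') = 0" by (simp add: algebra_simps)
    have "a x * B + b x * of_real (u x) = a x * B' + b x * of_real (u' x)" using t(2) by simp
    then have "cnj (a x * B + b x * of_real (u x)) = cnj (a x * B' + b x * of_real (u' x))" by (simp only:)
    then have 4: "cnj (b x) * ?U + cnj (a x) * cnj (B - B') = 0" by (simp add: algebra_simps)
    have "?U = 0" by (rule ind(1)[OF 3 4])
    then show ?thesis using pr q by simp
  qed
  then show "p = p'" "q = q'" "r = r'" "u = u'" by blast+
qed

text \<open>The stabiliser of \<open>sigma3\<close> in SU(1,1) is the diagonal U(1). The diagonal of
  \<open>S\<close> and unimodularity fix \<open>cmod (a x)\<close>, and the product
  \<open>a * b\<close> then forces the conjugate phase on \<open>b\<close>.\<close>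

lemma spin_eq_imp_phase:
  assumes uni: "unimodular a b" "unimodular a' b'" and eq: "spin a' b' = spin a b"
  shows "cmod (a' x * inverse (a x)) = 1" "b' x = b x * cnj (a' x * inverse (a x))"
proof -
  have u: "a x * cnj (a x) - b x * cnj (b x) = 1" "a' x * cnj (a' x) - b' x * cnj (b' x) = 1"
    using uni by (simp_all only: unimodularD)
  have "spin a' b' x = spin a b x" by (simp only: eq)
  then have s: "a' x * cnj (a' x) + b' x * cnj (b' x) = a x * cnj (a x) + b x * cnj (b x)"
    and ab: "a' x * b' x = a x * b x"
    by (simp_all add: spin_def mat2_eq_iff)
  have "2 * (a' x * cnj (a' x)) = (a' x * cnj (a' x) - b' x * cnj (b' x)) + (a' x * cnj (a' x) + b' x * cnj (b' x))"
    by simp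
  also have "\<dots> = 2 * (a x * cnj (a x))" unfolding s u(2) u(1)[symmetric] by simp
  finally have aa: "a' x * cnj (a' x) = a x * cnj (a x)" by simp
  have a0: "a x \<noteq> 0" "a' x \<noteq> 0" using unimodular_nonzero[OF uni(1)] unimodular_nonzero[OF uni(2)] by auto
  have "(cmod (a' x))\<^sup>2 = (cmod (a x))\<^sup>2"
    using aa unfolding complex_norm_square[symmetric] of_real_eq_iff .
  then have "cmod (a' x) = cmod (a x)" by simp
  then show "cmod (a' x * inverse (a x)) = 1" using a0 by (simp add: norm_mult norm_inverse)
  have "b' x = a x * b x * inverse (a' x)" using ab a0 by (simp add: field_simps)
  also have "a x * inverse (a' x) = cnj (a' x * inverse (a x))"
    using aa a0 by (simp add: field_simps)
  then have "a x * b x * inverse (a' x) = b x * cnj (a' x * inverse (a x))" by (simp add: mult_ac)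
  finally show "b' x = b x * cnj (a' x * inverse (a x))" .
qed

text \<open>Rotating the given frame by the relative phase yields the frame of
  \<open>(p', q', r', u')\<close> together with a second set of coefficients for it, and a frame has
  only one. Conversely the rotated frame is a gauge matrix for the new coefficients.\<close>

lemma corresponds_iff_U1_equivalent:
  assumes w: "w = 1 \<or> w = 2" and m: "2 \<le> m" and nls: "NLS_solution w m p q r u" "NLS_solution w m p' q' r' u'"
    and ab: "Ck w (m + 1) a" "Ck w (m + 1) b" and init: "a (0, 0, 0) = 1" "b (0, 0, 0) = 0"
    and f: "frame_of a b p q r u"
  shows "corresponds w p' q' r' u' (spin a b) \<longleftrightarrow> U1_equivalent w m p q r u p' q' r' u'"
proof
  have w0: "0 < w" "w \<le> 2" "w \<le> m + 1" using w m by auto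
  have c: "Ck w m p" "Ck w m q" "Ck w m r" "Ck w (m + 1 - w) u" "NLS p q r u"
    "Ck w m p'" "Ck w m q'" "Ck w m r'" "Ck w (m + 1 - w) u'" "NLS p' q' r' u'"
    using nls by (auto simp: NLS_solution_def)
  have "Ck 2 1 r" "Ck 2 1 r'"
    using Ck_mono[OF Ck_weight_2[OF w c(3)], of 1] Ck_mono[OF Ck_weight_2[OF w c(8)], of 1] m by auto
  note off = NLS_off_diag[OF this(1) c(5)] NLS_off_diag[OF this(2) c(10)]
  have h: "has_dt a" "has_d1 a" "has_d2 a" "has_dt b" "has_d1 b" "has_d2 b"
    using Ck_has_partials[OF ab(1) w0(1)] Ck_has_partials[OF ab(2) w0(1)] w0 by simp_all
  have hq: "has_d1 q" "has_d2 q" "has_d1 r" "has_d2 r"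
    using Ck_has_partials[OF c(2) w0(1)] Ck_has_partials[OF c(3) w0(1)] m by simp_all
  note rot = frame_of_rotate[OF h hq _ _ _ f]
  have ab2: "Ck w 2 a" "Ck w 2 b" using ab[THEN Ck_mono] w0 m by simp_all
  have uni: "unimodular a b" using f by (simp add: frame_of_def)
  {
    assume "corresponds w p' q' r' u' (spin a b)"
    then obtain a' b' where ab': "Ck w 2 a'" "Ck w 2 b'" "a' (0, 0, 0) = 1"
      "frame_of a' b' p' q' r' u'" "spin a' b' = spin a b"
      unfolding corresponds_iff[OF w m nls(2)] by metis
    have uni': "unimodular a' b'" using ab' by (simp add: frame_of_def)
    define c where "c = (\<lambda>x. a' x * inverse (a x))"
    have cc: "cmod (c x) = 1" "b' x = b x * cnj (c x)" for x
      unfolding c_def using spin_eq_imp_phase[OF uni uni' ab'(5)] by blast+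
    have a'_eq: "a' x = a x * c x" for x using unimodular_nonzero[OF uni, of x] by (simp add: c_def)
    have Cc: "Ck w 2 c" unfolding c_def
      by (intro Ck_mult Ck_inverse w0 ab2 ab' unimodular_nonzero[OF uni])
    have hc: "has_dt c" "has_d1 c" "has_d2 c" using Ck_has_partials[OF Cc w0(1)] w0 by simp_all
    have "c (0, 0, 0) = 1" by (simp add: c_def init ab')
    then obtain \<theta> where \<theta>: "continuous_on UNIV \<theta>" "\<theta> (0, 0, 0) = 0" "\<And>x. c x = cis (\<theta> x)"
      "has_dt \<theta>" "has_d1 \<theta>" "has_d2 \<theta>"
      using phase_lift[OF Ck_continuous[OF Cc] hc cc(1)] by metis
    have eqs: "a' = (\<lambda>x. a x * cis (\<theta> x))" "b' = (\<lambda>x. b x * cnj (cis (\<theta> x)))"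
      using a'_eq cc(2) \<theta>(3) by metis+
    note rotated = rot(1)[OF \<theta>(4-6), folded eqs]
    let ?p = "\<lambda>x. p x - \<i> * dz (\<lambda>y. of_real (\<theta> y)) x" and ?q = "\<lambda>x. cis (- 2 * \<theta> x) * q x"
      and ?r = "\<lambda>x. cis (2 * \<theta> x) * r x"
    have "off_diag_r ?p ?r x = cnj (off_diag_q ?p ?q x)" for x
    proof -
      have "off_diag_q ?p ?q x = cis (- 2 * \<theta> x) * off_diag_q p q x"
        by (rule rot(3)[OF \<theta>(4-6), THEN fun_cong])
      then have 1: "cnj (off_diag_q ?p ?q x) = cis (2 * \<theta> x) * cnj (off_diag_q p q x)"
        by (simp only: complex_cnj_mult cis_cnj) simp
      show ?thesis
        unfolding 1 off(1)[symmetric] by (rule rot(4)[OF \<theta>(4-6), THEN fun_cong])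
    qed
    note uniq = frame_of_coefficients_unique[OF rotated ab'(4) this off(2)]
    note P = uniq(1)[THEN fun_cong] uniq(2)[THEN fun_cong] uniq(3)[THEN fun_cong] uniq(4)[THEN fun_cong]
    \<comment> \<open>The competing frame is only of class \<open>Ck w 2\<close>, so the regularity
      of the angle comes from the coefficients: \<open>p' - p = - \<i> * dz \<theta>\<close> and
      \<open>u' - u = dt \<theta>\<close> have the classes \<open>m\<close> and
      \<open>m + 1 - w\<close>.\<close>
    have "d1 \<theta> x = Re (\<i> * (p' x - p x))" "d2 \<theta> x = - Im (\<i> * (p' x - p x))" for x
      using phase_partials(7)[OF \<theta>(4-6), of x] by (simp_all add: P(1)[of x, symmetric])
    then have d12: "d1 \<theta> = (\<lambda>x. Re (\<i> * (p' x - p x)))" "d2 \<theta> = (\<lambda>x. - Im (\<i> * (p' x - p x)))"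
      by blast+
    have dt: "dt \<theta> = (\<lambda>x. u' x - u x)" using P(4) by (auto simp: algebra_simps simp del: split_paired_All)
    have "Ck w m (d1 \<theta>)" "Ck w m (d2 \<theta>)" "Ck w (m + 1 - w) (dt \<theta>)"
      unfolding d12 dt
      by (intro Ck_Re Ck_Im Ck_minus Ck_mult Ck_diff Ck_const w0 c)+
    then have "Ck w (m + 1) \<theta>"
      using \<theta> w0 by (simp add: Ck_iff[of w "Suc m" \<theta>])
    then show "U1_equivalent w m p q r u p' q' r' u'"
      unfolding U1_equivalent_def using \<theta>(2) P by metis
  next
    assume "U1_equivalent w m p q r u p' q' r' u'"
    then obtain \<theta> where \<theta>: "Ck w (m + 1) \<theta>" "\<theta> (0, 0, 0) = 0"
      and "\<forall>x. p' x = p x - \<i> * dz (\<lambda>y. of_real (\<theta> y)) x \<and> q' x = cis (- 2 * \<theta> x) * q x \<and>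
             r' x = cis (2 * \<theta> x) * r x \<and> u' x = u x + dt \<theta> x"
      unfolding U1_equivalent_def by blast
    then have eqs: "p' = (\<lambda>x. p x - \<i> * dz (\<lambda>y. of_real (\<theta> y)) x)" "q' = (\<lambda>x. cis (- 2 * \<theta> x) * q x)"
      "r' = (\<lambda>x. cis (2 * \<theta> x) * r x)" "u' = (\<lambda>x. u x + dt \<theta> x)" by blast+
    have h\<theta>: "has_dt \<theta>" "has_d1 \<theta>" "has_d2 \<theta>" using Ck_has_partials[OF \<theta>(1) w0(1)] w0 by simp_all
    note r = rot[OF h\<theta>, folded eqs]
    have "Ck w (m + 1) (\<lambda>x. cis (\<theta> x))"
      unfolding cis_conv_exp by (intro Ck_exp Ck_mult Ck_const Ck_of_real \<theta> w0)
    then have C: "Ck w 2 (\<lambda>x. cis (\<theta> x))" by (rule Ck_mono) (use w0 m in auto)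
    show "corresponds w p' q' r' u' (spin a b)"
      unfolding corresponds_iff[OF w m nls(2)]
      by (rule exI[of _ "\<lambda>x. a x * cis (\<theta> x)"], rule exI[of _ "\<lambda>x. b x * cnj (cis (\<theta> x))"])
        (use r in \<open>simp add: init \<theta> Ck_mult Ck_cnj ab2 C w0\<close>)
  }
qed

text \<open>In the converse direction the value of \<open>S\<close> at the origin is forced by
  \<open>G = I\<close> there. \<open>S\<close> leaves the phase of the frame free, so uniqueness is
  up to \<open>U1_equivalent\<close>; the final equivalence says that nothing else is free.\<close>

theorem theorem2:
  fixes w :: nat
  assumes "w = 1 \<or> w = 2"
  shows
    "(\<forall>p q r u. NLS_solution w 2 p q r u \<longrightarrow>
        (\<exists>G S. Ck w 2 G \<and> gauge_transforms G p q r u S \<and> SM_solution_space w 3 S))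
     \<and>
     (\<forall>m\<ge>2.
        (\<forall>p q r u. NLS_solution w m p q r u \<longrightarrow>
           (\<exists>!S. SM_solution_space w (m + 1) S \<and> corresponds w p q r u S))
        \<and>
        (\<forall>S. SM_solution w (m + 1) S \<and> S (0, 0, 0) = cscale (- \<i>) sigma3 \<longrightarrow>
           (\<exists>p q r u. NLS_solution w m p q r u \<and> corresponds w p q r u S \<and>
              (\<forall>p' q' r' u'. NLS_solution w m p' q' r' u' \<longrightarrow>
                 (corresponds w p' q' r' u' S \<longleftrightarrow>
                  U1_equivalent w m p q r u p' q' r' u')))))"
proof (intro conjI allI impI)
  fix p q r u assume "NLS_solution w 2 p q r u"
  \<comment> \<open>Part (i) is the case \<open>m = 2\<close> of the normalised
    correspondence.\<close>
  from NLS_to_SM[OF assms order_refl this]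
  obtain S where "SM_solution_space w 3 S" "corresponds w p q r u S" by auto
  then show "\<exists>G S. Ck w 2 G \<and> gauge_transforms G p q r u S \<and> SM_solution_space w 3 S"
    unfolding corresponds_def by blast
next
  fix m :: nat and p q r u assume "2 \<le> m" "NLS_solution w m p q r u"
  then show "\<exists>!S. SM_solution_space w (m + 1) S \<and> corresponds w p q r u S"
    by (rule NLS_to_SM[OF assms])
next
  fix m :: nat and S assume m: "2 \<le> m"
    and "SM_solution w (m + 1) S \<and> S (0, 0, 0) = cscale (- \<i>) sigma3"
  then obtain a b p q r u where ab: "Ck w (m + 1) a" "Ck w (m + 1) b" "a (0, 0, 0) = 1" "b (0, 0, 0) = 0"
    "frame_of a b p q r u" and S: "S = spin a b" and nls: "NLS_solution w m p q r u"
    using SM_solution_frame[OF assms m] by metis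
  have "Ck w 2 a" "Ck w 2 b" using ab(1,2)[THEN Ck_mono] m assms by auto
  then have "corresponds w p q r u S"
    unfolding corresponds_iff[OF assms m nls] using ab S by blast
  then show "\<exists>p q r u. NLS_solution w m p q r u \<and> corresponds w p q r u S \<and>
      (\<forall>p' q' r' u'. NLS_solution w m p' q' r' u' \<longrightarrow>
         (corresponds w p' q' r' u' S \<longleftrightarrow> U1_equivalent w m p q r u p' q' r' u'))"
    using nls corresponds_iff_U1_equivalent[OF assms m nls _ ab] unfolding S by blast
qed

end
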